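(* Let $m_1,m_2\ge 2$ be two distinct integers and let $\alpha_1=[0;\overline{1,m_1}]$ and $\alpha_2=[0;\overline{1,m_2}]$. Let $\vartheta\in\mathbb{R}$ and $\beta\in\mathbb{R}$ with $m_2\beta\in\mathbb{R}\setminus\mathbb{Z}$. Then there exists $\delta>0$ such that, as $N\to\infty$, $$\sum_{0\le n<N} e\big(\vartheta S_{\alpha_1}(n)+\beta S_{\alpha_2}(n)\big)\ll N^{1-\delta},$$ where $\delta$ and the implied constant may depend on $m_1,m_2,\vartheta,\beta$ but not on $N$.
   Context: Notation: $e(x)=\exp(2\pi i x)$. For an integer $m\ge2$, $\alpha=[0;\overline{1,m}]$ denotes the irrational number in $(0,1)$ with purely periodic continued fraction expansion $[0;1,m,1,m,\dots]$, i.e. partial quotients $a_1=1,a_2=m,a_3=1,a_4=m,\dots$ (so $a_{i}=1$ for $i$ odd, $a_i=m$ for $i$ even). Its convergent denominators are $q_0=q_1=1$ and, for $i\ge2$, $q_i=mq_{i-1}+q_{i-2}$ if $i$ is even, $q_i=q_{i-1}+q_{i-2}$ if $i$ is odd. Every nonnegative integer $n$ has a unique Ostrowski $\alpha$-representation $n=\sum_{i\ge0}\varepsilon_i(n)q_i$ with integer digits satisfying: $0\le\varepsilon_0<a_1$ (so $\varepsilon_0=0$), $0\le \varepsilon_i\le a_{i+1}$ for $i\ge1$, and if $\varepsilon_i=a_{i+1}$ then $\varepsilon_{i-1}=0$ (equivalently $\sum_{0\le i<K}\varepsilon_i(n)q_i<q_K$ for all $K$). The Ostrowski sum-of-digits function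 is $S_\alpha(n)=\sum_{i\ge0}\varepsilon_i(n)$. $S_{\alpha_1}$ and $S_{\alpha_2}$ denote this function for $\alpha=\alpha_1$ (with $m=m_1$) and $\alpha=\alpha_2$ (with $m=m_2$) respectively. *)

theory Defs
  imports Complex_Main "HOL-Library.Landau_Symbols"
begin

fun cf_complete_quotient :: "real \<Rightarrow> nat \<Rightarrow> real" where
  "cf_complete_quotient x 0 = x"
| "cf_complete_quotient x (Suc i) = 1 / frac (cf_complete_quotient x i)"

definition cf_partial_quotient :: "real \<Rightarrow> nat \<Rightarrow> int" where
  "cf_partial_quotient x i = \<lfloor>cf_complete_quotient x i\<rfloor>"

definition has_cf_expansion :: "real \<Rightarrow> (nat \<Rightarrow> int) \<Rightarrow> bool" where
  "has_cf_expansion x a \<longleftrightarrow> x \<notin> \<rat> \<and> (\<forall>i. cf_partial_quotient x i = a i)"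

definition cf_1m :: "nat \<Rightarrow> nat \<Rightarrow> int" where
  "cf_1m m i = (if i = 0 then 0 else if odd i then 1 else int m)"

text \<open>In the Ostrowski numeration below, \<open>a\<close> is the sequence of partial quotients;
  only the values \<open>a i\<close> with \<open>i \<ge> 1\<close> matter.\<close>

fun cf_denom :: "(nat \<Rightarrow> nat) \<Rightarrow> nat \<Rightarrow> nat" where
  "cf_denom a 0 = 1"
| "cf_denom a (Suc 0) = a 1"
| "cf_denom a (Suc (Suc i)) = a (Suc (Suc i)) * cf_denom a (Suc i) + cf_denom a i"

definition ostrowski_admissible :: "(nat \<Rightarrow> nat) \<Rightarrow> (nat \<Rightarrow> nat) \<Rightarrow> bool" where
  "ostrowski_admissible a \<epsilon> \<longleftrightarrow>
     \<epsilon> 0 < a 1 \<and>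
     (\<forall>i\<ge>1. \<epsilon> i \<le> a (i + 1)) \<and>
     (\<forall>i\<ge>1. \<epsilon> i = a (i + 1) \<longrightarrow> \<epsilon> (i - 1) = 0)"

definition ostrowski_rep :: "(nat \<Rightarrow> nat) \<Rightarrow> nat \<Rightarrow> (nat \<Rightarrow> nat) \<Rightarrow> bool" where
  "ostrowski_rep a n \<epsilon> \<longleftrightarrow>
     ostrowski_admissible a \<epsilon> \<and> finite {i. \<epsilon> i \<noteq> 0} \<and>
     n = (\<Sum>i | \<epsilon> i \<noteq> 0. \<epsilon> i * cf_denom a i)"

definition ostrowski_digits :: "(nat \<Rightarrow> nat) \<Rightarrow> nat \<Rightarrow> nat \<Rightarrow> nat" where
  "ostrowski_digits a n = (THE \<epsilon>. ostrowski_rep a n \<epsilon>)"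

definition ostrowski_sum_of_digits :: "real \<Rightarrow> nat \<Rightarrow> nat" where
  "ostrowski_sum_of_digits \<alpha> n =
     (let \<epsilon> = ostrowski_digits (\<lambda>i. nat (cf_partial_quotient \<alpha> i)) n
      in \<Sum>i | \<epsilon> i \<noteq> 0. \<epsilon> i)"

definition unit_exp :: "real \<Rightarrow> complex" where
  "unit_exp x = exp (2 * complex_of_real pi * \<i> * complex_of_real x)"


lemma has_cf_expansion_cf_1m:
  assumes "m \<ge> 1"
  shows "has_cf_expansion ((sqrt (real m ^ 2 + 4 * real m) - real m) / 2) (cf_1m m)"
proof -
  define s where "s = sqrt (real m ^ 2 + 4 * real m)"
  define x where "x = (s - real m) / 2"
  have m: "real m \<ge> 1" using assms by simp
  have ssq: "s ^ 2 = real m ^ 2 + 4 * real m" and s0: "s \<ge> 0"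
    unfolding s_def by (auto intro!: real_sqrt_pow2 add_nonneg_nonneg)
  have "real m ^ 2 < s ^ 2" using ssq m by simp
  hence lo: "real m < s" using s0 by (rule power_less_imp_less_base)
  have "s ^ 2 < (real m + 2) ^ 2" unfolding ssq by (simp add: power2_eq_square algebra_simps)
  hence hi: "s < real m + 2" by (rule power_less_imp_less_base) simp
  have x0: "0 < x" and x1: "x < 1" using lo hi by (auto simp: x_def)
  have quad: "x * (x + real m) = real m"
  proof -
    have "x * (x + real m) = (s ^ 2 - real m ^ 2) / 4"
      by (simp add: x_def power2_eq_square field_simps)
    thus ?thesis using ssq by simp
  qed
  have inv: "1 / x = 1 + x / real m"
    using quad x0 m by (simp add: field_simps)
  have xm: "0 < x / real m" "x / real m < 1" using x0 x1 m by (auto simp: field_simps)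
  have inv2: "1 / (x / real m) = real m + x"
    using quad x0 m by (simp add: field_simps)
  have fl0: "\<lfloor>x\<rfloor> = 0" using x0 x1 by linarith
  have fl1: "\<lfloor>1 + x / real m\<rfloor> = 1" using xm by linarith
  have fl2: "\<lfloor>real m + x\<rfloor> = int m" using x0 x1 by linarith
  have fr: "frac x = x" "frac (1 + x / real m) = x / real m" "frac (real m + x) = x"
    unfolding frac_def fl0 fl1 fl2 by auto
  have cq: "cf_complete_quotient x (Suc (2 * k)) = 1 + x / real m \<and>
            cf_complete_quotient x (Suc (Suc (2 * k))) = real m + x" for k
    by (induction k) (auto simp: fr inv inv2 simp del: divide_divide_eq_right)
  have pq: "cf_partial_quotient x i = cf_1m m i" for i
  proof (cases "i = 0")
    case True
    thus ?thesis by (simp add: cf_partial_quotient_def cf_1m_def fl0)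
  next
    case i: False
    show ?thesis
    proof (cases "odd i")
      case True
      then obtain k where "i = Suc (2 * k)" by (auto elim: oddE)
      thus ?thesis using cq[of k] fl1
        by (simp add: cf_partial_quotient_def cf_1m_def del: cf_complete_quotient.simps)
    next
      case False
      then obtain j where "i = 2 * j" by auto
      with i obtain k where "i = Suc (Suc (2 * k))" by (cases j) auto
      thus ?thesis using cq[of k] fl2
        by (simp add: cf_partial_quotient_def cf_1m_def del: cf_complete_quotient.simps)
    qed
  qed
  have "x \<notin> \<rat>"
  proof
    assume "x \<in> \<rat>"
    hence "2 * x + real m \<in> \<rat>" by auto
    moreover have "2 * x + real m = s" by (simp add: x_def field_simps)
    ultimately have "s \<in> \<rat>" by simp
    moreover have "s = sqrt (real (m ^ 2 + 4 * m))" by (simp add: s_def)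
    ultimately have "sqrt (real (m ^ 2 + 4 * m)) \<in> \<rat>" by metis
    then obtain p q :: nat where q: "q \<noteq> 0" "coprime p q"
      and pq: "\<bar>sqrt (real (m ^ 2 + 4 * m))\<bar> = real p / real q"
      by (rule Rats_abs_nat_div_natE)
    have "real (m ^ 2 + 4 * m) = (real p / real q) ^ 2"
      unfolding pq[symmetric] by simp
    hence "real ((m ^ 2 + 4 * m) * q ^ 2) = real (p ^ 2)"
      using q(1) by (simp add: power_divide field_simps)
    hence eq: "(m ^ 2 + 4 * m) * q ^ 2 = p ^ 2" by (simp only: of_nat_eq_iff)
    hence "q ^ 2 dvd p ^ 2" by (metis dvd_triv_right)
    hence "q dvd p" by simp
    hence "q = 1" using q(2) by (metis coprime_absorb_right nat_dvd_1_iff_1)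
    hence p: "m ^ 2 + 4 * m = p ^ 2" using eq by simp
    have "m < p" using p assms by (intro power_less_imp_less_base[of m 2 p]) auto
    moreover have "p ^ 2 < (m + 2) ^ 2" using p by (simp add: power2_eq_square algebra_simps)
    hence "p < m + 2" by (rule power_less_imp_less_base) simp
    ultimately have "p = m + 1" by simp
    hence "2 * m = 1" using p by (simp add: power2_eq_square algebra_simps)
    thus False by presburger
  qed
  with pq show ?thesis unfolding has_cf_expansion_def x_def s_def by simp
qed

lemma cf_denom_pos:
  assumes "\<forall>i\<ge>1. a i \<ge> 1"
  shows "cf_denom a i > 0"
  using assms by (induction a i rule: cf_denom.induct) (auto simp: Suc_le_eq)

lemma cf_denom_le_Suc:
  assumes "\<forall>i\<ge>1. a i \<ge> 1"
  shows "cf_denom a i \<le> cf_denom a (Suc i)"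
proof (cases i)
  case 0
  thus ?thesis using assms by simp
next
  case (Suc j)
  have "1 * cf_denom a (Suc j) \<le> a (Suc (Suc j)) * cf_denom a (Suc j)"
    using assms by (intro mult_right_mono) auto
  thus ?thesis unfolding Suc cf_denom.simps by linarith
qed

lemma cf_denom_ge:
  assumes "\<forall>i\<ge>1. a i \<ge> 1"
  shows "Suc i \<le> cf_denom a (Suc i)"
proof (induction i)
  case 0
  thus ?case using assms by simp
next
  case (Suc i)
  have "1 * cf_denom a (Suc i) \<le> a (Suc (Suc i)) * cf_denom a (Suc i)"
    using assms by (intro mult_right_mono) auto
  moreover have "cf_denom a i > 0" using assms by (rule cf_denom_pos)
  ultimately have "cf_denom a (Suc i) < cf_denom a (Suc (Suc i))"
    unfolding cf_denom.simps by linarith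
  thus ?case using Suc by linarith
qed

lemma ostrowski_partial_sum_less:
  assumes "ostrowski_admissible a \<epsilon>"
  shows "(\<Sum>i<K. \<epsilon> i * cf_denom a i) < cf_denom a K"
proof (induction K rule: less_induct)
  case (less K)
  consider "K = 0" | "K = Suc 0" | k where "K = Suc (Suc k)"
    by (metis not0_implies_Suc)
  thus ?case
  proof cases
    case 1
    thus ?thesis by simp
  next
    case 2
    thus ?thesis using assms by (simp add: ostrowski_admissible_def)
  next
    case (3 k)
    have le: "\<epsilon> (Suc k) \<le> a (Suc (Suc k))"
      and z: "\<epsilon> (Suc k) = a (Suc (Suc k)) \<Longrightarrow> \<epsilon> k = 0"
      using assms by (force simp: ostrowski_admissible_def)+
    show ?thesis
    proof (cases "\<epsilon> (Suc k) = a (Suc (Suc k))")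
      case True
      thus ?thesis using z less.IH[of k] 3 by simp
    next
      case False
      hence "Suc (\<epsilon> (Suc k)) * cf_denom a (Suc k) \<le> a (Suc (Suc k)) * cf_denom a (Suc k)"
        using le by (intro mult_right_mono) auto
      thus ?thesis using less.IH[of "Suc k"] 3 by simp
    qed
  qed
qed

lemma ostrowski_rep_altdef:
  assumes "\<And>i. i \<ge> K \<Longrightarrow> \<epsilon> i = 0"
  shows "ostrowski_rep a n \<epsilon> \<longleftrightarrow>
    ostrowski_admissible a \<epsilon> \<and> n = (\<Sum>i<K. \<epsilon> i * cf_denom a i)"
proof -
  have sub: "{i. \<epsilon> i \<noteq> 0} \<subseteq> {..<K}"
    using assms by (metis (mono_tags, lifting) lessThan_iff mem_Collect_eq not_le subsetI)
  hence "finite {i. \<epsilon> i \<noteq> 0}" by (rule finite_subset) simp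
  moreover have "(\<Sum>i | \<epsilon> i \<noteq> 0. \<epsilon> i * cf_denom a i) = (\<Sum>i<K. \<epsilon> i * cf_denom a i)"
    using sub by (intro sum.mono_neutral_left) auto
  ultimately show ?thesis by (simp add: ostrowski_rep_def)
qed

lemma ostrowski_digits_eqI:
  assumes "\<forall>i\<ge>1. a i \<ge> 1"
    and "ostrowski_admissible a \<epsilon>" "ostrowski_admissible a \<epsilon>'"
    and "(\<Sum>i<K. \<epsilon> i * cf_denom a i) = (\<Sum>i<K. \<epsilon>' i * cf_denom a i)"
  shows "\<forall>i<K. \<epsilon> i = \<epsilon>' i"
  using assms(4)
proof (induction K)
  case 0
  thus ?case by simp
next
  case (Suc K)
  have top: "(\<Sum>i<Suc K. \<eta> i * cf_denom a i) div cf_denom a K = \<eta> K"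
    if "ostrowski_admissible a \<eta>" for \<eta>
    using ostrowski_partial_sum_less[OF that, of K] by simp
  have "\<epsilon> K = \<epsilon>' K" using top[OF assms(2)] top[OF assms(3)] Suc.prems by simp
  moreover from this have "\<forall>i<K. \<epsilon> i = \<epsilon>' i" using Suc by simp
  ultimately show ?case by (simp add: less_Suc_eq)
qed

lemma ostrowski_rep_exists:
  assumes a: "\<forall>i\<ge>1. a i \<ge> 1" and "n < cf_denom a K"
  shows "\<exists>\<epsilon>. ostrowski_admissible a \<epsilon> \<and> (\<forall>i\<ge>K. \<epsilon> i = 0) \<and>
             n = (\<Sum>i<K. \<epsilon> i * cf_denom a i)"
  using assms(2)
proof (induction K arbitrary: n rule: less_induct)
  case (less K)
  have a0: "a i > 0" if "i \<ge> 1" for i using a that by (simp add: Suc_le_eq)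
  consider "K = 0" | "K = Suc 0" | k where "K = Suc (Suc k)"
    by (metis not0_implies_Suc)
  thus ?case
  proof cases
    case 1
    thus ?thesis using less.prems a0
      by (intro exI[of _ "\<lambda>_. 0"]) (auto simp: ostrowski_admissible_def)
  next
    case 2
    have "a (Suc (Suc 0)) > 0" by (rule a0) simp
    thus ?thesis using less.prems 2
      by (intro exI[of _ "(\<lambda>_. 0)(0 := n)"]) (auto simp: ostrowski_admissible_def)
  next
    case (3 k)
    define Q where "Q = cf_denom a (Suc k)"
    define d where "d = n div Q"
    have Q: "Q > 0" unfolding Q_def using a by (rule cf_denom_pos)
    have n: "n = d * Q + n mod Q" by (simp add: d_def)
    have n_less: "n < a (Suc (Suc k)) * Q + cf_denom a k"
      using less.prems 3 by (simp add: Q_def)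
    also have "\<dots> \<le> (a (Suc (Suc k)) + 1) * Q"
      using cf_denom_le_Suc[of a k, OF a] by (simp add: Q_def)
    finally have d_le: "d \<le> a (Suc (Suc k))"
      unfolding d_def using Q by (simp add: less_mult_imp_div_less less_Suc_eq_le[symmetric])
    have "\<exists>\<epsilon>. ostrowski_admissible a \<epsilon> \<and> (\<forall>i\<ge>Suc k. \<epsilon> i = 0) \<and>
        n mod Q = (\<Sum>i<Suc k. \<epsilon> i * cf_denom a i) \<and> (d = a (Suc (Suc k)) \<longrightarrow> \<epsilon> k = 0)"
    proof (cases "d = a (Suc (Suc k))")
      case True
      hence "n mod Q < cf_denom a k" using n n_less by simp
      from less.IH[OF _ this] 3 obtain \<epsilon> where e: "ostrowski_admissible a \<epsilon>" "\<forall>i\<ge>k. \<epsilon> i = 0"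
        "n mod Q = (\<Sum>i<k. \<epsilon> i * cf_denom a i)" by auto
      thus ?thesis by (intro exI[of _ \<epsilon>]) auto
    next
      case False
      have "n mod Q < cf_denom a (Suc k)" using Q by (simp add: Q_def)
      from less.IH[OF _ this] 3 False show ?thesis by auto
    qed
    then obtain \<epsilon> where e: "ostrowski_admissible a \<epsilon>" "\<forall>i\<ge>Suc k. \<epsilon> i = 0"
        "n mod Q = (\<Sum>i<Suc k. \<epsilon> i * cf_denom a i)" "d = a (Suc (Suc k)) \<longrightarrow> \<epsilon> k = 0"
      by blast
    let ?e = "\<epsilon>(Suc k := d)"
    have nz: "a (Suc i) \<noteq> 0" for i using a0[of "Suc i"] by simp
    have "ostrowski_admissible a ?e"
      using e d_le unfolding ostrowski_admissible_def
      by (auto simp: Suc_le_eq nz)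
    moreover have "\<forall>i\<ge>K. ?e i = 0" using e(2) 3 by auto
    moreover have "n = (\<Sum>i<K. ?e i * cf_denom a i)"
      using n e(3) 3 by (simp add: Q_def)
    ultimately show ?thesis by blast
  qed
qed

lemma ostrowski_rep_ex1:
  assumes "\<forall>i\<ge>1. a i \<ge> 1"
  shows "\<exists>!\<epsilon>. ostrowski_rep a n \<epsilon>"
proof -
  have "n < cf_denom a (Suc n)" using cf_denom_ge[of a n, OF assms] by simp
  from ostrowski_rep_exists[OF assms this] obtain \<epsilon> where
    "ostrowski_admissible a \<epsilon>" "\<forall>i\<ge>Suc n. \<epsilon> i = 0"
    "n = (\<Sum>i<Suc n. \<epsilon> i * cf_denom a i)" by blast
  hence "ostrowski_rep a n \<epsilon>" using ostrowski_rep_altdef[of "Suc n" \<epsilon> a n] by blast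
  moreover have "\<epsilon> = \<epsilon>'" if r: "ostrowski_rep a n \<epsilon>" "ostrowski_rep a n \<epsilon>'" for \<epsilon> \<epsilon>'
  proof -
    have "finite ({i. \<epsilon> i \<noteq> 0} \<union> {i. \<epsilon>' i \<noteq> 0})"
      using r by (auto simp: ostrowski_rep_def)
    then obtain K where K: "\<forall>i\<in>{i. \<epsilon> i \<noteq> 0} \<union> {i. \<epsilon>' i \<noteq> 0}. i < K"
      using finite_nat_set_iff_bounded by metis
    have z: "\<epsilon> i = 0" "\<epsilon>' i = 0" if "i \<ge> K" for i
      using K that by (meson UnCI mem_Collect_eq not_le)+
    have adm: "ostrowski_admissible a \<epsilon>" "ostrowski_admissible a \<epsilon>'"
      using r by (simp_all add: ostrowski_rep_def)
    have "n = (\<Sum>i<K. \<epsilon> i * cf_denom a i)"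
      using r(1) ostrowski_rep_altdef[of K \<epsilon> a n] z(1) by blast
    moreover have "n = (\<Sum>i<K. \<epsilon>' i * cf_denom a i)"
      using r(2) ostrowski_rep_altdef[of K \<epsilon>' a n] z(2) by blast
    ultimately have "\<forall>i<K. \<epsilon> i = \<epsilon>' i"
      by (intro ostrowski_digits_eqI[OF assms adm]) simp
    thus ?thesis using z by (intro ext) (metis not_le)
  qed
  ultimately show ?thesis by blast
qed

corollary ostrowski_rep_digits:
  assumes "\<forall>i\<ge>1. a i \<ge> 1"
  shows "ostrowski_rep a n (ostrowski_digits a n)"
  unfolding ostrowski_digits_def using ostrowski_rep_ex1[OF assms] by (rule theI')

end

theory Submission
  imports Defs
begin

text \<open>
  Let \<open>\<alpha> = [0; 1, m, 1, m, \<dots>]\<close>. The increment \<open>S\<^sub>\<alpha>(z) - S\<^sub>\<alpha>(z - 1)\<close> depends only on the lowest nonzero digit of \<open>z\<close>,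
  hence only on \<open>z \<alpha>\<close> modulo 1: it is a step function whose jumps, of size \<open>m\<close> or 1, lie at the points \<open>- q\<^sub>l \<alpha>\<close>.
  Consequently, if \<open>z \<alpha>\<close> and \<open>z' \<alpha>\<close> are close to 0 modulo 1 from the left and from the right, then
  \<open>S\<^sub>\<alpha>(z' - i) - S\<^sub>\<alpha>(z - i)\<close> is, up to a constant, a step function of \<open>i\<close> alone, jumping at \<open>i = q\<^sub>l\<close>.

  Resonant case, where \<open>1, \<alpha>\<^sub>1, \<alpha>\<^sub>2\<close> are linearly dependent over the rationals. Then \<open>z \<alpha>\<^sub>1\<close> and \<open>z \<alpha>\<^sub>2\<close> can be made
  close to 0 simultaneously at every scale. Since \<open>m\<^sub>2 \<beta>\<close> is not an integer, the jumps of size \<open>m\<^sub>2\<close>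
  are felt, and those of the other step function cannot cancel them because the denominators of the two systems
  grow at different rates. So at every scale there are two long blocks which one and the same
  translation multiplies by different constants. This gives a constant factor at every scale, hence a power saving, uniformly in
  an additional linear phase. The case \<open>\<vartheta> = 0\<close> gives the same bound for one system.

  Nonresonant case. A quantitative Kronecker theorem yields \<open>d\<close> such that translation by \<open>e d\<close> acts like translation by 0 on
  the first system and by \<open>e\<close> on the second one, for all small \<open>e\<close>. Averaging over these translations and over short windows
  leads to bilinear sums in which the first system contributes arbitrary coefficients; they are
  controlled by the twisted sums of the second system alone.
\<close>

section \<open>Continued fraction denominators and phases\<close>

text \<open>A constant gain at every scale X needs numbers whose phases in both systems are O(1/X)
  inside every interval of length O(X). One quadratic irrational allows this: its expansions supply
  such numbers of either sign. Two independent ones in general ask for length of order X^2, so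
  independence calls for another argument. There a shift d as long as a fixed power of X is
  affordable, because only one scale, a small power of N, is used. That the power is fixed comes
  from a Liouville bound: a linear form in the two irrationals has four conjugates whose product is
  a nonzero integer.

  Uniformity in the linear phase is what links the two arguments: the bilinear sums with arbitrary
  coefficients are treated by Fourier expansion, so all frequencies of the second system enter.

  In the dependent case the sign matters too: a number just right of 0 in one system should be just
  right of 0 in the other. This is forced, since 2 \<alpha> + m is a positive square root and the
  relation survives conjugation.\<close>

declare cf_denom.simps [simp del]

definition pq :: "nat \<Rightarrow> nat \<Rightarrow> nat" where
  "pq m i = nat (cf_1m m i)"

abbreviation qd :: "nat \<Rightarrow> nat \<Rightarrow> nat" where
  "qd m \<equiv> cf_denom (pq m)"

text \<open>The positive root of x^2 + m x = m.\<close>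

definition alpha :: "nat \<Rightarrow> real" where
  "alpha m = (sqrt (real m ^ 2 + 4 * real m) - real m) / 2"

text \<open>The absolute value of \<open>q\<^sub>l \<alpha> - p\<^sub>l\<close>, in closed form.\<close>

definition abs_theta :: "nat \<Rightarrow> nat \<Rightarrow> real" where
  "abs_theta m l = (if even l then alpha m * (1 - alpha m) ^ (l div 2) else (1 - alpha m) ^ Suc (l div 2))"

definition theta :: "nat \<Rightarrow> nat \<Rightarrow> real" where
  "theta m l = (-1) ^ l * abs_theta m l"

text \<open>Congruence modulo 1, kept as a relation: the representative w may have either sign, and
  x may be a negative difference of natural numbers.\<close>

definition phase :: "nat \<Rightarrow> real \<Rightarrow> real \<Rightarrow> bool" where
  "phase m x w \<longleftrightarrow> x * alpha m - w \<in> \<int>"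

lemma phase_add: "phase m x w \<Longrightarrow> phase m y v \<Longrightarrow> phase m (x + y) (w + v)"
proof -
  assume "phase m x w" "phase m y v"
  hence "(x * alpha m - w) + (y * alpha m - v) \<in> \<int>" unfolding phase_def by (rule Ints_add)
  thus ?thesis unfolding phase_def by (simp add: algebra_simps)
qed

lemma phase_diff: "phase m x w \<Longrightarrow> phase m y v \<Longrightarrow> phase m (x - y) (w - v)"
proof -
  assume "phase m x w" "phase m y v"
  hence "(x * alpha m - w) - (y * alpha m - v) \<in> \<int>" unfolding phase_def by (rule Ints_diff)
  thus ?thesis unfolding phase_def by (simp add: algebra_simps)
qed

lemma phase_mult_nat: "phase m x w \<Longrightarrow> phase m (real k * x) (real k * w)"
proof -
  assume "phase m x w"
  hence "real k * (x * alpha m - w) \<in> \<int>" unfolding phase_def by (intro Ints_mult) auto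
  thus ?thesis unfolding phase_def by (simp add: algebra_simps)
qed

lemma phase_int: "n \<in> \<int> \<Longrightarrow> phase m x w \<Longrightarrow> phase m x (w + n)"
  unfolding phase_def by (metis Ints_diff diff_diff_eq)

lemma phase_0: "phase m 0 0" by (simp add: phase_def)

lemma phase_unique:
  assumes "phase m x w" "phase m x v" "\<bar>w - v\<bar> < 1"
  shows "w = v"
proof -
  have "(x * alpha m - v) - (x * alpha m - w) \<in> \<int>" using assms(1,2) unfolding phase_def by (metis Ints_diff)
  moreover have "(x * alpha m - v) - (x * alpha m - w) = w - v" by simp
  ultimately have "w - v \<in> \<int>" by metis
  then obtain i :: int where i: "w - v = of_int i" by (rule Ints_cases)
  with assms(3) have "\<bar>i\<bar> < 1" by linarith
  with i show ?thesis by simp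
qed

lemma qd_simps:
  "qd m 0 = 1" "qd m (Suc 0) = 1"
  "qd m (Suc (Suc l)) = (if even l then m else 1) * qd m (Suc l) + qd m l"
  by (simp_all add: pq_def cf_1m_def cf_denom.simps)

lemma pq_ge: "m \<ge> 1 \<Longrightarrow> \<forall>i\<ge>1. pq m i \<ge> 1"
  by (simp add: pq_def cf_1m_def)

lemma pq_Suc_Suc: "pq m (Suc (Suc l)) = (if even l then m else 1)"
  by (simp add: pq_def cf_1m_def)

context
  fixes m :: nat
  assumes m: "m \<ge> 1"
begin

lemma alpha_pos: "alpha m > 0" and alpha_lt1: "alpha m < 1" and alpha_sq: "alpha m ^ 2 = real m * (1 - alpha m)"
proof -
  define s where "s = sqrt (real m ^ 2 + 4 * real m)"
  have m1: "real m \<ge> 1" using m by simp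
  have ssq: "s ^ 2 = real m ^ 2 + 4 * real m" and s0: "s \<ge> 0"
    unfolding s_def by (auto intro!: real_sqrt_pow2 add_nonneg_nonneg)
  have "real m ^ 2 < s ^ 2" using ssq m1 by simp
  hence lo: "real m < s" using s0 by (rule power_less_imp_less_base)
  have "s ^ 2 < (real m + 2) ^ 2" unfolding ssq by (simp add: power2_eq_square algebra_simps)
  hence hi: "s < real m + 2" by (rule power_less_imp_less_base) simp
  have al: "alpha m = (s - real m) / 2" by (simp add: alpha_def s_def)
  show "alpha m > 0" "alpha m < 1" using lo hi by (auto simp: al)
  have "alpha m ^ 2 = (s ^ 2 - 2 * real m * s + real m ^ 2) / 4"
    by (simp add: al power2_eq_square field_simps)
  also have "\<dots> = real m * (1 - alpha m)" unfolding ssq al by (simp add: power2_eq_square field_simps)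
  finally show "alpha m ^ 2 = real m * (1 - alpha m)" .
qed

lemma alpha_irrational: "alpha m \<notin> \<rat>"
  using has_cf_expansion_cf_1m[OF m] by (simp add: has_cf_expansion_def alpha_def)

lemma mu_lt_alpha: "1 - alpha m < alpha m"
proof -
  have "1 * (1 - alpha m) \<le> real m * (1 - alpha m)" using m alpha_lt1 by (intro mult_right_mono) auto
  also have "\<dots> = alpha m * alpha m" using alpha_sq by (simp add: power2_eq_square)
  also have "\<dots> < alpha m * 1" using alpha_pos alpha_lt1 by (intro mult_strict_left_mono) auto
  finally show ?thesis by simp
qed

lemma abs_theta_pos: "abs_theta m l > 0"
  using alpha_pos alpha_lt1 by (simp add: abs_theta_def)

lemma abs_theta_rec: "abs_theta m (Suc (Suc l)) = abs_theta m l - real (pq m (Suc (Suc l))) * abs_theta m (Suc l)"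
proof (cases "even l")
  case True
  have "alpha m * (1 - alpha m) = alpha m - real m * (1 - alpha m)"
    using alpha_sq by (simp add: power2_eq_square algebra_simps)
  hence "(1 - alpha m) ^ (l div 2) * (alpha m * (1 - alpha m)) = (1 - alpha m) ^ (l div 2) * (alpha m - real m * (1 - alpha m))"
    by simp
  thus ?thesis using True by (simp add: abs_theta_def pq_Suc_Suc algebra_simps)
next
  case False
  then obtain k where l: "l = 2 * k + 1" by (auto elim: oddE)
  show ?thesis unfolding l by (simp add: abs_theta_def pq_Suc_Suc algebra_simps)
qed

lemma abs_theta_Suc_less: "abs_theta m (Suc l) < abs_theta m l"
proof (cases "even l")
  case True
  thus ?thesis using mu_lt_alpha alpha_lt1 by (simp add: abs_theta_def mult_strict_right_mono)
next
  case False
  then obtain k where l: "l = 2 * k + 1" by (auto elim: oddE)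
  show ?thesis unfolding l using alpha_lt1 by (simp add: abs_theta_def)
qed

lemma abs_theta_antimono: "l \<le> l' \<Longrightarrow> abs_theta m l' \<le> abs_theta m l"
  by (rule lift_Suc_antimono_le[of "abs_theta m"]) (auto intro: less_imp_le abs_theta_Suc_less)

lemma qd_pos: "qd m l > 0"
  using cf_denom_pos[OF pq_ge[OF m]] .

lemma qd_mono: "l \<le> l' \<Longrightarrow> qd m l \<le> qd m l'"
  by (rule lift_Suc_mono_le[of "qd m"]) (auto intro: cf_denom_le_Suc[OF pq_ge[OF m]])

lemma qd_Suc_less: "l \<ge> 1 \<Longrightarrow> qd m l < qd m (Suc l)"
proof -
  assume "l \<ge> 1"
  then obtain k where l: "l = Suc k" by (cases l) auto
  have "1 * qd m (Suc k) \<le> (if even k then m else 1) * qd m (Suc k)"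
    using m by (intro mult_right_mono) auto
  moreover have "qd m k > 0" by (rule qd_pos)
  ultimately show ?thesis unfolding l qd_simps(3)[of m k] by linarith
qed

lemma qd_strict_mono: "1 \<le> l \<Longrightarrow> l < l' \<Longrightarrow> qd m l < qd m l'"
  by (meson Suc_leI le_trans less_le_trans qd_Suc_less qd_mono)

lemma qd_inj: "1 \<le> l \<Longrightarrow> 1 \<le> l' \<Longrightarrow> qd m l = qd m l' \<Longrightarrow> l = l'"
  by (metis linorder_neqE_nat less_irrefl qd_strict_mono)

lemma qd_ge: "l \<le> qd m l"
  using cf_denom_ge[OF pq_ge[OF m]] by (cases l) auto

lemma qd_Suc_le: "qd m (Suc l) \<le> (m + 1) * qd m l"
proof (cases l)
  case 0 thus ?thesis using m by (simp add: qd_simps)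
next
  case (Suc k)
  have "qd m k \<le> qd m (Suc k)" by (rule qd_mono) simp
  moreover have "(if even k then m else 1) * qd m (Suc k) \<le> m * qd m (Suc k)"
    using m by (intro mult_right_mono) auto
  ultimately have "(if even k then m else 1) * qd m (Suc k) + qd m k \<le> m * qd m (Suc k) + qd m (Suc k)"
    by (rule add_mono[rotated])
  thus ?thesis unfolding Suc qd_simps(3)[of m k] by (simp add: algebra_simps)
qed

text \<open>Determinant identity of consecutive convergents, with the alternating signs absorbed
  into absolute values. It makes \<open>abs_theta m l\<close> comparable to the reciprocal of the
  next denominator.\<close>

lemma qd_abs_theta_det: "real (qd m (Suc l)) * abs_theta m l + real (qd m l) * abs_theta m (Suc l) = 1"
proof (induction l)
  case 0
  thus ?case using m by (simp add: qd_simps abs_theta_def)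
next
  case (Suc l)
  show ?case using Suc.IH unfolding abs_theta_rec[of l] qd_simps(3)[of m l] pq_Suc_Suc
    by (auto simp: algebra_simps)
qed

lemma qd_abs_theta_le: "real (qd m (Suc l)) * abs_theta m l \<le> 1"
  using qd_abs_theta_det[of l] abs_theta_pos[of "Suc l"] by (smt (verit) mult_nonneg_nonneg of_nat_0_le_iff)

lemma qd_abs_theta_ge: "real (qd m (Suc l)) * abs_theta m l \<ge> 1 / 2"
proof -
  have "real (qd m l) * abs_theta m (Suc l) \<le> real (qd m (Suc l)) * abs_theta m l"
    using qd_mono[of l "Suc l"] abs_theta_Suc_less[of l] abs_theta_pos[of "Suc l"] by (intro mult_mono) auto
  thus ?thesis using qd_abs_theta_det[of l] by linarith
qed

lemma phase_qd: "phase m (real (qd m l)) (theta m l)"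
proof (induction l rule: less_induct)
  case (less l)
  consider "l = 0" | "l = Suc 0" | k where "l = Suc (Suc k)"
    by (metis not0_implies_Suc)
  thus ?case
  proof cases
    case 3
    have "phase m (real (pq m l) * real (qd m (Suc k)) + real (qd m k)) (real (pq m l) * theta m (Suc k) + theta m k)"
      using 3 by (intro phase_add phase_mult_nat less.IH) auto
    thus ?thesis unfolding 3 by (simp add: theta_def abs_theta_rec cf_denom.simps algebra_simps)
  qed (simp_all add: qd_simps theta_def abs_theta_def phase_def)
qed

text \<open>For |w| < 1: the product of w and its conjugate is a nonzero integer, hence at least 1
  in absolute value, while the conjugate is at most (m + 3) k.\<close>

lemma dist_int_ge:
  assumes "k \<ge> (1::nat)" "phase m (real k) w"
  shows "\<bar>w\<bar> \<ge> 1 / (real (m + 3) * real k)"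
proof (cases "\<bar>w\<bar> < 1")
  case False
  have "1 / (real (m + 3) * real k) \<le> 1" using assms(1) by (simp add: mult_ge1_I)
  thus ?thesis using False by linarith
next
  case True
  from assms(2) obtain p where p: "real k * alpha m - w = of_int p" unfolding phase_def by (auto elim: Ints_cases)
  have w: "w = real k * alpha m - p" using p by simp
  \<comment> \<open>The conjugate of w: the other root of x^2 + m x = m is - m -
    \<open>alpha m\<close>.\<close>
  define w' where "w' = real k * (- real m - alpha m) - of_int p"
  have "w * w' = of_int (- int m * int k ^ 2 + int m * int k * p + p ^ 2)"
  proof -
    have "w * w' = real k ^ 2 * (- (alpha m ^ 2) - real m * alpha m) + real m * real k * p + of_int p ^ 2"
      unfolding w w'_def by (simp add: power2_eq_square algebra_simps)
    also have "- (alpha m ^ 2) - real m * alpha m = - real m" using alpha_sq by (simp add: algebra_simps)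
    finally show ?thesis by (simp add: algebra_simps)
  qed
  moreover have "w * w' \<noteq> 0"
  proof
    assume "w * w' = 0"
    hence "w = 0 \<or> w' = 0" by simp
    hence "alpha m = of_int p / real k \<or> alpha m = - real m - of_int p / real k"
      using assms(1) unfolding w w'_def by (auto simp: field_simps)
    hence "alpha m \<in> \<rat>" by (auto intro!: Rats_diff Rats_divide)
    thus False using alpha_irrational by simp
  qed
  ultimately have "1 \<le> \<bar>w * w'\<bar>" by (metis Ints_nonzero_abs_ge1 Ints_of_int)
  also have "\<dots> = \<bar>w\<bar> * \<bar>w'\<bar>" by (rule abs_mult)
  also have "\<bar>w'\<bar> \<le> real (m + 3) * real k"
  proof -
    have "w' = w - real k * (real m + 2 * alpha m)" unfolding w w'_def by (simp add: algebra_simps)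
    hence "\<bar>w'\<bar> \<le> \<bar>w\<bar> + real k * (real m + 2 * alpha m)"
      using alpha_pos by (smt (verit) mult_nonneg_nonneg of_nat_0_le_iff)
    also have "\<dots> \<le> real k * 1 + real k * (real m + 2 * 1)"
      using True assms(1) alpha_lt1 by (intro add_mono mult_left_mono) auto
    finally show ?thesis by (simp add: algebra_simps)
  qed
  finally have "1 \<le> \<bar>w\<bar> * (real (m + 3) * real k)" by (simp add: mult_left_mono)
  thus ?thesis using assms(1) by (simp add: divide_le_eq)
qed

end

section \<open>Increments of the digit sum\<close>

definition digit_sum :: "nat \<Rightarrow> nat \<Rightarrow> nat" where
  "digit_sum m n = (let \<epsilon> = ostrowski_digits (pq m) n in \<Sum>i | \<epsilon> i \<noteq> 0. \<epsilon> i)"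

definition digit_incr :: "nat \<Rightarrow> nat \<Rightarrow> int" where
  "digit_incr m z = int (digit_sum m z) - int (digit_sum m (z - 1))"

text \<open>The digit sum sees \<alpha> only through its partial quotients, so the given number can
  be replaced by the closed form \<open>alpha m\<close> without proving the two equal.\<close>

lemma ostrowski_sum_of_digits_eq:
  assumes "has_cf_expansion \<alpha> (cf_1m m)"
  shows "ostrowski_sum_of_digits \<alpha> = digit_sum m"
proof -
  have "(\<lambda>i. nat (cf_partial_quotient \<alpha> i)) = pq m"
    using assms by (auto simp: has_cf_expansion_def pq_def)
  thus ?thesis by (intro ext) (simp add: ostrowski_sum_of_digits_def digit_sum_def)
qed

text \<open>The digits of \<open>q\<^sub>l - 1\<close>.\<close>

definition pred_digits :: "nat \<Rightarrow> nat \<Rightarrow> nat \<Rightarrow> nat" where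
  "pred_digits m l i = (if 1 \<le> i \<and> i < l \<and> odd (l - i) then pq m (Suc i) else 0)"

lemma sum_pred_digits_step:
  "(\<Sum>i<Suc (Suc l). pred_digits m (Suc (Suc l)) i * c i)
     = (\<Sum>i<l. pred_digits m l i * c i) + pq m (Suc (Suc l)) * (c (Suc l) :: nat)"
proof -
  have "(\<Sum>i<l. pred_digits m (Suc (Suc l)) i * c i) = (\<Sum>i<l. pred_digits m l i * c i)"
    by (intro sum.cong) (auto simp: pred_digits_def Suc_diff_le)
  moreover have "pred_digits m (Suc (Suc l)) l = 0" "pred_digits m (Suc (Suc l)) (Suc l) = pq m (Suc (Suc l))"
    by (auto simp: pred_digits_def)
  ultimately show ?thesis by simp
qed

lemma minus_one_power_theta:
  "(-1) ^ j * (x * theta m j + r) = x * abs_theta m j - (-1) ^ Suc j * r"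
proof -
  have "(-1) ^ j * (-1) ^ j = (1::real)" by (simp flip: power_mult_distrib)
  hence "(-1) ^ j * (-1) ^ j * (x * abs_theta m j) = x * abs_theta m j" by simp
  thus ?thesis by (simp add: theta_def algebra_simps)
qed

lemma sum_pred_digits_even: "(\<Sum>i<2 * k. pred_digits m (2 * k) i) = m * k"
proof (induction k)
  case (Suc k)
  show ?case using sum_pred_digits_step[of m "2 * k" "\<lambda>_. 1"] Suc.IH by (simp add: pq_Suc_Suc)
qed simp

lemma sum_pred_digits_odd: "(\<Sum>i<Suc (2 * k). pred_digits m (Suc (2 * k)) i) = k"
proof (induction k)
  case 0
  show ?case by (simp add: pred_digits_def)
next
  case (Suc k)
  show ?case using sum_pred_digits_step[of m "Suc (2 * k)" "\<lambda>_. 1"] Suc.IH by (simp add: pq_Suc_Suc)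
qed

lemma sum_pred_digits_qd: "(\<Sum>i<l. pred_digits m l i * qd m i) + 1 = qd m l"
proof (induction l rule: less_induct)
  case (less l)
  consider "l = 0" | "l = Suc 0" | k where "l = Suc (Suc k)"
    by (metis not0_implies_Suc)
  thus ?case
  proof cases
    case (3 k)
    show ?thesis unfolding 3 using sum_pred_digits_step[of m k "qd m"] less.IH[of k] 3 by (simp add: cf_denom.simps)
  qed (simp_all add: pred_digits_def qd_simps)
qed

section \<open>The increment as a step function of the phase\<close>

context
  fixes m :: nat
  assumes m: "m \<ge> 1"
begin

lemma digit_sum_eq:
  assumes "ostrowski_admissible (pq m) \<epsilon>" "\<And>i. i \<ge> K \<Longrightarrow> \<epsilon> i = 0"
  shows "digit_sum m (\<Sum>i<K. \<epsilon> i * qd m i) = (\<Sum>i<K. \<epsilon> i)"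
proof -
  let ?n = "\<Sum>i<K. \<epsilon> i * qd m i"
  have "ostrowski_rep (pq m) ?n \<epsilon>"
    using ostrowski_rep_altdef[of K \<epsilon> "pq m" ?n] assms by blast
  hence "ostrowski_digits (pq m) ?n = \<epsilon>"
    unfolding ostrowski_digits_def using ostrowski_rep_ex1[OF pq_ge[OF m]] by (intro the1_equality) auto
  moreover have "(\<Sum>i | \<epsilon> i \<noteq> 0. \<epsilon> i) = (\<Sum>i<K. \<epsilon> i)"
    using assms(2) by (intro sum.mono_neutral_left) (auto simp: subset_iff intro: ccontr)
  ultimately show ?thesis by (simp add: digit_sum_def)
qed

lemma digits_exist:
  obtains \<epsilon> K where "ostrowski_admissible (pq m) \<epsilon>" "\<And>i. i \<ge> K \<Longrightarrow> \<epsilon> i = 0"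
    "n = (\<Sum>i<K. \<epsilon> i * qd m i)" "K \<ge> K0"
proof -
  define K where "K = max K0 (Suc n)"
  have "n < qd m (Suc n)" using qd_ge[OF m, of "Suc n"] by simp
  also have "\<dots> \<le> qd m K" unfolding K_def by (intro qd_mono[OF m]) simp
  finally show ?thesis
    using ostrowski_rep_exists[OF pq_ge[OF m], of n K] that[of _ K] unfolding K_def by auto
qed

text \<open>By \<open>abs_theta_rec\<close> the extreme tails, with the maximal digit at every
  second place, telescope. A nonzero digit at j forbids the maximal digit at j + 1, which costs one
  more \<open>abs_theta m (Suc j)\<close>; this sharpening separates the phase intervals of
  different lowest digits.\<close>

lemma admissible_tail_bounds:
  assumes adm: "ostrowski_admissible (pq m) \<epsilon>" and "Suc j \<le> K"
  shows "- abs_theta m (Suc j) < (-1) ^ Suc j * (\<Sum>i=Suc j..<K. real (\<epsilon> i) * theta m i) \<and>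
     (-1) ^ Suc j * (\<Sum>i=Suc j..<K. real (\<epsilon> i) * theta m i) < abs_theta m j \<and>
     (\<epsilon> j \<ge> 1 \<longrightarrow> (-1) ^ Suc j * (\<Sum>i=Suc j..<K. real (\<epsilon> i) * theta m i) < abs_theta m j - abs_theta m (Suc j))"
  using assms(2)
proof (induction "K - Suc j" arbitrary: j)
  case 0
  thus ?case using abs_theta_pos[OF m] abs_theta_Suc_less[OF m, of j] by simp
next
  case (Suc d)
  define t where "t = (-1) ^ Suc (Suc j) * (\<Sum>i=Suc (Suc j)..<K. real (\<epsilon> i) * theta m i)"
  have IH: "- abs_theta m (Suc (Suc j)) < t" "t < abs_theta m (Suc j)"
     "\<epsilon> (Suc j) \<ge> 1 \<Longrightarrow> t < abs_theta m (Suc j) - abs_theta m (Suc (Suc j))"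
    using Suc.hyps(1)[of "Suc j"] Suc.hyps(2) unfolding t_def by auto
  have "(\<Sum>i=Suc j..<K. real (\<epsilon> i) * theta m i)
      = real (\<epsilon> (Suc j)) * theta m (Suc j) + (\<Sum>i=Suc (Suc j)..<K. real (\<epsilon> i) * theta m i)"
    using Suc.hyps(2) by (intro sum.atLeast_Suc_lessThan) simp
  hence eq: "(-1) ^ Suc j * (\<Sum>i=Suc j..<K. real (\<epsilon> i) * theta m i) = real (\<epsilon> (Suc j)) * abs_theta m (Suc j) - t"
    unfolding t_def by (simp only: minus_one_power_theta)
  have le: "\<epsilon> (Suc j) \<le> pq m (Suc (Suc j))"
    and z: "\<epsilon> j \<ge> 1 \<Longrightarrow> \<epsilon> (Suc j) \<noteq> pq m (Suc (Suc j))"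
    using adm by (force simp: ostrowski_admissible_def)+
  have p: "abs_theta m (Suc j) > 0" "abs_theta m (Suc (Suc j)) > 0" by (rule abs_theta_pos[OF m])+
  have lower: "- abs_theta m (Suc j) < real (\<epsilon> (Suc j)) * abs_theta m (Suc j) - t"
    using IH(2) p(1) by (smt (verit) mult_nonneg_nonneg of_nat_0_le_iff)
  have "real (\<epsilon> (Suc j)) * abs_theta m (Suc j) \<le> real (pq m (Suc (Suc j))) * abs_theta m (Suc j)"
    using le p by (intro mult_right_mono) auto
  hence upper: "real (\<epsilon> (Suc j)) * abs_theta m (Suc j) - t < abs_theta m j"
    using IH(1) abs_theta_rec[OF m, of j] by linarith
  have "real (\<epsilon> (Suc j)) * abs_theta m (Suc j) - t < abs_theta m j - abs_theta m (Suc j)" if "\<epsilon> j \<ge> 1"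
  proof -
    have "real (\<epsilon> (Suc j) + 1) * abs_theta m (Suc j) \<le> real (pq m (Suc (Suc j))) * abs_theta m (Suc j)"
      using le z[OF that] p by (intro mult_right_mono) auto
    thus ?thesis using IH(1) abs_theta_rec[OF m, of j] by (simp add: algebra_simps)
  qed
  thus ?case unfolding eq using lower upper by blast
qed

lemma phase_sum_digits: "phase m (real (\<Sum>i<K. \<epsilon> i * qd m i)) (\<Sum>i<K. real (\<epsilon> i) * theta m i)"
proof (induction K)
  case (Suc K)
  have "phase m (real (\<epsilon> K) * real (qd m K)) (real (\<epsilon> K) * theta m K)"
    by (intro phase_mult_nat phase_qd[OF m])
  from phase_add[OF Suc.IH this] show ?case by simp
qed (simp add: phase_0)

lemma phase_lowest_digit:
  assumes adm: "ostrowski_admissible (pq m) \<epsilon>"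
    and l: "\<epsilon> (Suc j) \<ge> 1" "\<And>i. i \<le> j \<Longrightarrow> \<epsilon> i = 0" "Suc j < K"
  obtains w where "phase m (real (\<Sum>i<K. \<epsilon> i * qd m i)) w"
    "abs_theta m (Suc (Suc j)) < (-1) ^ Suc j * w" "(-1) ^ Suc j * w < abs_theta m j"
proof -
  define w where "w = (\<Sum>i<K. real (\<epsilon> i) * theta m i)"
  define t where "t = (-1) ^ Suc (Suc j) * (\<Sum>i=Suc (Suc j)..<K. real (\<epsilon> i) * theta m i)"
  have w2: "w = (\<Sum>i=Suc j..<K. real (\<epsilon> i) * theta m i)"
    unfolding w_def using l(2) by (intro sum.mono_neutral_right) (auto simp: not_less_eq_eq)
  also have "\<dots> = real (\<epsilon> (Suc j)) * theta m (Suc j) + (\<Sum>i=Suc (Suc j)..<K. real (\<epsilon> i) * theta m i)"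
    using l(3) by (intro sum.atLeast_Suc_lessThan) simp
  finally have w1: "(-1) ^ Suc j * w = real (\<epsilon> (Suc j)) * abs_theta m (Suc j) - t"
    unfolding t_def by (simp only: minus_one_power_theta)
  have "t < abs_theta m (Suc j) - abs_theta m (Suc (Suc j))"
    using admissible_tail_bounds[OF adm, of "Suc j" K] l unfolding t_def by auto
  moreover have "1 * abs_theta m (Suc j) \<le> real (\<epsilon> (Suc j)) * abs_theta m (Suc j)"
    using l(1) abs_theta_pos[OF m] by (intro mult_right_mono) (auto intro: less_imp_le)
  ultimately have "abs_theta m (Suc (Suc j)) < (-1) ^ Suc j * w" unfolding w1 by linarith
  moreover have "(-1) ^ Suc j * w < abs_theta m j"
    using admissible_tail_bounds[OF adm, of j K] l(3) unfolding w2 by auto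
  ultimately show ?thesis using that phase_sum_digits unfolding w_def by blast
qed

text \<open>Subtracting 1 borrows from the lowest nonzero digit: one \<open>q\<^sub>l\<close> is
  replaced by the expansion of \<open>q\<^sub>l\<close> - 1. The new digits are admissible because
  digit l drops below its maximum and digit l + 1 was not maximal.\<close>

lemma digit_incr_lowest_digit:
  assumes adm: "ostrowski_admissible (pq m) \<epsilon>"
    and l: "\<epsilon> l \<ge> 1" "\<And>i. i < l \<Longrightarrow> \<epsilon> i = 0" "l \<ge> 1"
    and K: "\<And>i. i \<ge> K \<Longrightarrow> \<epsilon> i = 0"
  shows "digit_incr m (\<Sum>i<K. \<epsilon> i * qd m i) = 1 - int (\<Sum>i<l. pred_digits m l i)"
proof -
  have lK: "l < K" using K[of l] l(1) by (metis not_le not_one_le_zero)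
  define e where "e i = (if i < l then pred_digits m l i else if i = l then \<epsilon> l - 1 else \<epsilon> i)" for i
  have pq1: "pq m (Suc i) \<ge> 1" for i using pq_ge[OF m] by simp
  have le: "\<epsilon> i \<le> pq m (Suc i)" if "i \<ge> 1" for i using adm that by (simp add: ostrowski_admissible_def)
  have zero: "\<epsilon> (i - 1) = 0" if "i \<ge> 1" "\<epsilon> i = pq m (Suc i)" for i
    using adm that by (simp add: ostrowski_admissible_def)
  have adm': "ostrowski_admissible (pq m) e"
    unfolding ostrowski_admissible_def
  proof (intro conjI allI impI)
    show "e 0 < pq m 1" using l(3) pq1[of 0] by (simp add: e_def pred_digits_def)
  next
    fix i :: nat assume "i \<ge> 1"
    thus "e i \<le> pq m (i + 1)" using le[of i] by (auto simp: e_def pred_digits_def)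
  next
    fix i :: nat assume i: "i \<ge> 1" and eq: "e i = pq m (i + 1)"
    consider "i < l" | "i = l" | "i > l" by linarith
    thus "e (i - 1) = 0"
    proof cases
      case 1
      hence "odd (l - i)" using eq pq1[of i] by (auto simp: e_def pred_digits_def split: if_splits)
      moreover have "l - (i - 1) = Suc (l - i)" using 1 i by simp
      ultimately have "even (l - (i - 1))" by simp
      moreover have "i - 1 < l" using 1 by simp
      ultimately show ?thesis unfolding e_def pred_digits_def by presburger
    next
      case 2
      hence "\<epsilon> l - 1 = pq m (Suc l)" using eq by (simp add: e_def)
      thus ?thesis using le[of l] l(1) i 2 by linarith
    next
      case 3
      hence "\<epsilon> (i - 1) = 0" using eq zero i by (simp add: e_def)
      thus ?thesis using l(1) 3 by (auto simp: e_def)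
    qed
  qed
  have split: "(\<Sum>i<K. g i) = (\<Sum>i<l. g i) + g l + (\<Sum>i=Suc l..<K. g i)" for g :: "nat \<Rightarrow> nat"
  proof -
    have "(\<Sum>i<K. g i) = (\<Sum>i<l. g i) + (\<Sum>i=l..<K. g i)"
      using lK by (simp add: lessThan_atLeast0 sum.atLeastLessThan_concat)
    thus ?thesis using lK by (simp add: sum.atLeast_Suc_lessThan)
  qed
  have e_lt: "(\<Sum>i<l. e i * c i) = (\<Sum>i<l. pred_digits m l i * c i)"
    and e_gt: "(\<Sum>i=Suc l..<K. e i * c i) = (\<Sum>i=Suc l..<K. \<epsilon> i * c i)"
    and eps_lt: "(\<Sum>i<l. \<epsilon> i * c i) = 0" for c :: "nat \<Rightarrow> nat"
    by (auto simp: e_def l(2) intro!: sum.cong sum.neutral)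
  have el: "e l = \<epsilon> l - 1" by (simp add: e_def)
  have val: "(\<Sum>i<K. e i * qd m i) = (\<Sum>i<K. \<epsilon> i * qd m i) - 1"
  proof -
    have "\<epsilon> l * qd m l = (\<epsilon> l - 1) * qd m l + qd m l"
      using l(1) by (simp add: diff_mult_distrib)
    thus ?thesis
      unfolding split e_lt e_gt eps_lt el using sum_pred_digits_qd[of m l] by linarith
  qed
  have K': "e i = 0" if "i \<ge> K" for i using K[OF that] that lK by (simp add: e_def)
  have "digit_sum m ((\<Sum>i<K. \<epsilon> i * qd m i) - 1) = (\<Sum>i<K. e i)"
    using digit_sum_eq[OF adm' K', of K] unfolding val by simp
  moreover have "digit_sum m (\<Sum>i<K. \<epsilon> i * qd m i) = (\<Sum>i<K. \<epsilon> i)" by (rule digit_sum_eq[OF adm K])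
  moreover have "int (\<Sum>i<K. \<epsilon> i) - int (\<Sum>i<K. e i) = 1 - int (\<Sum>i<l. pred_digits m l i)"
    unfolding split using e_lt[of "\<lambda>_. 1"] e_gt[of "\<lambda>_. 1"] eps_lt[of "\<lambda>_. 1"] el l(1) by simp
  ultimately show ?thesis unfolding digit_incr_def by simp
qed

text \<open>Lowest digits at even places put the phase right of 0, those at odd places left of 0. On
  each side the intervals are adjacent, and together they fill the range from -
  \<open>alpha m\<close> to 1 - \<open>alpha m\<close>, one full period.\<close>

lemma digit_incr_cases:
  assumes "z \<ge> 1"
  obtains (pos) k w where "k \<ge> 1" "phase m (real z) w" "(1 - alpha m) ^ Suc k < w" "w < (1 - alpha m) ^ k"
      "digit_incr m z = 1 - int (m * k)"
    | (neg) k w where "phase m (real z) w" "alpha m * (1 - alpha m) ^ Suc k < - w" "- w < alpha m * (1 - alpha m) ^ k"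
      "digit_incr m z = 1 - int k"
proof -
  obtain \<epsilon> K where e: "ostrowski_admissible (pq m) \<epsilon>" "\<And>i. i \<ge> K \<Longrightarrow> \<epsilon> i = 0"
    "z = (\<Sum>i<K. \<epsilon> i * qd m i)" "K \<ge> 0" by (rule digits_exist[of z 0]) blast
  have ex: "\<exists>i. \<epsilon> i \<noteq> 0"
  proof (rule ccontr)
    assume "\<not> ?thesis"
    hence "z = 0" unfolding e(3) by simp
    thus False using assms by simp
  qed
  define l where "l = (LEAST i. \<epsilon> i \<noteq> 0)"
  have l: "\<epsilon> l \<noteq> 0" unfolding l_def using ex by (rule LeastI_ex)
  have l0: "\<epsilon> i = 0" if "i < l" for i using not_less_Least[of i "\<lambda>i. \<epsilon> i \<noteq> 0"] that by (auto simp: l_def)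
  have "\<epsilon> 0 = 0" using e(1) by (simp add: ostrowski_admissible_def pq_def cf_1m_def)
  hence l1: "l \<ge> 1" using l by (cases l) auto
  have lK: "l < K" using e(2)[of l] l by (metis not_le)
  have Dz: "digit_incr m z = 1 - int (\<Sum>i<l. pred_digits m l i)"
    unfolding e(3) using l l0 l1 e(1,2) by (intro digit_incr_lowest_digit) auto
  obtain j where j: "l = Suc j" using l1 by (cases l) auto
  obtain w where w: "phase m (real z) w" "abs_theta m (Suc (Suc j)) < (-1) ^ Suc j * w" "(-1) ^ Suc j * w < abs_theta m j"
  proof (rule phase_lowest_digit[OF e(1)])
    show "\<epsilon> (Suc j) \<ge> 1" using l j by simp
    show "\<epsilon> i = 0" if "i \<le> j" for i using l0[of i] that j by simp
    show "Suc j < K" using lK j by simp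
  qed (use that e(3) in blast)
  show ?thesis
  proof (cases "even l")
    case True
    then obtain k where k: "l = 2 * k" by auto
    with l1 obtain k' where k': "k = Suc k'" by (cases k) auto
    have j': "j = Suc (2 * k')" using j k k' by simp
    have "digit_incr m z = 1 - int (m * k)" using Dz by (simp only: k sum_pred_digits_even)
    thus ?thesis
      using w k' by (intro pos[of k w]) (auto simp: j' abs_theta_def)
  next
    case False
    then obtain k where k: "l = Suc (2 * k)" by (auto elim: oddE)
    have j': "j = 2 * k" using j k by simp
    show ?thesis
      using w Dz by (intro neg[of w k]) (auto simp: k sum_pred_digits_odd j' abs_theta_def simp del: sum.lessThan_Suc)
  qed
qed

lemma power_sandwich_unique:
  fixes x :: real
  assumes "0 < x" "x < 1" "x ^ Suc k < y" "y < x ^ k" "x ^ Suc j < y" "y < x ^ j"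
  shows "k = j"
proof -
  have "x ^ Suc k < x ^ j" "x ^ Suc j < x ^ k" using assms by linarith+
  hence "j < Suc k" "k < Suc j" using assms(1,2) by (metis power_strict_decreasing_iff)+
  thus ?thesis by simp
qed

text \<open>Converse of \<open>digit_incr_cases\<close>, as is \<open>digit_incr_neg\<close>: all
  representatives there lie in an open interval of length 1, so \<open>phase_unique\<close>
  identifies w with the one found there, and disjointness of the intervals gives the level.\<close>

lemma digit_incr_pos:
  assumes "z \<ge> 1" "phase m (real z) w" "k \<ge> 1" "(1 - alpha m) ^ Suc k < w" "w < (1 - alpha m) ^ k"
  shows "digit_incr m z = 1 - int (m * k)"
proof -
  have a: "0 < alpha m" "alpha m < 1" using alpha_pos[OF m] alpha_lt1[OF m] .
  have le1: "(1 - alpha m) ^ n \<le> 1 - alpha m" if "n \<ge> 1" for n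
    using power_decreasing[of 1 n "1 - alpha m"] that a by simp
  have w0: "w > 0" using assms(4) a by (smt (verit) zero_less_power)
  show ?thesis using \<open>z \<ge> 1\<close>
  proof (cases rule: digit_incr_cases)
    case (pos j v)
    have "v > 0" using pos(3) a by (smt (verit) zero_less_power)
    hence "v = w" using phase_unique[OF pos(2) assms(2)] w0 le1[OF pos(1)] le1[OF assms(3)] pos(4) assms(5) a by linarith
    hence "k = j" using power_sandwich_unique[of "1 - alpha m" k w j] a pos assms by auto
    thus ?thesis using pos by simp
  next
    case (neg j v)
    have "v < 0" using neg(2) a by (smt (verit) zero_less_power mult_pos_pos)
    moreover have "alpha m * (1 - alpha m) ^ j \<le> alpha m * 1" using a by (intro mult_left_mono power_le_one) auto
    ultimately have "v = w" using phase_unique[OF neg(1) assms(2)] w0 le1[OF assms(3)] neg(3) assms(5) a by linarith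
    thus ?thesis using \<open>v < 0\<close> w0 by simp
  qed
qed

lemma digit_incr_neg:
  assumes "z \<ge> 1" "phase m (real z) w" "alpha m * (1 - alpha m) ^ Suc k < - w" "- w < alpha m * (1 - alpha m) ^ k"
  shows "digit_incr m z = 1 - int k"
proof -
  have a: "0 < alpha m" "alpha m < 1" using alpha_pos[OF m] alpha_lt1[OF m] .
  have le1: "(1 - alpha m) ^ n \<le> 1 - alpha m" if "n \<ge> 1" for n
    using power_decreasing[of 1 n "1 - alpha m"] that a by simp
  have le2: "alpha m * (1 - alpha m) ^ j \<le> alpha m" for j
    using a mult_left_mono[of "(1 - alpha m) ^ j" 1 "alpha m"] by (simp add: power_le_one)
  have w0: "w < 0" using assms(3) a by (smt (verit) zero_less_power mult_pos_pos)
  show ?thesis using \<open>z \<ge> 1\<close>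
  proof (cases rule: digit_incr_cases)
    case (pos j v)
    have "v > 0" using pos(3) a by (smt (verit) zero_less_power)
    hence "v = w" using phase_unique[OF pos(2) assms(2)] w0 le1[OF pos(1)] le2[of k] pos(4) assms(4) a by linarith
    thus ?thesis using \<open>v > 0\<close> w0 by simp
  next
    case (neg j v)
    have "v < 0" using neg(2) a by (smt (verit) zero_less_power mult_pos_pos)
    hence v: "v = w" using phase_unique[OF neg(1) assms(2)] w0 le2[of j] le2[of k] neg(3) assms(4) a by linarith
    have "(1 - alpha m) ^ Suc k < - w / alpha m" "- w / alpha m < (1 - alpha m) ^ k"
      "(1 - alpha m) ^ Suc j < - w / alpha m" "- w / alpha m < (1 - alpha m) ^ j"
      using neg assms a unfolding v by (auto simp: field_simps)
    hence "k = j" using power_sandwich_unique[of "1 - alpha m" k "- w / alpha m" j] a by auto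
    thus ?thesis using neg by simp
  qed
qed

end

section \<open>Step functions near small phases\<close>

text \<open>Crossing the phase of - \<open>q\<^sub>l\<close> from left to right raises the increment
  by m for odd l and lowers it by 1 for even l. Starting at l = 1 counts the common value
  \<open>q\<^sub>0\<close> = \<open>q\<^sub>1\<close> once.\<close>

definition jump_sum :: "nat \<Rightarrow> nat \<Rightarrow> int" where
  "jump_sum m n = (\<Sum>l | 1 \<le> l \<and> qd m l < n. if odd l then int m else -1)"

context
  fixes m :: nat
  assumes m: "m \<ge> 1"
begin

lemma abs_theta_even: "abs_theta m (2 * k) = alpha m * (1 - alpha m) ^ k"
  and abs_theta_odd: "abs_theta m (Suc (2 * k)) = (1 - alpha m) ^ Suc k"
  by (simp_all add: abs_theta_def)

lemma dist_int_ge_diff: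
  assumes "a \<noteq> b" "real a \<le> B" "real b \<le> B" "phase m (real a - real b) u"
  shows "\<bar>u\<bar> \<ge> 1 / (real (m + 3) * B)"
proof -
  have *: "\<bar>u\<bar> \<ge> 1 / (real (m + 3) * B)"
    if ab: "a > b" "real a \<le> B" "phase m (real a - real b) u" for a b u
  proof -
    have "phase m (real (a - b)) u" using ab by (simp add: of_nat_diff)
    hence "1 / (real (m + 3) * real (a - b)) \<le> \<bar>u\<bar>" using ab by (intro dist_int_ge[OF m]) auto
    moreover have "1 / (real (m + 3) * B) \<le> 1 / (real (m + 3) * real (a - b))"
      using ab by (intro divide_left_mono mult_left_mono) auto
    ultimately show ?thesis by (rule order.trans[rotated])
  qed
  show ?thesis
  proof (cases "a > b")
    case True
    thus ?thesis using * assms by blast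
  next
    case False
    have "phase m (real b - real a) (- u)" using phase_diff[OF phase_0 assms(4)] by simp
    hence "1 / (real (m + 3) * B) \<le> \<bar>- u\<bar>" using False assms by (intro *[of a b]) auto
    thus ?thesis by simp
  qed
qed

text \<open>Breakpoints accumulate only at phase 0. At distance \<rho> from 0 the neighbouring
  breakpoints have denominators O(1/\<rho>), whence the bound Y; if these are farther than \<eta>
  away, a shift by at most \<eta> crosses none.\<close>

lemma digit_incr_shift_eq:
  assumes z: "z \<ge> 1" and d: "phase m (real d) \<delta>" "\<bar>\<delta>\<bar> \<le> \<eta>" and \<rho>: "\<rho> > 0"
    and far: "\<And>w. phase m (real z) w \<Longrightarrow> \<bar>w\<bar> > \<rho>"
    and nojump: "\<And>l w. real (qd m l) \<le> Y \<Longrightarrow> phase m (real z + real (qd m l)) w \<Longrightarrow> \<bar>w\<bar> > \<eta>"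
    and Y: "Y \<ge> 1 / (alpha m * (1 - alpha m) * \<rho>)"
  shows "digit_incr m (z + d) = digit_incr m z"
proof -
  have a: "0 < alpha m" "alpha m < 1" using alpha_pos[OF m] alpha_lt1[OF m] .
  have zd: "z + d \<ge> 1" using z by simp
  have small: "real (qd m (Suc l)) \<le> Y" if "abs_theta m l \<ge> alpha m * (1 - alpha m) * \<rho>" for l
  proof -
    have p: "alpha m * (1 - alpha m) * \<rho> > 0" using a \<rho> by simp
    have "real (qd m (Suc l)) * (alpha m * (1 - alpha m) * \<rho>) \<le> real (qd m (Suc l)) * abs_theta m l"
      using that by (intro mult_left_mono) auto
    hence "real (qd m (Suc l)) * (alpha m * (1 - alpha m) * \<rho>) \<le> 1" using qd_abs_theta_le[OF m, of l] by linarith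
    hence "real (qd m (Suc l)) \<le> 1 / (alpha m * (1 - alpha m) * \<rho>)" using p by (simp add: pos_le_divide_eq)
    thus ?thesis using Y by linarith
  qed
  have al1: "alpha m * (1 - alpha m) \<le> alpha m" "alpha m * (1 - alpha m) \<le> 1 - alpha m"
    using mult_left_mono[of "1 - alpha m" 1 "alpha m"] mult_right_mono[of "alpha m" 1 "1 - alpha m"] a by auto
  show ?thesis using z
  proof (cases rule: digit_incr_cases[OF m, consumes 1, case_names pos neg])
    case (pos k w)
    have ph: "phase m (real (z + d)) (w + \<delta>)" using phase_add[OF pos(2) d(1)] by simp
    have w0: "w > 0" using pos(3) a by (smt (verit) zero_less_power)
    hence wr: "w > \<rho>" using far[OF pos(2)] by simp
    have "alpha m * (1 - alpha m) * \<rho> \<le> alpha m * \<rho>" using al1(1) \<rho> by (intro mult_right_mono) auto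
    also have "\<dots> \<le> alpha m * (1 - alpha m) ^ k" using wr pos(4) a by (intro mult_left_mono) auto
    also have "\<dots> = abs_theta m (2 * k)" by (simp add: abs_theta_even)
    finally have q: "real (qd m (Suc (2 * k))) \<le> Y" by (rule small)
    obtain k' where k': "k = Suc k'" using pos(1) by (cases k) auto
    have "real (qd m (Suc (2 * k'))) \<le> real (qd m (Suc (2 * k)))"
      unfolding of_nat_le_iff using k' by (intro qd_mono[OF m]) simp
    hence q': "real (qd m (Suc (2 * k'))) \<le> Y" using q by linarith
    have "\<bar>w + theta m (Suc (2 * k))\<bar> > \<eta>"
      by (rule nojump[OF q phase_add[OF pos(2) phase_qd[OF m]]])
    moreover have "\<bar>w + theta m (Suc (2 * k'))\<bar> > \<eta>"
      by (rule nojump[OF q' phase_add[OF pos(2) phase_qd[OF m]]])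
    ultimately have "(1 - alpha m) ^ Suc k < w + \<delta>" "w + \<delta> < (1 - alpha m) ^ k"
      using pos(3,4) d(2) unfolding theta_def abs_theta_odd k' by auto
    hence "digit_incr m (z + d) = 1 - int (m * k)" by (intro digit_incr_pos[OF m zd ph pos(1)])
    thus ?thesis using pos by simp
  next
    case (neg k w)
    have ph: "phase m (real (z + d)) (w + \<delta>)" using phase_add[OF neg(1) d(1)] by simp
    have w0: "w < 0" using neg(2) a by (smt (verit) zero_less_power mult_pos_pos)
    hence wr: "- w > \<rho>" using far[OF neg(1)] by simp
    have "alpha m * (1 - alpha m) * \<rho> \<le> (1 - alpha m) * \<rho>" using al1(2) \<rho> by (intro mult_right_mono) auto
    also have "\<dots> \<le> (1 - alpha m) * (1 - alpha m) ^ k"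
    proof -
      have "alpha m * (1 - alpha m) ^ k \<le> (1 - alpha m) ^ k" using a mult_right_mono[of "alpha m" 1 "(1 - alpha m) ^ k"] by simp
      hence "\<rho> \<le> (1 - alpha m) ^ k" using wr neg(3) by linarith
      thus ?thesis using a by (intro mult_left_mono) auto
    qed
    also have "\<dots> = abs_theta m (Suc (2 * k))" by (simp add: abs_theta_odd)
    finally have q: "real (qd m (2 * Suc k)) \<le> Y" using small[of "Suc (2 * k)"] by (simp)
    have "real (qd m (2 * k)) \<le> real (qd m (2 * Suc k))"
      unfolding of_nat_le_iff by (intro qd_mono[OF m]) simp
    hence q': "real (qd m (2 * k)) \<le> Y" using q by linarith
    have "\<bar>w + theta m (2 * Suc k)\<bar> > \<eta>"
      by (rule nojump[OF q phase_add[OF neg(1) phase_qd[OF m]]])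
    moreover have "\<bar>w + theta m (2 * k)\<bar> > \<eta>"
      by (rule nojump[OF q' phase_add[OF neg(1) phase_qd[OF m]]])
    ultimately have "alpha m * (1 - alpha m) ^ Suc k < - (w + \<delta>)" "- (w + \<delta>) < alpha m * (1 - alpha m) ^ k"
      using neg(2,3) d(2) unfolding theta_def abs_theta_even by auto
    hence "digit_incr m (z + d) = 1 - int k" by (intro digit_incr_neg[OF m zd ph])
    thus ?thesis using neg by simp
  qed
qed

lemma digit_incr_jump:
  assumes z: "z > j" "z' > j" and w: "phase m (real z) w" "w < 0" "- w < \<epsilon>"
    and w': "phase m (real z') w'" "w' > 0" "w' < \<epsilon>"
    and j: "j = qd m l" "l \<ge> 1" and \<epsilon>: "\<epsilon> \<le> alpha m * abs_theta m l"
  shows "digit_incr m (z' - j) = digit_incr m (z - j) + (if odd l then int m else -1)"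
proof -
  have a: "0 < alpha m" "alpha m < 1" using alpha_pos[OF m] alpha_lt1[OF m] .
  have ph: "phase m (real (z - j)) (w - theta m l)" "phase m (real (z' - j)) (w' - theta m l)"
    using phase_diff[OF w(1) phase_qd[OF m, of l]] phase_diff[OF w'(1) phase_qd[OF m, of l]] z j(1)
    by (auto simp: of_nat_diff)
  have z1: "z - j \<ge> 1" "z' - j \<ge> 1" using z by auto
  show ?thesis
  proof (cases "odd l")
    case True
    then obtain k where l: "l = Suc (2 * k)" by (auto elim: oddE)
    have th: "- theta m l = (1 - alpha m) ^ Suc k" by (simp add: l theta_def abs_theta_odd)
    have e: "\<epsilon> \<le> alpha m * (1 - alpha m) ^ Suc k" using \<epsilon> by (simp add: l abs_theta_odd)
    have gap: "alpha m * (1 - alpha m) ^ n = (1 - alpha m) ^ n - (1 - alpha m) ^ Suc n" for n by (simp add: algebra_simps)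
    have D1: "digit_incr m (z - j) = 1 - int (m * Suc k)"
      using w e gap[of "Suc k"] th by (intro digit_incr_pos[OF m z1(1) ph(1)]) auto
    have D2: "digit_incr m (z' - j) = 1 - int (m * k)"
    proof (cases k)
      case 0
      \<comment> \<open>The breakpoint of \<open>q\<^sub>1\<close> is the seam of the period: just
        right of 1 - \<open>alpha m\<close> the representative continues just right of -
        \<open>alpha m\<close>.\<close>
      have ph': "phase m (real (z' - j)) (w' - alpha m)"
        using phase_int[of "- 1", OF _ ph(2)] th 0 by (simp add: algebra_simps)
      have "alpha m * (1 - alpha m) \<le> alpha m * alpha m" using mu_lt_alpha[OF m] a by (intro mult_left_mono) auto
      hence "digit_incr m (z' - j) = 1 - int 0"
        using w' e 0 by (intro digit_incr_neg[OF m z1(2) ph']) (auto simp: algebra_simps)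
      thus ?thesis using 0 by simp
    next
      case (Suc n)
      have "alpha m * (1 - alpha m) ^ Suc k \<le> alpha m * (1 - alpha m) ^ k"
        using a by (intro mult_left_mono power_decreasing) auto
      thus ?thesis using w' e gap[of "k"] th Suc by (intro digit_incr_pos[OF m z1(2) ph(2)]) auto
    qed
    show ?thesis using D1 D2 True by (simp add: algebra_simps)
  next
    case False
    then obtain k where k: "l = 2 * k" by auto
    with j(2) obtain n where n: "k = Suc n" by (cases k) auto
    have th: "- theta m l = - (alpha m * (1 - alpha m) ^ k)" by (simp add: k theta_def abs_theta_even)
    have e: "\<epsilon> \<le> alpha m * (alpha m * (1 - alpha m) ^ k)" using \<epsilon> by (simp add: k abs_theta_even)
    have gap: "alpha m * (alpha m * (1 - alpha m) ^ n) = alpha m * (1 - alpha m) ^ n - alpha m * (1 - alpha m) ^ Suc n" for n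
      by (simp add: algebra_simps)
    have "alpha m * (alpha m * (1 - alpha m) ^ k) \<le> alpha m * (alpha m * (1 - alpha m) ^ n)"
      using a n by (intro mult_left_mono power_decreasing) auto
    hence D1: "digit_incr m (z - j) = 1 - int n"
      using w e gap[of n] th n by (intro digit_incr_neg[OF m z1(1) ph(1)]) auto
    have D2: "digit_incr m (z' - j) = 1 - int k"
      using w' e gap[of k] th by (intro digit_incr_neg[OF m z1(2) ph(2)]) auto
    show ?thesis using D1 D2 False n by simp
  qed
qed

text \<open>Chosen so that 4 \<open>eps0\<close> / Y = 1 / ((m + 3) Y1) with Y1 = 3 (m + 3) Y /
  (\<alpha> (1 - \<alpha>)), the lower bound for the phase of a nonzero difference of two numbers up
  to Y1.\<close>

definition eps0 :: real where
  "eps0 = alpha m * (1 - alpha m) / (12 * (real m + 3) ^ 2)"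

lemma eps0_pos: "eps0 > 0"
  using alpha_pos[OF m] alpha_lt1[OF m] by (simp add: eps0_def)

text \<open>If j is a denominator, z - j and z' - j lie on the two sides of its breakpoint.
  Otherwise \<open>dist_int_ge_diff\<close> keeps z - j so far from 0 and from the relevant
  breakpoints that passing to z' - j crosses none.\<close>

lemma digit_incr_diff_near_zero:
  assumes z: "z > j" "z' > j" "z \<le> z'" and w: "phase m (real z) w" "w < 0" "- w < eps0 / Y"
    and w': "phase m (real z') w'" "w' > 0" "w' < eps0 / Y"
    and j: "1 \<le> j" "real j \<le> Y"
  shows "digit_incr m (z' - j) - digit_incr m (z - j) = jump_sum m (Suc j) - jump_sum m j"
proof -
  have a: "0 < alpha m" "alpha m < 1" using alpha_pos[OF m] alpha_lt1[OF m] .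
  have Y: "Y \<ge> 1" using j by linarith
  have fin: "finite {l. 1 \<le> l \<and> qd m l < n}" for n
    by (rule finite_subset[of _ "{..n}"]) (auto intro: order.trans[OF qd_ge[OF m] less_imp_le])
  show ?thesis
  proof (cases "\<exists>l\<ge>1. j = qd m l")
    case True
    then obtain l where l: "l \<ge> 1" "j = qd m l" by blast
    have "{l. 1 \<le> l \<and> qd m l < Suc j} = insert l {l. 1 \<le> l \<and> qd m l < j}"
      using l qd_inj[OF m, of _ l] by (auto simp: less_Suc_eq)
    hence "jump_sum m (Suc j) - jump_sum m j = (if odd l then int m else -1)"
      unfolding jump_sum_def using fin l by simp
    moreover have "digit_incr m (z' - j) = digit_incr m (z - j) + (if odd l then int m else -1)"
    proof (rule digit_incr_jump[OF z(1,2) w w' l(2,1)])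
      have "1 / 2 \<le> real (qd m (Suc l)) * abs_theta m l" by (rule qd_abs_theta_ge[OF m])
      also have "\<dots> \<le> (real (m + 1) * Y) * abs_theta m l"
      proof -
        have "real (qd m (Suc l)) \<le> real ((m + 1) * qd m l)" unfolding of_nat_le_iff by (rule qd_Suc_le[OF m])
        also have "\<dots> \<le> real (m + 1) * Y" using l j unfolding of_nat_mult by (intro mult_left_mono) auto
        finally show ?thesis using abs_theta_pos[OF m, of l] by (intro mult_right_mono) auto
      qed
      finally have "1 / (2 * real (m + 1) * Y) \<le> abs_theta m l" using Y by (subst pos_divide_le_eq) (auto simp: mult_ac, simp add: algebra_simps)
      hence "alpha m * (1 / (2 * real (m + 1) * Y)) \<le> alpha m * abs_theta m l" using a by (intro mult_left_mono) auto
      moreover have "eps0 / Y \<le> alpha m * (1 / (2 * real (m + 1) * Y))"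
      proof -
        have "eps0 \<le> alpha m * 1 / (12 * (real m + 3) ^ 2)" unfolding eps0_def
          using a by (intro divide_right_mono mult_left_mono) auto
        also have "\<dots> \<le> alpha m * 1 / (2 * real (m + 1))"
          using a by (intro divide_left_mono) (auto simp: power2_eq_square algebra_simps intro!: add_pos_nonneg)
        finally have "eps0 / Y \<le> alpha m * 1 / (2 * real (m + 1)) / Y" using Y by (intro divide_right_mono) auto
        thus ?thesis by simp
      qed
      ultimately show "eps0 / Y \<le> alpha m * abs_theta m l" by linarith
    qed
    ultimately show ?thesis by simp
  next
    case False
    hence "{l. 1 \<le> l \<and> qd m l < Suc j} = {l. 1 \<le> l \<and> qd m l < j}" by (auto simp: less_Suc_eq)
    hence T: "jump_sum m (Suc j) = jump_sum m j" by (simp add: jump_sum_def)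
    \<comment> \<open>A third of the lower bound for the phase of j; \<open>Y1\<close> is then the
      range of denominators that \<open>digit_incr_shift_eq\<close> asks about.\<close>
    define \<rho> where "\<rho> = 1 / (3 * (real m + 3) * Y)"
    define Y1 where "Y1 = 1 / (alpha m * (1 - alpha m) * \<rho>)"
    have Y1: "Y1 = 3 * (real m + 3) * Y / (alpha m * (1 - alpha m))" by (simp add: Y1_def \<rho>_def)
    have aa: "0 < alpha m * (1 - alpha m)" "alpha m * (1 - alpha m) \<le> 1"
      using a mult_mono[of "alpha m" 1 "1 - alpha m" 1] by auto
    have "3 * (real m + 3) * Y \<ge> 1 * Y" using Y by (intro mult_right_mono) auto
    moreover have "3 * (real m + 3) * Y * (alpha m * (1 - alpha m)) \<le> 3 * (real m + 3) * Y * 1"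
      using aa Y by (intro mult_left_mono) auto
    ultimately have YY1: "Y \<le> Y1" unfolding Y1 using aa by (simp add: pos_le_divide_eq)
    have e1: "4 * (eps0 / Y) = 1 / (real (m + 3) * Y1)"
    proof -
      have "4 * (x / (12 * t ^ 2) / Y) = 1 / (t * (3 * t * Y / x))" if "x > 0" "t > 0" for x t :: real
        using that Y by (simp add: divide_simps power2_eq_square)
      from this[OF aa(1), of "real m + 3"] show ?thesis unfolding Y1 eps0_def by simp
    qed
    have e0: "eps0 / Y > 0" using eps0_pos Y by simp
    have e2: "4 * (eps0 / Y) \<le> 1 / (real (m + 3) * Y)"
      unfolding e1 using YY1 Y by (intro divide_left_mono mult_left_mono) auto
    have "digit_incr m ((z - j) + (z' - z)) = digit_incr m (z - j)"
    proof (rule digit_incr_shift_eq[where \<eta> = "2 * (eps0 / Y)" and \<rho> = \<rho> and Y = Y1])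
      show "z - j \<ge> 1" using z by simp
      show "phase m (real (z' - z)) (w' - w)" using phase_diff[OF w'(1) w(1)] z by (simp add: of_nat_diff)
      show "\<bar>w' - w\<bar> \<le> 2 * (eps0 / Y)" using w w' by linarith
      show "\<rho> > 0" using Y by (simp add: \<rho>_def)
      show "1 / (alpha m * (1 - alpha m) * \<rho>) \<le> Y1" by (simp add: Y1_def)
    next
      fix v assume "phase m (real (z - j)) v"
      hence "phase m (real z - real (z - j)) (w - v)" by (intro phase_diff w)
      hence "phase m (real j) (w - v)" using z by (simp add: of_nat_diff)
      hence "phase m (real j - real 0) (w - v)" by simp
      hence "\<bar>w - v\<bar> \<ge> 1 / (real (m + 3) * Y)" using j Y by (intro dist_int_ge_diff[of j 0]) auto
      hence "\<bar>v\<bar> \<ge> 1 / (real (m + 3) * Y) - eps0 / Y" using w by linarith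
      moreover have "\<rho> = (1 / (real (m + 3) * Y)) / 3" by (simp add: \<rho>_def)
      moreover have "1 / (real (m + 3) * Y) > 0" using Y by simp
      moreover have "b - e \<le> x \<Longrightarrow> r = b / 3 \<Longrightarrow> 0 < b \<Longrightarrow> 4 * e \<le> b \<Longrightarrow> r < x" for b e r x :: real
        by linarith
      ultimately show "\<bar>v\<bar> > \<rho>" using e2 by blast
    next
      fix l v assume l: "real (qd m l) \<le> Y1" and ph: "phase m (real (z - j) + real (qd m l)) v"
      have ne: "qd m l \<noteq> j"
      proof
        assume eq: "qd m l = j"
        show False
        proof (cases "l = 0")
          case True
          hence "j = qd m (Suc 0)" using eq by (simp only: qd_simps)
          thus False using False by (metis One_nat_def order_refl)
        next
          case lf: False
          thus False using eq False by (metis One_nat_def Suc_leI neq0_conv)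
        qed
      qed
      have "phase m (real (z - j) + real (qd m l) - real z) (v - w)" by (intro phase_diff ph w)
      hence "phase m (real (qd m l) - real j) (v - w)" using z by (simp add: of_nat_diff)
      hence "\<bar>v - w\<bar> \<ge> 1 / (real (m + 3) * Y1)" using l j YY1 ne by (intro dist_int_ge_diff[of "qd m l" j]) auto
      hence "4 * (eps0 / Y) \<le> \<bar>v - w\<bar>" unfolding e1 .
      thus "2 * (eps0 / Y) < \<bar>v\<bar>" using w e0 by linarith
    qed
    moreover have "(z - j) + (z' - z) = z' - j" using z by simp
    ultimately show ?thesis using T by simp
  qed
qed

lemma digit_sum_diff_near_zero:
  assumes z: "z > i" "z' > i" "z \<le> z'" and w: "phase m (real z) w" "w < 0" "- w < eps0 / Y"
    and w': "phase m (real z') w'" "w' > 0" "w' < eps0 / Y"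
    and i: "1 \<le> i" "real i \<le> Y"
  shows "int (digit_sum m (z' - i)) - int (digit_sum m (z - i)) = int (digit_sum m (z' - 1)) - int (digit_sum m (z - 1)) - jump_sum m i"
  using i z
proof (induction i)
  case (Suc i)
  show ?case
  proof (cases "i = 0")
    case True
    have "{l. 1 \<le> l \<and> qd m l < Suc 0} = {}" using qd_pos[OF m] by auto
    hence "jump_sum m (Suc 0) = 0" unfolding jump_sum_def by (simp only: sum.empty)
    thus ?thesis using True by simp
  next
    case False
    have "int (digit_sum m (z' - i)) - int (digit_sum m (z - i)) = int (digit_sum m (z' - 1)) - int (digit_sum m (z - 1)) - jump_sum m i"
      using Suc False by auto
    moreover have "digit_incr m (z' - i) - digit_incr m (z - i) = jump_sum m (Suc i) - jump_sum m i"
      using Suc.prems False by (intro digit_incr_diff_near_zero[OF _ _ _ w w']) auto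
    moreover have "z - i - 1 = z - Suc i" "z' - i - 1 = z' - Suc i" by auto
    ultimately show ?thesis unfolding digit_incr_def by simp
  qed
qed simp

section \<open>Gaps between numbers of small phase of a given sign\<close>

text \<open>Cut off the expansion of a below L and put the digit 1 at L; digit L + 1 is cleared
  because a nonzero digit L forbids its maximal value. The lowest digit now sits at L, which fixes
  the sign and the size of the phase.\<close>

lemma small_phase_near:
  assumes "L \<ge> 1"
  obtains z w where "a \<le> z + qd m (Suc (Suc L))" "z \<le> a + qd m L"
    "phase m (real z) w" "0 < (-1) ^ L * w" "(-1) ^ L * w < abs_theta m (L - 1)"
proof -
  obtain \<epsilon> K where e: "ostrowski_admissible (pq m) \<epsilon>" "\<And>i. i \<ge> K \<Longrightarrow> \<epsilon> i = 0"
    "a = (\<Sum>i<K. \<epsilon> i * qd m i)" "K \<ge> L + 3" by (rule digits_exist[OF m, of a "L + 3"]) blast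
  define e' where "e' i = (if i < L then 0 else if i = L then 1 else if i = Suc L then 0 else \<epsilon> i)" for i
  have pq1: "pq m (Suc i) \<ge> 1" for i using pq_ge[OF m] by simp
  have adm: "ostrowski_admissible (pq m) e'"
    unfolding ostrowski_admissible_def
  proof (intro conjI allI impI)
    show "e' 0 < pq m 1" using assms pq1[of 0] by (auto simp: e'_def)
  next
    fix i :: nat assume "i \<ge> 1"
    thus "e' i \<le> pq m (i + 1)" using e(1) pq1[of i] by (auto simp: e'_def ostrowski_admissible_def)
  next
    fix i :: nat assume i: "i \<ge> 1" and eq: "e' i = pq m (i + 1)"
    have "\<epsilon> (i - 1) = 0" if "\<epsilon> i = pq m (Suc i)" using e(1) i that by (simp add: ostrowski_admissible_def)
    thus "e' (i - 1) = 0" using eq pq1[of i] i by (auto simp: e'_def split: if_splits)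
  qed
  define z where "z = (\<Sum>i<K. e' i * qd m i)"
  have split: "(\<Sum>i<K. g i) = (\<Sum>i<L. g i) + g L + g (Suc L) + (\<Sum>i=Suc (Suc L)..<K. g i)" for g :: "nat \<Rightarrow> nat"
  proof -
    have "(\<Sum>i<K. g i) = (\<Sum>i<Suc (Suc L). g i) + (\<Sum>i=Suc (Suc L)..<K. g i)"
      using e(4) by (simp add: lessThan_atLeast0 sum.atLeastLessThan_concat del: sum.lessThan_Suc sum.op_ivl_Suc)
    thus ?thesis by simp
  qed
  have "(\<Sum>i<L. e' i * qd m i) = 0" by (simp add: e'_def)
  moreover have "e' L = 1" "e' (Suc L) = 0" by (auto simp: e'_def)
  moreover have "(\<Sum>i=Suc (Suc L)..<K. e' i * qd m i) = (\<Sum>i=Suc (Suc L)..<K. \<epsilon> i * qd m i)"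
    by (intro sum.cong) (auto simp: e'_def)
  ultimately have z: "z = qd m L + (\<Sum>i=Suc (Suc L)..<K. \<epsilon> i * qd m i)"
    unfolding z_def split by simp
  have a: "a = (\<Sum>i<Suc (Suc L). \<epsilon> i * qd m i) + (\<Sum>i=Suc (Suc L)..<K. \<epsilon> i * qd m i)"
    unfolding e(3) split by simp
  have "(\<Sum>i<Suc (Suc L). \<epsilon> i * qd m i) < qd m (Suc (Suc L))"
    by (rule ostrowski_partial_sum_less[OF e(1)])
  hence b: "a \<le> z + qd m (Suc (Suc L))" "z \<le> a + qd m L" using z a by linarith+
  obtain j where j: "L = Suc j" using assms by (cases L) auto
  obtain w where w: "phase m (real z) w" "abs_theta m (Suc (Suc j)) < (-1) ^ Suc j * w" "(-1) ^ Suc j * w < abs_theta m j"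
    unfolding z_def
  proof (rule phase_lowest_digit[OF m adm])
    show "e' (Suc j) \<ge> 1" using j by (simp add: e'_def)
    show "e' i = 0" if "i \<le> j" for i using that j by (simp add: e'_def)
    show "Suc j < K" using e(4) j by simp
  qed blast
  have "0 < (-1) ^ L * w" using w(2) abs_theta_pos[OF m, of "Suc (Suc j)"] j by simp
  thus ?thesis using that[OF b w(1)] w(3) j by simp
qed

text \<open>The gaps are linear in Y: one step multiplies a denominator by at most m + 1, so the
  first level with error below e / Y has denominators O(Y).\<close>

lemma small_phase_syndetic:
  assumes e: "e > 0"
  obtains C :: real where "C > 0"
    "\<And>Y a. Y \<ge> 1 \<Longrightarrow> \<exists>z\<ge>a. \<exists>w. real z \<le> real a + C * Y \<and> phase m (real z) w \<and> 0 < w \<and> w < e / Y"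
    "\<And>Y a. Y \<ge> 1 \<Longrightarrow> \<exists>z\<ge>a. \<exists>w. real z \<le> real a + C * Y \<and> phase m (real z) w \<and> w < 0 \<and> - w < e / Y"
proof -
  have a: "0 < alpha m" "alpha m < 1" using alpha_pos[OF m] alpha_lt1[OF m] .
  \<comment> \<open>Capping e below 1 forces the least exponent k to be positive.\<close>
  define e1 where "e1 = min e (1/2)"
  have e1: "0 < e1" "e1 < 1" "e1 \<le> e" using e by (auto simp: e1_def)
  define B where "B = real ((m + 1) ^ 4) / (alpha m * e1)"
  have "\<exists>k\<ge>1. (1 - alpha m) ^ k \<le> e1 / Y \<and> real (qd m (2 * k + 3)) \<le> B * Y" if Y: "Y \<ge> 1" for Y :: real
  proof -
    have pos: "e1 / Y > 0" using e1 Y by simp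
    have ex: "\<exists>k. (1 - alpha m) ^ k \<le> e1 / Y"
      using real_arch_pow_inv[OF pos, of "1 - alpha m"] a by (auto intro: less_imp_le)
    define k where "k = (LEAST k. (1 - alpha m) ^ k \<le> e1 / Y)"
    have k: "(1 - alpha m) ^ k \<le> e1 / Y" unfolding k_def using ex by (rule LeastI_ex)
    have "e1 / Y < 1" using e1 Y by (simp add: field_simps)
    hence "k \<noteq> 0" using k by (cases "k = 0") auto
    then obtain n where n: "k = Suc n" by (cases k) auto
    have "\<not> (1 - alpha m) ^ n \<le> e1 / Y" using not_less_Least[of n "\<lambda>k. (1 - alpha m) ^ k \<le> e1 / Y"] n by (simp add: k_def)
    hence "alpha m * (e1 / Y) \<le> abs_theta m (2 * n)" unfolding abs_theta_even using a by (intro mult_left_mono) auto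
    hence "real (qd m (Suc (2 * n))) * (alpha m * (e1 / Y)) \<le> real (qd m (Suc (2 * n))) * abs_theta m (2 * n)"
      by (intro mult_left_mono) auto
    also have "\<dots> \<le> 1" by (rule qd_abs_theta_le[OF m])
    finally have q: "real (qd m (Suc (2 * n))) \<le> Y / (alpha m * e1)" using a e1 Y by (simp add: field_simps)
    have "qd m (Suc (Suc l)) \<le> (m + 1) ^ 2 * qd m l" for l
      using mult_le_mono2[OF qd_Suc_le[OF m, of l], of "m + 1"] qd_Suc_le[OF m, of "Suc l"]
      by (simp add: power2_eq_square algebra_simps)
    hence "qd m (Suc (Suc (Suc (Suc l)))) \<le> (m + 1) ^ 4 * qd m l" for l
      using mult_le_mono2[of "qd m (Suc (Suc l))" "(m + 1) ^ 2 * qd m l" "(m + 1) ^ 2"]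
      by (simp) (metis (no_types, lifting) le_trans mult.assoc numeral_Bit0 power_add)
    hence "qd m (2 * k + 3) \<le> (m + 1) ^ 4 * qd m (Suc (2 * n))"
      using n by (simp add: numeral_3_eq_3)
    hence "real (qd m (2 * k + 3)) \<le> real ((m + 1) ^ 4 * qd m (Suc (2 * n)))" unfolding of_nat_le_iff .
    also have "\<dots> = real ((m + 1) ^ 4) * real (qd m (Suc (2 * n)))" by (rule of_nat_mult)
    also have "\<dots> \<le> real ((m + 1) ^ 4) * (Y / (alpha m * e1))" by (rule mult_left_mono[OF q]) simp
    also have "\<dots> = B * Y" by (simp add: B_def)
    finally show ?thesis using k n by auto
  qed note ex = this
  have main: "\<exists>z\<ge>a. \<exists>w. real z \<le> real a + 2 * B * Y \<and> phase m (real z) w \<and> 0 < s * w \<and> s * w < e / Y"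
    if Y: "Y \<ge> 1" and s: "s = 1 \<or> s = -1" for Y s :: real and a :: nat
  proof -
    obtain k where k: "k \<ge> 1" "(1 - alpha m) ^ k \<le> e1 / Y" "real (qd m (2 * k + 3)) \<le> B * Y"
      using ex[OF Y] by blast
    define L where "L = (if s = 1 then 2 * k else Suc (2 * k))"
    have L: "L \<ge> 1" "(-1) ^ L = s" "Suc (Suc L) \<le> 2 * k + 3" using k s by (auto simp: L_def)
    have "2 * k - 1 \<le> L - 1" by (auto simp: L_def)
    hence "abs_theta m (L - 1) \<le> abs_theta m (2 * k - 1)" by (rule abs_theta_antimono[OF m])
    also have "\<dots> = (1 - alpha m) ^ k"
    proof -
      obtain n where "k = Suc n" using k(1) by (cases k) auto
      thus ?thesis using abs_theta_odd[of n] by simp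
    qed
    finally have "abs_theta m (L - 1) \<le> e1 / Y" using k(2) by linarith
    also have "\<dots> \<le> e / Y" using e1 Y by (intro divide_right_mono) auto
    finally have ath: "abs_theta m (L - 1) \<le> e / Y" .
    \<comment> \<open>Starting from a + q(L+2) makes up for the possible loss of q(L+2) in
      \<open>small_phase_near\<close>, so that z \<ge> a.\<close>
    obtain z w where z: "a + qd m (Suc (Suc L)) \<le> z + qd m (Suc (Suc L))" "z \<le> a + qd m (Suc (Suc L)) + qd m L"
      "phase m (real z) w" "0 < (-1) ^ L * w" "(-1) ^ L * w < abs_theta m (L - 1)"
      using small_phase_near[OF L(1), of "a + qd m (Suc (Suc L))"] by metis
    have "qd m L \<le> qd m (2 * k + 3)" "qd m (Suc (Suc L)) \<le> qd m (2 * k + 3)"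
      using L(3) by (intro qd_mono[OF m]; simp)+
    hence "real z \<le> real a + 2 * real (qd m (2 * k + 3))" using z(2) by linarith
    hence "real z \<le> real a + 2 * B * Y" using k(3) by linarith
    thus ?thesis using z L(2) ath by (intro exI[of _ z] conjI exI[of _ w]) auto
  qed
  have "B > 0" using a e1 m by (simp add: B_def)
  show ?thesis
  proof (rule that[of "2 * B"])
    show "2 * B > 0" using \<open>B > 0\<close> by simp
  qed (use main[of _ 1] main[of _ "- 1"] in auto)
qed

end

section \<open>Power saving from twin blocks\<close>

lemma unit_exp_cis: "unit_exp x = cis (2 * pi * x)"
  by (simp add: unit_exp_def cis_conv_exp mult_ac)

lemma norm_unit_exp [simp]: "cmod (unit_exp x) = 1"
  by (simp add: unit_exp_cis)

lemma unit_exp_add: "unit_exp (x + y) = unit_exp x * unit_exp y"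
  by (simp add: unit_exp_cis cis_mult algebra_simps)

lemma unit_exp_0 [simp]: "unit_exp 0 = 1"
  by (simp add: unit_exp_cis)

lemma unit_exp_Ints: "x \<in> \<int> \<Longrightarrow> unit_exp x = 1"
  by (auto simp: unit_exp_cis elim!: Ints_cases)

lemma unit_exp_eq_1_imp_Ints:
  assumes "unit_exp x = 1"
  shows "x \<in> \<int>"
proof -
  have "cos (2 * pi * x) = 1" using arg_cong[OF assms, of Re] by (simp add: unit_exp_cis)
  then obtain n :: int where "2 * pi * x = of_int n * 2 * pi" using cos_one_2pi_int by auto
  thus ?thesis by simp
qed

definition bounded_sums :: "(nat \<Rightarrow> complex) \<Rightarrow> nat \<Rightarrow> real \<Rightarrow> bool" where
  "bounded_sums F Y M \<longleftrightarrow> (\<forall>a n. n \<le> Y \<longrightarrow> cmod (\<Sum>i=a..<a + n. F i) \<le> M)"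

text \<open>The two blocks cannot both be fully reinforced by their translates, which gains a constant factor
  at the scale \<open>X\<close>.\<close>

definition twin_blocks :: "real \<Rightarrow> nat \<Rightarrow> real \<Rightarrow> nat \<Rightarrow> (nat \<Rightarrow> complex) \<Rightarrow> bool" where
  "twin_blocks c C \<kappa> X0 F \<longleftrightarrow> (\<forall>X\<ge>X0. \<forall>a. \<exists>L p p' s v v'.
     c * real X \<le> real L \<and> a \<le> p \<and> p + L \<le> p' \<and> p' + L \<le> p + s \<and> p' + s + L \<le> a + C * X \<and>
     cmod v = 1 \<and> cmod v' = 1 \<and> \<kappa> \<le> cmod (v - v') \<and>
     (\<forall>n. p \<le> n \<and> n < p + L \<longrightarrow> F (n + s) = v * F n) \<and>
     (\<forall>n. p' \<le> n \<and> n < p' + L \<longrightarrow> F (n + s) = v' * F n))"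

text \<open>Both blocks share the translation s, so a linear phase multiplies both constants by the
  same unit and keeps their distance. This is the source of uniformity in t.\<close>

lemma twin_blocks_twist:
  assumes "twin_blocks c C \<kappa> X0 F"
  shows "twin_blocks c C \<kappa> X0 (\<lambda>n. F n * unit_exp (real n * t))"
  unfolding twin_blocks_def
proof (intro allI impI)
  fix X a assume X: "X \<ge> X0"
  obtain L p p' s v v' where *:
     "c * real X \<le> real L \<and> a \<le> p \<and> p + L \<le> p' \<and> p' + L \<le> p + s \<and> p' + s + L \<le> a + C * X \<and>
     cmod v = 1 \<and> cmod v' = 1 \<and> \<kappa> \<le> cmod (v - v') \<and>
     (\<forall>n. p \<le> n \<and> n < p + L \<longrightarrow> F (n + s) = v * F n) \<and>
     (\<forall>n. p' \<le> n \<and> n < p' + L \<longrightarrow> F (n + s) = v' * F n)"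
    using assms[unfolded twin_blocks_def, rule_format, OF X, of a] by (elim exE) (rule that)
  have "v * unit_exp (real s * t) - v' * unit_exp (real s * t) = (v - v') * unit_exp (real s * t)"
    by (simp add: algebra_simps)
  hence "cmod (v * unit_exp (real s * t) - v' * unit_exp (real s * t)) = cmod (v - v')"
    by (simp add: norm_mult)
  with * have "\<exists>L p p' s v v'. c * real X \<le> real L \<and> a \<le> p \<and> p + L \<le> p' \<and> p' + L \<le> p + s \<and> p' + s + L \<le> a + C * X \<and>
     cmod v = 1 \<and> cmod v' = 1 \<and> \<kappa> \<le> cmod (v - v') \<and>
     (\<forall>n. p \<le> n \<and> n < p + L \<longrightarrow> F (n + s) * (unit_exp (real n * t) * unit_exp (real s * t)) = v * (F n * unit_exp (real n * t))) \<and>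
     (\<forall>n. p' \<le> n \<and> n < p' + L \<longrightarrow> F (n + s) * (unit_exp (real n * t) * unit_exp (real s * t)) = v' * (F n * unit_exp (real n * t)))"
    by (intro exI[of _ L] exI[of _ p] exI[of _ p'] exI[of _ s] exI[of _ "v * unit_exp (real s * t)"]
              exI[of _ "v' * unit_exp (real s * t)"]) (simp add: norm_mult)
  thus "\<exists>L p p' s v v'. c * real X \<le> real L \<and> a \<le> p \<and> p + L \<le> p' \<and> p' + L \<le> p + s \<and> p' + s + L \<le> a + C * X \<and>
     cmod v = 1 \<and> cmod v' = 1 \<and> \<kappa> \<le> cmod (v - v') \<and>
     (\<forall>n. p \<le> n \<and> n < p + L \<longrightarrow> F (n + s) * unit_exp (real (n + s) * t) = v * (F n * unit_exp (real n * t))) \<and>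
     (\<forall>n. p' \<le> n \<and> n < p' + L \<longrightarrow> F (n + s) * unit_exp (real (n + s) * t) = v' * (F n * unit_exp (real n * t)))"
    unfolding of_nat_add distrib_right unit_exp_add .
qed

text \<open>Parallelogram law for 1 and v, followed by 4 - k^2 \<le> (2 - k^2 / 4)^2.\<close>

lemma norm_one_plus_unit:
  assumes "cmod v = 1" "cmod (1 - v) \<ge> k" "k \<ge> 0"
  shows "cmod (1 + v) \<le> 2 - k ^ 2 / 4"
proof -
  have "cmod (1 + v) ^ 2 + cmod (1 - v) ^ 2 = 4"
  proof -
    have "Re v ^ 2 + Im v ^ 2 = 1" using assms(1) cmod_power2[of v] by simp
    thus ?thesis unfolding cmod_power2 by (simp add: power2_eq_square algebra_simps)
  qed
  moreover have "k ^ 2 \<le> cmod (1 - v) ^ 2" using assms by (intro power_mono) auto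
  ultimately have le: "cmod (1 + v) ^ 2 \<le> 4 - k ^ 2" by linarith
  have "cmod (1 - v) \<le> 2" using norm_triangle_ineq4[of 1 v] assms(1) by simp
  hence "k ^ 2 \<le> 2 ^ 2" using assms by (intro power_mono) auto
  hence nn: "2 - k ^ 2 / 4 \<ge> 0" by simp
  have "(2 - k ^ 2 / 4) ^ 2 = 4 - k ^ 2 + (k ^ 2 / 4) ^ 2" by (simp add: power2_eq_square algebra_simps)
  hence "4 - k ^ 2 \<le> (2 - k ^ 2 / 4) ^ 2" by simp
  hence "cmod (1 + v) ^ 2 \<le> (2 - k ^ 2 / 4) ^ 2" using le by linarith
  thus ?thesis using nn by (rule power2_le_imp_le)
qed

lemma norm_one_plus_units:
  assumes "cmod v = 1" "cmod v' = 1" "cmod (v - v') \<ge> \<kappa>" "\<kappa> \<ge> 0"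
  shows "cmod (1 + v) + cmod (1 + v') \<le> 4 - \<kappa> ^ 2 / 16"
proof -
  have b: "cmod (1 + v) \<le> 2" "cmod (1 + v') \<le> 2"
    using norm_triangle_ineq[of 1 v] norm_triangle_ineq[of 1 v'] assms by auto
  have "cmod (v - v') \<le> cmod (1 - v) + cmod (1 - v')"
    using norm_triangle_ineq4[of "1 - v'" "1 - v"] by simp
  hence "cmod (1 - v) \<ge> \<kappa> / 2 \<or> cmod (1 - v') \<ge> \<kappa> / 2" using assms by linarith
  moreover have "(\<kappa> / 2) ^ 2 / 4 = \<kappa> ^ 2 / 16" by (simp add: power_divide)
  ultimately show ?thesis
    using norm_one_plus_unit[OF assms(1), of "\<kappa> / 2"] norm_one_plus_unit[OF assms(2), of "\<kappa> / 2"] assms(4) b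
    by (elim disjE) linarith+
qed

lemma bounded_sums_nonneg: "bounded_sums F Y M \<Longrightarrow> M \<ge> 0"
  unfolding bounded_sums_def by (metis le0 norm_ge_zero order_trans)

lemma bounded_sums_long:
  assumes "bounded_sums F Y M" "Y \<ge> 1"
  shows "cmod (\<Sum>i=a..<a + n. F i) \<le> (real n / real Y + 1) * M"
proof (induction n arbitrary: a rule: less_induct)
  case (less n)
  have M: "M \<ge> 0" using assms(1) by (rule bounded_sums_nonneg)
  show ?case
  proof (cases "n \<le> Y")
    case True
    have "1 * M \<le> (real n / real Y + 1) * M" using M by (intro mult_right_mono) auto
    moreover have "cmod (\<Sum>i=a..<a + n. F i) \<le> M" using assms(1) True unfolding bounded_sums_def by blast
    ultimately show ?thesis by simp
  next
    case False
    have "(\<Sum>i=a..<a + n. F i) = (\<Sum>i=a..<a + Y. F i) + (\<Sum>i=a + Y..<a + Y + (n - Y). F i)"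
      using False by (simp add: sum.atLeastLessThan_concat)
    moreover have "cmod (\<Sum>i=a..<a + Y. F i) \<le> M" using assms(1) unfolding bounded_sums_def by blast
    moreover have "cmod (\<Sum>i=a + Y..<a + Y + (n - Y). F i) \<le> (real (n - Y) / real Y + 1) * M"
      using False assms(2) by (intro less.IH) auto
    ultimately have "cmod (\<Sum>i=a..<a + n. F i) \<le> M + (real (n - Y) / real Y + 1) * M"
      by (simp only:) (rule order.trans[OF norm_triangle_ineq add_mono])
    also have "\<dots> = (real n / real Y + 1) * M"
      using False assms(2) by (simp add: of_nat_diff field_simps)
    finally show ?thesis .
  qed
qed

lemma sum_shifted_block:
  fixes F :: "nat \<Rightarrow> complex"
  assumes "\<forall>n. p \<le> n \<and> n < p + L \<longrightarrow> F (n + s) = v * F n"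
  shows "(\<Sum>i=p + s..<p + s + L. F i) = v * (\<Sum>i=p..<p + L. F i)"
proof -
  have "(\<Sum>i=p + s..<p + s + L. F i) = (\<Sum>i=p..<p + L. F (i + s))"
    using sum.shift_bounds_nat_ivl[of F p s "p + L"] by (simp add: add_ac)
  also have "\<dots> = (\<Sum>i=p..<p + L. v * F i)" using assms by (intro sum.cong) auto
  finally show ?thesis by (simp add: sum_distrib_left)
qed

text \<open>The blocks and their translates contribute (1 + v) A + (1 + v') B, where the two factors
  cannot both have modulus near 2. The interval splits into four blocks and five gaps; each of these
  nine pieces may cost one extra M, which explains the constant 9.\<close>

lemma twin_blocks_gain:
  assumes bs: "bounded_sums F Y M" "Y \<ge> 1"
    and o: "a \<le> p" "p + L \<le> p'" "p' + L \<le> p + s" "p' + s + L \<le> b"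
    and v: "cmod v = 1" "cmod v' = 1" "\<kappa> \<le> cmod (v - v')" "\<kappa> \<ge> 0"
    and F: "\<forall>n. p \<le> n \<and> n < p + L \<longrightarrow> F (n + s) = v * F n"
      "\<forall>n. p' \<le> n \<and> n < p' + L \<longrightarrow> F (n + s) = v' * F n"
  shows "cmod (\<Sum>i=a..<b. F i) \<le> (real (b - a) / real Y + 9 - \<kappa> ^ 2 / 16 * (real L / real Y)) * M"
proof -
  define y where "y = real Y"
  have y: "y > 0" using bs(2) by (simp add: y_def)
  have M: "M \<ge> 0" using bs(1) by (rule bounded_sums_nonneg)
  have gap: "cmod (\<Sum>i=u..<w. F i) \<le> (real (w - u) / y + 1) * M" if "u \<le> w" for u w
    using bounded_sums_long[OF bs, of u "w - u"] that by (simp add: y_def)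
  define A where "A = (\<Sum>i=p..<p + L. F i)"
  define B where "B = (\<Sum>i=p'..<p' + L. F i)"
  have cat: "(\<Sum>i=u..<x. F i) = (\<Sum>i=u..<w. F i) + (\<Sum>i=w..<x. F i)" if "u \<le> w" "w \<le> x" for u w x
    using that by (simp add: sum.atLeastLessThan_concat)
  have AB: "cmod A \<le> (real L / y + 1) * M" "cmod B \<le> (real L / y + 1) * M"
    using gap[of p "p + L"] gap[of p' "p' + L"] by (auto simp: A_def B_def)
  have "(\<Sum>i=a..<b. F i) = (\<Sum>i=a..<p. F i) + (A + ((\<Sum>i=p + L..<p'. F i) + (B + ((\<Sum>i=p' + L..<p + s. F i)
      + ((\<Sum>i=p + s..<p + s + L. F i) + ((\<Sum>i=p + s + L..<p' + s. F i) + ((\<Sum>i=p' + s..<p' + s + L. F i)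
      + (\<Sum>i=p' + s + L..<b. F i))))))))"
    unfolding A_def B_def using o by (simp add: cat[symmetric])
  also have "\<dots> = (1 + v) * A + (1 + v') * B + ((\<Sum>i=a..<p. F i) + (\<Sum>i=p + L..<p'. F i)
      + (\<Sum>i=p' + L..<p + s. F i) + (\<Sum>i=p + s + L..<p' + s. F i) + (\<Sum>i=p' + s + L..<b. F i))"
    unfolding sum_shifted_block[OF F(1)] sum_shifted_block[OF F(2)] A_def[symmetric] B_def[symmetric]
    by (simp add: algebra_simps)
  finally have eq: "(\<Sum>i=a..<b. F i) = \<dots>" .
  define G where "G = (real (p - a) / y + 1) * M + (real (p' - (p + L)) / y + 1) * M
     + (real (p + s - (p' + L)) / y + 1) * M + (real (p' + s - (p + s + L)) / y + 1) * M + (real (b - (p' + s + L)) / y + 1) * M"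
  have "cmod ((\<Sum>i=a..<p. F i) + (\<Sum>i=p + L..<p'. F i)
      + (\<Sum>i=p' + L..<p + s. F i) + (\<Sum>i=p + s + L..<p' + s. F i) + (\<Sum>i=p' + s + L..<b. F i)) \<le> G"
    unfolding G_def by (intro norm_triangle_mono gap) (use o in auto)
  moreover have "cmod ((1 + v) * A + (1 + v') * B) \<le> (4 - \<kappa> ^ 2 / 16) * ((real L / y + 1) * M)"
  proof -
    have "cmod ((1 + v) * A + (1 + v') * B) \<le> cmod (1 + v) * cmod A + cmod (1 + v') * cmod B"
      by (metis norm_mult norm_triangle_ineq)
    also have "\<dots> \<le> cmod (1 + v) * ((real L / y + 1) * M) + cmod (1 + v') * ((real L / y + 1) * M)"
      using AB by (intro add_mono mult_left_mono) auto
    also have "\<dots> = (cmod (1 + v) + cmod (1 + v')) * ((real L / y + 1) * M)" by (simp add: algebra_simps)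
    also have "\<dots> \<le> (4 - \<kappa> ^ 2 / 16) * ((real L / y + 1) * M)"
      using norm_one_plus_units[OF v] M y by (intro mult_right_mono mult_nonneg_nonneg) auto
    finally show ?thesis .
  qed
  ultimately have "cmod (\<Sum>i=a..<b. F i) \<le> (4 - \<kappa> ^ 2 / 16) * ((real L / y + 1) * M) + G"
    unfolding eq by (rule norm_triangle_mono[rotated])
  also have "G = ((real (b - a) - 4 * real L) / y + 5) * M"
  proof -
    have "(x1 / y + 1) * M + (x2 / y + 1) * M + (x3 / y + 1) * M + (x4 / y + 1) * M + (x5 / y + 1) * M
        = ((x1 + x2 + x3 + x4 + x5) / y + 5) * M" for x1 x2 x3 x4 x5
      by (simp add: add_divide_distrib algebra_simps)
    moreover have "real (p - a) + real (p' - (p + L)) + real (p + s - (p' + L)) + real (p' + s - (p + s + L))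
        + real (b - (p' + s + L)) = real (b - a) - 4 * real L"
      using o by (simp add: of_nat_diff)
    ultimately show ?thesis unfolding G_def by (simp only:)
  qed
  also have "(4 - \<kappa> ^ 2 / 16) * ((real L / y + 1) * M) + ((real (b - a) - 4 * real L) / y + 5) * M
      = (real (b - a) / y + 9 - \<kappa> ^ 2 / 16 * (real L / y)) * M - \<kappa> ^ 2 / 16 * M"
    using y by (simp add: field_simps)
  also have "\<dots> \<le> (real (b - a) / y + 9 - \<kappa> ^ 2 / 16 * (real L / y)) * M" using M by simp
  finally show ?thesis by (simp add: y_def)
qed

lemma bounded_sums_blocks:
  assumes "\<And>a. cmod (\<Sum>i=a..<a + B. F i) \<le> M1" "\<And>a n. n < B \<Longrightarrow> cmod (\<Sum>i=a..<a + n. F i) \<le> M2"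
    "B \<ge> 1" "M1 \<ge> 0"
  shows "bounded_sums F (P * B) (real P * M1 + M2)"
proof -
  have full: "cmod (\<Sum>i=a..<a + k * B. F i) \<le> real k * M1" for k a
  proof (induction k)
    case (Suc k)
    have "(\<Sum>i=a..<a + Suc k * B. F i) = (\<Sum>i=a..<a + k * B. F i) + (\<Sum>i=a + k * B..<a + k * B + B. F i)"
      by (subst sum.atLeastLessThan_concat) (auto simp: algebra_simps)
    hence "cmod (\<Sum>i=a..<a + Suc k * B. F i) \<le> real k * M1 + M1"
      using Suc.IH assms(1)[of "a + k * B"] by (simp only:) (rule order.trans[OF norm_triangle_ineq add_mono])
    thus ?case by (simp add: algebra_simps)
  qed simp
  show ?thesis unfolding bounded_sums_def
  proof (intro allI impI)
    fix a n assume n: "n \<le> P * B"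
    define k where "k = n div B"
    have k: "n = k * B + n mod B" by (simp add: k_def)
    have "k \<le> P" using n assms(3) unfolding k_def by (metis div_le_mono nonzero_mult_div_cancel_right not_one_le_zero)
    have "(\<Sum>i=a..<a + n. F i) = (\<Sum>i=a..<a + k * B. F i) + (\<Sum>i=a + k * B..<a + k * B + n mod B. F i)"
      using k by (subst sum.atLeastLessThan_concat) (auto simp: algebra_simps)
    hence "cmod (\<Sum>i=a..<a + n. F i) \<le> real k * M1 + M2"
      using full[of a k] assms(2)[of "n mod B" "a + k * B"] assms(3)
      by (simp only:) (rule order.trans[OF norm_triangle_ineq add_mono], auto)
    also have "\<dots> \<le> real P * M1 + M2" using \<open>k \<le> P\<close> assms(4) by (simp add: mult_right_mono)
    finally show "cmod (\<Sum>i=a..<a + n. F i) \<le> real P * M1 + M2" .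
  qed
qed

lemma twin_blocks_step:
  assumes c: "c > 0" "\<kappa> > 0" "C \<ge> 1"
  obtains Q :: nat and r :: real where "Q \<ge> 2" "3 / 4 \<le> r" "r < 1"
    "\<And>F Y M. twin_blocks c C \<kappa> X0 F \<Longrightarrow> Y \<ge> X0 \<Longrightarrow> Y \<ge> 1 \<Longrightarrow> bounded_sums F Y M \<Longrightarrow>
        bounded_sums F (Q * Y) (r * real Q * M)"
proof -
  define k where "k = \<kappa> ^ 2 / 16"
  have k: "k > 0" using c by (simp add: k_def)
  \<comment> \<open>At the scale X = G Y the gain k c G \<ge> 18 is twice the rounding cost
    9.\<close>
  define G where "G = nat \<lceil>18 / (k * c)\<rceil> + 1"
  have "real G \<ge> 18 / (k * c)" unfolding G_def by linarith
  hence G: "k * (c * real G) \<ge> 18" "G \<ge> 1" using k c by (auto simp: field_simps G_def)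
  \<comment> \<open>The remaining gain k c G / 2 relative to the length C G; the cap 1/2 keeps r at
    least 3/4.\<close>
  define g where "g = min (k * c / (2 * real C)) (1 / 2)"
  have g: "0 < g" "g \<le> 1 / 2" "g \<le> k * c / (2 * real C)" using k c by (auto simp: g_def)
  \<comment> \<open>With P blocks in a row, the incomplete one at the end costs at most half of the
    total saving.\<close>
  define P where "P = nat \<lceil>4 / g\<rceil> + 2"
  have "real P \<ge> 4 / g" unfolding P_def by linarith
  hence P: "real P * g \<ge> 4" "P \<ge> 2" using g by (auto simp: field_simps P_def)
  define Q where "Q = P * (C * G)"
  define r where "r = 1 - g / 2"
  have CG: "C * G \<ge> 1" using c(3) G(2) by simp
  have Q2: "Q \<ge> 2" unfolding Q_def using P CG by (metis le_trans mult_le_mono mult_1_right)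
  show ?thesis
  proof (rule that[OF Q2, of r])
    show "3 / 4 \<le> r" "r < 1" using g by (auto simp: r_def)
  next
    fix F Y M assume tw: "twin_blocks c C \<kappa> X0 F" and Y: "Y \<ge> X0" "Y \<ge> 1" and bs: "bounded_sums F Y M"
    have M: "M \<ge> 0" using bs by (rule bounded_sums_nonneg)
    define X where "X = G * Y"
    have "1 * Y \<le> X" unfolding X_def using G by (intro mult_right_mono) auto
    hence X: "X \<ge> X0" using Y by simp
    have main: "cmod (\<Sum>i=a..<a + C * X. F i) \<le> real (C * G) * (1 - g) * M" for a
    proof -
      obtain L p p' s v v' where *:
         "c * real X \<le> real L" "a \<le> p" "p + L \<le> p'" "p' + L \<le> p + s" "p' + s + L \<le> a + C * X"
         "cmod v = 1" "cmod v' = 1" "\<kappa> \<le> cmod (v - v')"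
         "\<forall>n. p \<le> n \<and> n < p + L \<longrightarrow> F (n + s) = v * F n"
         "\<forall>n. p' \<le> n \<and> n < p' + L \<longrightarrow> F (n + s) = v' * F n"
        using tw[unfolded twin_blocks_def, rule_format, OF X, of a] by (elim exE conjE) (rule that)
      have "cmod (\<Sum>i=a..<a + C * X. F i) \<le> (real (C * X) / real Y + 9 - k * (real L / real Y)) * M"
        using twin_blocks_gain[OF bs Y(2) *(2-8) _ *(9,10)] c(2) unfolding k_def by simp
      also have "\<dots> \<le> (real (C * G) * (1 - g)) * M"
      proof (rule mult_right_mono[OF _ M])
        have "k * (c * real G) \<le> k * (real L / real Y)"
          using *(1) Y(2) k by (intro mult_left_mono) (auto simp: X_def field_simps)
        moreover have "real (C * X) / real Y = real (C * G)" using Y(2) by (simp add: X_def)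
        moreover have "real (C * G) * g \<le> k * (c * real G) / 2"
        proof -
          have "real (C * G) * g \<le> real (C * G) * (k * c / (2 * real C))" using g by (intro mult_left_mono) auto
          also have "\<dots> = k * (c * real G) / 2" using c by (simp add: field_simps)
          finally show ?thesis .
        qed
        ultimately show "real (C * X) / real Y + 9 - k * (real L / real Y) \<le> real (C * G) * (1 - g)"
          using G(1) by (simp add: right_diff_distrib)
      qed
      finally show ?thesis .
    qed
    have "bounded_sums F (P * (C * X)) (real P * (real (C * G) * (1 - g) * M) + (real (C * G) + 1) * M)"
    proof (rule bounded_sums_blocks[OF main])
      fix a n assume n: "n < C * X"
      have "cmod (\<Sum>i=a..<a + n. F i) \<le> (real n / real Y + 1) * M" by (rule bounded_sums_long[OF bs Y(2)])
      also have "\<dots> \<le> (real (C * G) + 1) * M"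
      proof (intro mult_right_mono[OF _ M] add_right_mono)
        have "real n \<le> real (C * X)" using n unfolding of_nat_le_iff by simp
        thus "real n / real Y \<le> real (C * G)" using Y(2) by (simp add: X_def field_simps)
      qed
      finally show "cmod (\<Sum>i=a..<a + n. F i) \<le> (real (C * G) + 1) * M" .
    next
      show "C * X \<ge> 1" using c(3) G(2) Y(2) by (simp add: X_def)
      show "0 \<le> real (C * G) * (1 - g) * M" using g M by simp
    qed
    moreover have "P * (C * X) = Q * Y" by (simp add: Q_def X_def)
    moreover have "real P * (real (C * G) * (1 - g) * M) + (real (C * G) + 1) * M \<le> r * real Q * M"
    proof -
      have "real (C * G) + 1 \<le> 2 * real (C * G)" using CG by linarith
      also have "\<dots> \<le> real (C * G) * (real P * g / 2)"
        using mult_left_mono[OF P(1), of "real (C * G)"] by simp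
      finally have "real P * (real (C * G) * (1 - g)) + (real (C * G) + 1) \<le> r * real Q"
        unfolding r_def Q_def by (simp add: algebra_simps)
      from mult_right_mono[OF this M] show ?thesis by (simp add: algebra_simps)
    qed
    ultimately show "bounded_sums F (Q * Y) (r * real Q * M)"
      unfolding bounded_sums_def by (auto intro: order_trans)
  qed
qed

theorem twin_blocks_power_saving:
  assumes c: "c > 0" "\<kappa> > 0" "C \<ge> 1" and f: "\<And>n. cmod (f n) \<le> 1" and tw: "twin_blocks c C \<kappa> X0 f"
  obtains K \<delta> :: real where "K > 0" "0 < \<delta>" "\<delta> < 1"
    "\<And>a n t. n \<ge> 1 \<Longrightarrow> cmod (\<Sum>i=a..<a + n. f i * unit_exp (real i * t)) \<le> K * real n powr (1 - \<delta>)"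
proof -
  obtain Q r where Q: "Q \<ge> 2" "3 / 4 \<le> r" "r < 1" and
    step: "\<And>F Y M. twin_blocks c C \<kappa> X0 F \<Longrightarrow> Y \<ge> X0 \<Longrightarrow> Y \<ge> 1 \<Longrightarrow> bounded_sums F Y M \<Longrightarrow>
        bounded_sums F (Q * Y) (r * real Q * M)"
    using twin_blocks_step[OF c, of X0] by metis
  define Y0 where "Y0 = max X0 1"
  \<comment> \<open>Each iteration multiplies the length by Q and the bound by r Q, which is Q^(1 -
    \<delta>) for this \<delta>; that \<delta> < 1 comes from r \<ge> 3/4 and Q \<ge> 2.\<close>
  define \<delta> where "\<delta> = - ln r / ln (real Q)"
  have lnQ: "ln (real Q) > 0" using Q by simp
  have r_powr: "r = real Q powr (- \<delta>)"
    using lnQ Q by (simp add: \<delta>_def powr_def)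
  have d0: "\<delta> > 0" unfolding \<delta>_def using Q lnQ by (intro divide_pos_pos) auto
  have d1: "\<delta> < 1"
  proof -
    have "inverse r \<le> inverse (3 / 4)" using Q by (intro le_imp_inverse_le) auto
    also have "\<dots> < real Q" using Q by simp
    finally have "ln (inverse r) < ln (real Q)" using Q by (subst ln_less_cancel_iff) auto
    hence "- ln r < ln (real Q)" using Q by (simp add: ln_inverse)
    thus ?thesis unfolding \<delta>_def using lnQ by (simp add: field_simps)
  qed
  define K where "K = real Y0 * real Q powr (1 - \<delta>)"
  show ?thesis
  proof (rule that[OF _ d0 d1, of K])
    show "K > 0" using Q by (simp add: K_def Y0_def)
  next
    fix a n :: nat and t :: real assume n: "n \<ge> 1"
    define F where "F i = f i * unit_exp (real i * t)" for i
    have twF: "twin_blocks c C \<kappa> X0 F" unfolding F_def by (rule twin_blocks_twist[OF tw])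
    have bs: "bounded_sums F (Q ^ j * Y0) ((r * real Q) ^ j * real Y0)" for j
    proof (induction j)
      case 0
      have "cmod (\<Sum>i=a..<a + n. F i) \<le> real n" for a n
      proof -
        have "cmod (\<Sum>i=a..<a + n. F i) \<le> (\<Sum>i=a..<a + n. 1)"
          using f by (intro sum_norm_le) (simp add: F_def norm_mult)
        thus ?thesis by simp
      qed
      hence "cmod (\<Sum>i=a..<a + n. F i) \<le> real Y0" if "n \<le> Y0" for a n
        using that by (meson of_nat_le_iff order_trans)
      thus ?case unfolding bounded_sums_def by auto
    next
      case (Suc j)
      have "1 * Y0 \<le> Q ^ j * Y0" using Q by (intro mult_right_mono) auto
      hence "X0 \<le> Q ^ j * Y0" "1 \<le> Q ^ j * Y0" unfolding Y0_def by linarith+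
      from step[OF twF this Suc.IH] show ?case by (simp add: mult_ac)
    qed
    have "n < 2 ^ n" by (rule less_exp)
    also have "2 ^ n \<le> Q ^ n" using Q(1) by (rule power_mono) simp
    finally have ex: "\<exists>j. n \<le> Q ^ j" by (auto intro: less_imp_le)
    define j where "j = (LEAST j. n \<le> Q ^ j)"
    have j: "n \<le> Q ^ j" unfolding j_def using ex by (rule LeastI_ex)
    have Qj: "Q ^ j \<le> Q * n"
    proof (cases j)
      case 0
      have "1 * 1 \<le> Q * n" using Q n by (intro mult_mono) auto
      thus ?thesis using 0 by simp
    next
      case (Suc i)
      have "\<not> n \<le> Q ^ i" using not_less_Least[of i "\<lambda>j. n \<le> Q ^ j"] Suc by (simp add: j_def)
      thus ?thesis using Suc by simp
    qed
    have "n \<le> Q ^ j * Y0" using j by (metis Y0_def max.cobounded2 mult.right_neutral mult_le_mono)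
    hence "cmod (\<Sum>i=a..<a + n. F i) \<le> (r * real Q) ^ j * real Y0"
      using bs[of j] unfolding bounded_sums_def by blast
    also have "(r * real Q) ^ j = real (Q ^ j) powr (1 - \<delta>)"
    proof -
      have "r * real Q = real Q powr (1 - \<delta>)"
        unfolding r_powr using Q by (simp add: powr_diff powr_minus field_simps)
      hence "(r * real Q) ^ j = (real Q powr (1 - \<delta>)) ^ j" by simp
      also have "\<dots> = (real Q ^ j) powr (1 - \<delta>)"
        using Q by (simp add: powr_powr powr_realpow[symmetric] mult.commute)
      finally show ?thesis by simp
    qed
    also have "real (Q ^ j) powr (1 - \<delta>) * real Y0 \<le> real (Q * n) powr (1 - \<delta>) * real Y0"
      using Qj d1 by (intro mult_right_mono powr_mono2) (auto simp del: of_nat_mult of_nat_power)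
    also have "\<dots> = K * real n powr (1 - \<delta>)" by (simp add: K_def powr_mult)
    finally show "cmod (\<Sum>i=a..<a + n. f i * unit_exp (real i * t)) \<le> K * real n powr (1 - \<delta>)"
      unfolding F_def .
  qed
qed

section \<open>Step functions of two systems\<close>

definition jump_total :: "nat \<Rightarrow> nat \<Rightarrow> int" where
  "jump_total m l = (\<Sum>i=1..l. if odd i then int m else -1)"

text \<open>The limit of q(l+2) / q(l), equal to 1 / (1 - \<open>alpha m\<close>).\<close>

definition lam :: "nat \<Rightarrow> real" where
  "lam m = real m + 1 + alpha m"

lemma jump_total_Suc: "jump_total m (Suc l) = jump_total m l + (if even l then int m else -1)"
  by (simp add: jump_total_def)

section \<open>Growth ratios of the denominators\<close>

lemma alpha_inj:
  assumes "m1 \<ge> 1" "m2 \<ge> 1" "alpha m1 = alpha m2"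
  shows "m1 = m2"
proof -
  have "real m1 * (1 - alpha m1) = real m2 * (1 - alpha m1)"
    using alpha_sq[OF assms(1)] alpha_sq[OF assms(2)] assms(3) by metis
  thus ?thesis using alpha_lt1[OF assms(1)] by simp
qed

text \<open>If \<open>lam m1\<close> were \<open>lam m2\<close> - 1, the integer m2 - m1 - 1 would
  be a difference of two numbers in (0, 1), hence 0, and \<open>alpha\<close> would take the same
  value twice. Both ratios are limits of quotients of denominators, and their separation later
  isolates breakpoints.\<close>

lemma lam_separated:
  assumes "m1 \<ge> 1" "m2 \<ge> 1" "m1 < m2"
  shows "lam m1 < lam m2" "lam m1 \<noteq> lam m2 - 1"
proof -
  have a: "0 < alpha m1" "alpha m1 < 1" "0 < alpha m2" "alpha m2 < 1"
    using assms alpha_pos alpha_lt1 by auto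
  show "lam m1 < lam m2" using a assms(3) unfolding lam_def by linarith
  show "lam m1 \<noteq> lam m2 - 1"
  proof
    assume "lam m1 = lam m2 - 1"
    hence eq: "real m2 - real m1 - 1 = alpha m1 - alpha m2" by (simp add: lam_def)
    hence "real m2 - real m1 - 1 < 1" "real m2 - real m1 - 1 > -1" using a by linarith+
    hence "m2 = Suc m1" using assms(3) by linarith
    hence "alpha m1 = alpha m2" using eq by simp
    thus False using alpha_inj[OF assms(1,2)] assms(3) by simp
  qed
qed

context
  fixes m :: nat
  assumes m: "m \<ge> 1"
begin

lemma lam_gt: "lam m > 2" and lam_ge: "lam m > real m + 1"
  using m alpha_pos[OF m] by (auto simp: lam_def)

lemma lam_mu: "lam m + (1 - alpha m) = real m + 2" "lam m * (1 - alpha m) = 1"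
proof -
  show "lam m + (1 - alpha m) = real m + 2" by (simp add: lam_def)
  show "lam m * (1 - alpha m) = 1"
    using alpha_sq[OF m] by (simp add: lam_def power2_eq_square algebra_simps)
qed

lemma qd_step2: "real (qd m (l + 4)) = (real m + 2) * real (qd m (l + 2)) - real (qd m l)"
proof -
  have "qd m (Suc (Suc (Suc (Suc l)))) + qd m l = (m + 2) * qd m (Suc (Suc l))"
    unfolding qd_simps(3)[of m "Suc (Suc l)"] qd_simps(3)[of m "Suc l"] qd_simps(3)[of m l]
    by (auto simp: algebra_simps)
  hence "real (qd m (l + 4)) + real (qd m l) = real ((m + 2) * qd m (l + 2))"
    by (simp add: numeral_eq_Suc flip: of_nat_add)
  thus ?thesis by (simp add: algebra_simps)
qed

text \<open>The two-step recursion has the characteristic roots \<open>lam m\<close> and 1 -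
  \<open>alpha m\<close>; removing the dominant one leaves a defect that shrinks by the factor 1 -
  \<open>alpha m\<close>.\<close>

lemma qd_lam_step: "real (qd m (l + 4)) - lam m * real (qd m (l + 2)) = (1 - alpha m) * (real (qd m (l + 2)) - lam m * real (qd m l))"
proof -
  have "(1 - alpha m) * (real (qd m (l + 2)) - lam m * real (qd m l))
      = (1 - alpha m) * real (qd m (l + 2)) - (lam m * (1 - alpha m)) * real (qd m l)"
    by (simp add: algebra_simps)
  also have "\<dots> = (real m + 2 - lam m) * real (qd m (l + 2)) - real (qd m l)"
    using lam_mu by (simp add: algebra_simps)
  finally show ?thesis unfolding qd_step2 by (simp add: algebra_simps)
qed

lemma qd_lam: "\<bar>real (qd m (l + 2)) - lam m * real (qd m l)\<bar> \<le> 1"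
proof (induction l rule: less_induct)
  case (less l)
  have a: "0 < alpha m" "alpha m < 1" using alpha_pos[OF m] alpha_lt1[OF m] .
  consider "l = 0" | "l = 1" | k where "l = k + 2"
    by (metis One_nat_def add_2_eq_Suc' not0_implies_Suc)
  thus ?case
  proof cases
    case 1
    have "qd m (0 + 2) = m + 1" using qd_simps(3)[of m 0] by (simp add: qd_simps numeral_2_eq_2)
    thus ?thesis using 1 a by (simp add: lam_def qd_simps)
  next
    case 2
    have "qd m (1 + 2) = m + 2"
      using qd_simps(3)[of m 1] qd_simps(3)[of m 0] by (simp add: qd_simps numeral_eq_Suc)
    thus ?thesis using 2 a qd_simps(2)[of m] by (simp add: lam_def)
  next
    case (3 k)
    have "\<bar>real (qd m (k + 4)) - lam m * real (qd m (k + 2))\<bar>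
        = (1 - alpha m) * \<bar>real (qd m (k + 2)) - lam m * real (qd m k)\<bar>"
      unfolding qd_lam_step abs_mult using a by simp
    also have "\<dots> \<le> 1 * 1" using less.IH[of k] 3 a by (intro mult_mono) auto
    finally show ?thesis using 3 by (simp add: numeral_eq_Suc)
  qed
qed

text \<open>For odd l the partial quotient of index l + 2 is 1, so q(l+1) = q(l+2) - q(l).\<close>

lemma qd_lam_odd:
  assumes "odd l"
  shows "\<bar>real (qd m (l + 1)) - (lam m - 1) * real (qd m l)\<bar> \<le> 1"
proof -
  have "qd m (Suc (Suc l)) = qd m (Suc l) + qd m l" using assms by (simp add: qd_simps(3))
  hence "real (qd m (l + 2)) = real (qd m (l + 1)) + real (qd m l)" by simp
  thus ?thesis using qd_lam[of l] by (simp add: algebra_simps)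
qed

lemma qd_even_Suc:
  assumes "even l" "l \<ge> 1"
  shows "qd m (l + 1) \<le> 2 * qd m l"
proof -
  obtain k where k: "l = Suc k" using assms by (cases l) auto
  have "qd m (Suc (Suc k)) = qd m (Suc k) + qd m k" using assms k by (simp add: qd_simps(3))
  thus ?thesis using qd_mono[OF m, of k "Suc k"] k by simp
qed

lemma qd_gap:
  assumes "l \<ge> 1" "\<sigma> \<le> 1 / (real m + 2)"
  shows "(1 + \<sigma>) * real (qd m l) \<le> real (qd m (l + 1))" "l \<ge> 2 \<Longrightarrow> real (qd m (l - 1)) \<le> (1 - \<sigma>) * real (qd m l)"
proof -
  have gen: "(1 + 1 / (real m + 1)) * real (qd m l) \<le> real (qd m (l + 1))" if l1: "l \<ge> 1" for l
  proof -
    obtain k where k: "l = Suc k" using l1 by (cases l) auto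
    have "real (qd m (Suc k)) \<le> real ((m + 1) * qd m k)" unfolding of_nat_le_iff by (rule qd_Suc_le[OF m])
    hence "real (qd m (Suc k)) / (real m + 1) \<le> real (qd m k)" by (simp add: divide_le_eq algebra_simps)
    moreover have "qd m (Suc (Suc k)) \<ge> qd m (Suc k) + qd m k"
      unfolding qd_simps(3)[of m k] using m by simp
    ultimately have "real (qd m (Suc k)) + real (qd m (Suc k)) / (real m + 1) \<le> real (qd m (Suc (Suc k)))" by linarith
    thus ?thesis unfolding k by (simp add: algebra_simps)
  qed
  have "1 / (real m + 2) \<le> 1 / (real m + 1)" by (simp add: field_simps)
  hence "(1 + \<sigma>) * real (qd m l) \<le> (1 + 1 / (real m + 1)) * real (qd m l)"
    using assms(2) by (intro mult_right_mono) auto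
  thus "(1 + \<sigma>) * real (qd m l) \<le> real (qd m (l + 1))" using gen[OF assms(1)] by linarith
  assume l2: "l \<ge> 2"
  hence "(1 + 1 / (real m + 1)) * real (qd m (l - 1)) \<le> real (qd m l)" using gen[of "l - 1"] by simp
  hence "(real m + 2) * real (qd m (l - 1)) \<le> (real m + 1) * real (qd m l)"
    by (simp add: field_simps)
  hence "real (qd m (l - 1)) \<le> (1 - 1 / (real m + 2)) * real (qd m l)"
    by (simp add: field_simps)
  also have "\<dots> \<le> (1 - \<sigma>) * real (qd m l)" using assms(2) by (intro mult_right_mono) auto
  finally show "real (qd m (l - 1)) \<le> (1 - \<sigma>) * real (qd m l)" .
qed

lemma jump_sum_eq_total:
  assumes "l \<ge> 1" "qd m l < n" "n \<le> qd m (l + 1)"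
  shows "jump_sum m n = jump_total m l"
proof -
  have "{i. 1 \<le> i \<and> qd m i < n} = {1..l}"
  proof (intro equalityI subsetI)
    fix i assume "i \<in> {i. 1 \<le> i \<and> qd m i < n}"
    hence i: "1 \<le> i" "qd m i < qd m (l + 1)" using assms by auto
    hence "\<not> l + 1 \<le> i" using qd_mono[OF m] by (metis not_le)
    thus "i \<in> {1..l}" using i by simp
  next
    fix i assume "i \<in> {1..l}"
    thus "i \<in> {i. 1 \<le> i \<and> qd m i < n}" using qd_mono[OF m, of i l] assms by auto
  qed
  thus ?thesis by (simp add: jump_sum_def jump_total_def)
qed

end

section \<open>Windows on the two sides of a cluster of breakpoints\<close>

text \<open>The breakpoints of both systems near x form a cluster within relative distance \<eta>.
  The window at A lies below the cluster, the one at B above it; both have relative length about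
  \<epsilon> and contain no breakpoint.\<close>

lemma jump_sum_constant_ranges:
  fixes x \<eta> \<epsilon> :: real
  assumes m: "m1 \<ge> 1" "m2 \<ge> 1" and e: "0 \<le> \<eta>" "0 < \<epsilon>" "\<eta> + \<epsilon> \<le> 1" and x: "\<epsilon> * x \<ge> 2"
    and i: "a1 \<ge> 1" "a2 \<ge> 1" "b1 \<ge> 1" "b2 \<ge> 1"
    and a: "real (qd m1 a1) \<le> (1 - \<eta> - \<epsilon>) * x" "(1 - \<eta>) * x \<le> real (qd m1 (a1 + 1))"
      "real (qd m2 a2) \<le> (1 - \<eta> - \<epsilon>) * x" "(1 - \<eta>) * x \<le> real (qd m2 (a2 + 1))"
    and b: "real (qd m1 b1) \<le> (1 + \<eta>) * x" "(1 + \<eta> + \<epsilon>) * x \<le> real (qd m1 (b1 + 1))"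
      "real (qd m2 b2) \<le> (1 + \<eta>) * x" "(1 + \<eta> + \<epsilon>) * x \<le> real (qd m2 (b2 + 1))"
  obtains A B L where "\<epsilon> / 2 * x \<le> real L" "1 \<le> A" "A + L \<le> B" "real (B + L) \<le> 3 * x"
    "\<And>n. A \<le> n \<Longrightarrow> n < A + L \<Longrightarrow> jump_sum m1 n = jump_total m1 a1 \<and> jump_sum m2 n = jump_total m2 a2"
    "\<And>n. B \<le> n \<Longrightarrow> n < B + L \<Longrightarrow> jump_sum m1 n = jump_total m1 b1 \<and> jump_sum m2 n = jump_total m2 b2"
proof -
  have x0: "x > 0" using x e by (smt (verit) mult_nonneg_nonpos)
  have x2: "x \<ge> 2"
  proof -
    have "\<epsilon> * x \<le> 1 * x" using e x0 by (intro mult_right_mono) auto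
    thus ?thesis using x by linarith
  qed
  define A where "A = nat \<lfloor>(1 - \<eta> - \<epsilon>) * x\<rfloor> + 1"
  define B where "B = nat \<lfloor>(1 + \<eta>) * x\<rfloor> + 1"
  define L where "L = nat \<lfloor>\<epsilon> * x\<rfloor>"
  have nn: "(1 - \<eta> - \<epsilon>) * x \<ge> 0" "(1 + \<eta>) * x \<ge> 0" "\<epsilon> * x \<ge> 0" using e x0 by auto
  have A: "real A > (1 - \<eta> - \<epsilon>) * x" "real A \<le> (1 - \<eta> - \<epsilon>) * x + 1" using nn(1) unfolding A_def by linarith+
  have B: "real B > (1 + \<eta>) * x" "real B \<le> (1 + \<eta>) * x + 1" using nn(2) unfolding B_def by linarith+
  have L: "real L \<le> \<epsilon> * x" "real L > \<epsilon> * x - 1" using nn(3) unfolding L_def by linarith+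
  have sumA: "(1 - \<eta> - \<epsilon>) * x + \<epsilon> * x = (1 - \<eta>) * x" "(1 + \<eta>) * x + \<epsilon> * x = (1 + \<eta> + \<epsilon>) * x"
    by (simp_all add: algebra_simps)
  have "(1 - \<eta>) * x \<le> (1 + \<eta>) * x" using e x0 by (intro mult_right_mono) auto
  hence "real A + real L < real B + 1" using A B L sumA by linarith
  hence AB: "A + L \<le> B" by linarith
  have "(1 + \<eta> + \<epsilon>) * x \<le> 2 * x" using e x0 by (intro mult_right_mono) auto
  hence BL: "real (B + L) \<le> 3 * x" using B L sumA x2 unfolding of_nat_add by linarith
  show ?thesis
  proof (rule that[of L A B])
    show "\<epsilon> / 2 * x \<le> real L" using L x by simp
    show "1 \<le> A" by (simp add: A_def)
    show "A + L \<le> B" by (rule AB)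
    show "real (B + L) \<le> 3 * x" by (rule BL)
  next
    fix n assume n: "A \<le> n" "n < A + L"
    have "real n > (1 - \<eta> - \<epsilon>) * x" using n A by linarith
    moreover have "real n \<le> (1 - \<eta>) * x"
      using n A L sumA by linarith
    ultimately have "qd m1 a1 < n" "n \<le> qd m1 (a1 + 1)" "qd m2 a2 < n" "n \<le> qd m2 (a2 + 1)"
      using a by linarith+
    thus "jump_sum m1 n = jump_total m1 a1 \<and> jump_sum m2 n = jump_total m2 a2" using jump_sum_eq_total[OF m(1) i(1)] jump_sum_eq_total[OF m(2) i(2)] by blast
  next
    fix n assume n: "B \<le> n" "n < B + L"
    have "real n > (1 + \<eta>) * x" using n B by linarith
    moreover have "real n \<le> (1 + \<eta> + \<epsilon>) * x"
      using n B L sumA by linarith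
    ultimately have "qd m1 b1 < n" "n \<le> qd m1 (b1 + 1)" "qd m2 b2 < n" "n \<le> qd m2 (b2 + 1)"
      using b by linarith+
    thus "jump_sum m1 n = jump_total m1 b1 \<and> jump_sum m2 n = jump_total m2 b2" using jump_sum_eq_total[OF m(1) i(3)] jump_sum_eq_total[OF m(2) i(4)] by blast
  qed
qed

text \<open>With w at least about p x and z at most about r x, up to errors e x, a gap G between p
  and r that dominates e survives as a relative gap \<epsilon> between w and z.
  \<open>separated_above\<close> is the mirror image.\<close>

lemma separated_below:
  fixes x w z p r e G \<Lambda> :: real
  assumes "x \<ge> 0" "(p - e) * x \<le> w" "z \<le> (r + e) * x" "r + G \<le> p" "0 \<le> e" "e \<le> G / 8"
    "0 < G" "G \<le> \<Lambda>" "0 < p" "p \<le> \<Lambda>" "\<epsilon> \<le> G / (8 * \<Lambda>)" "0 < \<epsilon>"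
  shows "z \<le> (1 - \<epsilon>) * w"
proof -
  have L: "\<Lambda> > 0" using assms by linarith
  have eL: "\<epsilon> * (8 * \<Lambda>) \<le> G" using assms(11) L by (simp add: pos_le_divide_eq)
  have "\<epsilon> * p \<le> \<epsilon> * \<Lambda>" using assms by (intro mult_left_mono) auto
  hence ep: "\<epsilon> * p \<le> G / 8" using eL by linarith
  have "\<epsilon> * e \<ge> 0" using assms by simp
  have "r + e \<le> p - e - \<epsilon> * p" using assms ep by linarith
  also have "\<dots> \<le> (1 - \<epsilon>) * (p - e)" using \<open>\<epsilon> * e \<ge> 0\<close> by (simp add: algebra_simps)
  finally have "(r + e) * x \<le> (1 - \<epsilon>) * (p - e) * x" using assms(1) by (rule mult_right_mono)
  also have "\<dots> = (1 - \<epsilon>) * ((p - e) * x)" by simp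
  also have "\<dots> \<le> (1 - \<epsilon>) * w"
  proof (rule mult_left_mono[OF assms(2)])
    have "\<epsilon> * (8 * \<Lambda>) \<le> 1 * (8 * \<Lambda>)" using eL assms L by linarith
    thus "0 \<le> 1 - \<epsilon>" using L mult_le_cancel_right_pos[of "8 * \<Lambda>" \<epsilon> 1] by simp
  qed
  finally show ?thesis using assms(3) by linarith
qed

lemma separated_above:
  fixes x w z p r e G \<Lambda> :: real
  assumes "x \<ge> 0" "w \<le> (p + e) * x" "(r - e) * x \<le> z" "p + G \<le> r" "0 \<le> e" "e \<le> G / 8"
    "0 < G" "G \<le> \<Lambda>" "0 < p" "p \<le> \<Lambda>" "\<epsilon> \<le> G / (8 * \<Lambda>)" "0 < \<epsilon>"
  shows "(1 + \<epsilon>) * w \<le> z"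
proof -
  have L: "\<Lambda> > 0" using assms by linarith
  have eL: "\<epsilon> * (8 * \<Lambda>) \<le> G" using assms(11) L by (simp add: pos_le_divide_eq)
  have "\<epsilon> * (p + e) \<le> \<epsilon> * (2 * \<Lambda>)" using assms by (intro mult_left_mono) auto
  hence ep: "\<epsilon> * (p + e) \<le> G / 4" using eL by linarith
  have "(1 + \<epsilon>) * w \<le> (1 + \<epsilon>) * ((p + e) * x)" using assms by (intro mult_left_mono) auto
  also have "\<dots> = (p + e + \<epsilon> * (p + e)) * x" by (simp add: algebra_simps)
  also have "\<dots> \<le> (r - e) * x" using assms ep by (intro mult_right_mono) auto
  finally show ?thesis using assms(3) by linarith
qed

lemma finite_nontrivial_unit_exp:
  assumes "finite J"
  obtains \<kappa> :: real where "\<kappa> > 0" "\<And>j. j \<in> J \<Longrightarrow> j \<notin> \<int> \<Longrightarrow> \<kappa> \<le> cmod (1 - unit_exp j)"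
proof -
  define R where "R = insert 1 ((\<lambda>j. cmod (1 - unit_exp j)) ` (J - \<int>))"
  have fin: "finite R" "R \<noteq> {}" using assms by (auto simp: R_def)
  have "\<forall>r\<in>R. r > 0" using unit_exp_eq_1_imp_Ints by (force simp: R_def)
  hence "Min R > 0" using fin by simp
  moreover have "Min R \<le> cmod (1 - unit_exp j)" if "j \<in> J" "j \<notin> \<int>" for j
    using fin that by (intro Min_le) (auto simp: R_def)
  ultimately show ?thesis using that by blast
qed

lemma qd_bracket:
  assumes "m \<ge> 1" "x \<ge> (1::real)"
  obtains l where "l \<ge> 1" "real (qd m l) \<le> x" "x < real (qd m (l + 1))"
proof -
  have "x < real (nat \<lceil>x\<rceil> + 1)" by linarith
  also have "\<dots> \<le> real (qd m (nat \<lceil>x\<rceil> + 1))" unfolding of_nat_le_iff by (rule qd_ge[OF assms(1)])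
  finally have ex: "\<exists>l. x < real (qd m l)" by blast
  define k where "k = (LEAST l. x < real (qd m l))"
  have k: "x < real (qd m k)" unfolding k_def using ex by (rule LeastI_ex)
  have "k \<noteq> 0" using k assms(2) qd_simps(1)[of m] by (intro notI) simp
  moreover have "k \<noteq> Suc 0" using k assms(2) qd_simps(2)[of m] by (intro notI) simp
  ultimately obtain l where l: "k = l + 1" "l \<ge> 1" by (cases k) auto
  have "\<not> x < real (qd m l)" using not_less_Least[of l "\<lambda>l. x < real (qd m l)"] l by (simp add: k_def)
  thus ?thesis using that l k by auto
qed

text \<open>Around the breakpoint \<open>x = q\<^sub>2\<^sub>k\<^sub>+\<^sub>1\<close> of the second system the second step function jumps by \<open>m\<^sub>2\<close>.
  If a breakpoint of the first system lies so close that the two jumps compensate, then the next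
  breakpoint of the same kind in the system with the smaller ratio \<open>lam\<close> is isolated.\<close>

theorem jump_sum_combination_nonconstant:
  fixes \<theta> \<beta> :: real
  assumes m: "m1 \<ge> 2" "m2 \<ge> 2" "m1 \<noteq> m2" and \<beta>: "real m2 * \<beta> \<notin> \<int>"
  obtains c C \<kappa> :: real and X0 :: nat where "c > 0" "C > 0" "\<kappa> > 0"
    "\<And>X. X \<ge> X0 \<Longrightarrow> \<exists>A B L u u'. c * real X \<le> real L \<and> 1 \<le> A \<and> A + L \<le> B \<and> real (B + L) \<le> C * real X \<and>
       \<kappa> \<le> cmod (unit_exp u - unit_exp u') \<and>
       (\<forall>n. A \<le> n \<and> n < A + L \<longrightarrow> \<theta> * of_int (jump_sum m1 n) + \<beta> * of_int (jump_sum m2 n) = u) \<and>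
       (\<forall>n. B \<le> n \<and> n < B + L \<longrightarrow> \<theta> * of_int (jump_sum m1 n) + \<beta> * of_int (jump_sum m2 n) = u')"
proof -
  have m': "m1 \<ge> 1" "m2 \<ge> 1" using m by auto
  define jp :: "nat \<Rightarrow> real" where "jp l = (if odd l then real m1 else -1)" for l
  have V1: "of_int (jump_total m1 (l + 1)) = of_int (jump_total m1 l) + jp (l + 1)" for l
    by (simp add: jump_total_Suc jp_def)
  have V2: "of_int (jump_total m2 (l + 1)) = of_int (jump_total m2 l) + real m2" if "odd (l + 1)" for l
    using that by (simp add: jump_total_Suc)
  \<comment> \<open>The set contains every total jump that can occur below, so one \<kappa> serves
    all scales.\<close>
  obtain \<kappa> where \<kappa>: "\<kappa> > 0" "\<And>j. j \<in> {\<beta> * m2, \<theta> * m1 + \<beta> * m2, \<theta> * (-1) + \<beta> * m2, \<theta> * m1, \<theta> * (-1)} \<Longrightarrow>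
      j \<notin> \<int> \<Longrightarrow> \<kappa> \<le> cmod (1 - unit_exp j)"
    by (rule finite_nontrivial_unit_exp[of "{\<beta> * m2, \<theta> * m1 + \<beta> * m2, \<theta> * (-1) + \<beta> * m2, \<theta> * m1, \<theta> * (-1)}"]) auto
  define \<Lambda> where "\<Lambda> = lam m1 + lam m2"
  \<comment> \<open>Least distance between ratios that must be told apart: \<open>lam\<close> of one
    system against \<open>lam\<close> and \<open>lam\<close> - 1 of the other. The cap 1/2 serves
    the comparisons with 1 and with 2 + 2 \<eta>.\<close>
  define G where "G = min (min \<bar>lam m1 - lam m2\<bar> (1/2)) (min \<bar>lam m1 - (lam m2 - 1)\<bar> \<bar>lam m2 - (lam m1 - 1)\<bar>)"
  \<comment> \<open>A relative gap between consecutive denominators, valid in both systems. The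
    cluster radius \<eta> is small against it, and small enough that the error e stays below G /
    8.\<close>
  define \<sigma> where "\<sigma> = 1 / (real (max m1 m2) + 2)"
  define \<eta> where "\<eta> = min (\<sigma> / 4) (G / (8 * (\<Lambda> + 1)))"
  define \<epsilon> where "\<epsilon> = min \<eta> (G / (8 * \<Lambda>))"
  have lam: "lam m1 > 2" "lam m2 > 2" "lam m1 > real m1 + 1" "lam m2 > real m2 + 1"
    using lam_gt m' lam_ge by auto
  have \<Lambda>: "lam m1 \<le> \<Lambda>" "lam m2 \<le> \<Lambda>" "\<Lambda> > 4" using lam by (auto simp: \<Lambda>_def)
  have G0: "G > 0"
    using lam_separated[OF m'(1,2)] lam_separated[OF m'(2,1)] m(3) unfolding G_def
    by (cases "m1 < m2") (auto simp: not_less le_less)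
  have G1: "G \<le> \<bar>lam m1 - lam m2\<bar>" "G \<le> 1/2" "G \<le> \<bar>lam m1 - (lam m2 - 1)\<bar>" "G \<le> \<bar>lam m2 - (lam m1 - 1)\<bar>"
    unfolding G_def by (meson min.cobounded1 min.cobounded2 order_trans)+
  have G\<Lambda>: "G \<le> \<Lambda>" using G1 \<Lambda> by linarith
  have \<sigma>: "0 < \<sigma>" "\<sigma> \<le> 1 / 4" "\<sigma> \<le> 1 / (real m1 + 2)" "\<sigma> \<le> 1 / (real m2 + 2)"
    using m by (auto simp: \<sigma>_def intro!: divide_left_mono)
  have \<eta>: "0 < \<eta>" "\<eta> \<le> \<sigma> / 4" "\<eta> \<le> G / (8 * (\<Lambda> + 1))" 
    using \<sigma> G0 \<Lambda> unfolding \<eta>_def by (auto intro: min.cobounded1 min.cobounded2 simp del: min.bounded_iff le_divide_eq_numeral1 divide_le_eq_numeral1)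
  have \<epsilon>: "0 < \<epsilon>" "\<epsilon> \<le> \<eta>" "\<epsilon> \<le> G / (8 * \<Lambda>)" using \<eta> G0 \<Lambda> by (auto simp: \<epsilon>_def)
  define e where "e = (\<Lambda> + 1) * \<eta>"
  have e: "0 \<le> e" "e \<le> G / 8" using \<eta> \<Lambda> G0 by (auto simp: e_def field_simps)
  define good where "good x = (\<exists>A B L u u'. \<epsilon> / 2 * x \<le> real L \<and> 1 \<le> A \<and> A + L \<le> B \<and> real (B + L) \<le> 3 * (\<Lambda> + 2) * x \<and>
       \<kappa> \<le> cmod (unit_exp u - unit_exp u') \<and>
       (\<forall>n. A \<le> n \<and> n < A + L \<longrightarrow> \<theta> * of_int (jump_sum m1 n) + \<beta> * of_int (jump_sum m2 n) = u) \<and>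
       (\<forall>n. B \<le> n \<and> n < B + L \<longrightarrow> \<theta> * of_int (jump_sum m1 n) + \<beta> * of_int (jump_sum m2 n) = u'))" for x :: real
  have goodI: "good x"
    if w: "x \<le> w" "w \<le> (\<Lambda> + 2) * x" "\<epsilon> * x \<ge> 2" and h: "0 \<le> h" "h \<le> \<eta>"
      and i: "a1 \<ge> 1" "a2 \<ge> 1" "b1 \<ge> 1" "b2 \<ge> 1"
    and a: "real (qd m1 a1) \<le> (1 - h - \<epsilon>) * w" "(1 - h) * w \<le> real (qd m1 (a1 + 1))"
      "real (qd m2 a2) \<le> (1 - h - \<epsilon>) * w" "(1 - h) * w \<le> real (qd m2 (a2 + 1))"
    and b: "real (qd m1 b1) \<le> (1 + h) * w" "(1 + h + \<epsilon>) * w \<le> real (qd m1 (b1 + 1))"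
      "real (qd m2 b2) \<le> (1 + h) * w" "(1 + h + \<epsilon>) * w \<le> real (qd m2 (b2 + 1))"
    and j: "j = \<theta> * (of_int (jump_total m1 b1) - of_int (jump_total m1 a1)) + \<beta> * (of_int (jump_total m2 b2) - of_int (jump_total m2 a2))"
      "j \<in> {\<beta> * m2, \<theta> * m1 + \<beta> * m2, \<theta> * (-1) + \<beta> * m2, \<theta> * m1, \<theta> * (-1)}" "j \<notin> \<int>"
    for x w h j :: real and a1 a2 b1 b2
  proof -
    have he: "h + \<epsilon> \<le> 1" using h \<epsilon> \<eta> \<sigma> by linarith
    have "\<epsilon> * x \<le> \<epsilon> * w" using w \<epsilon> by (intro mult_left_mono) auto
    hence ew: "2 \<le> \<epsilon> * w" using w by linarith
    obtain A B L where *: "\<epsilon> / 2 * w \<le> real L" "1 \<le> A" "A + L \<le> B" "real (B + L) \<le> 3 * w"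
      "\<And>n. A \<le> n \<Longrightarrow> n < A + L \<Longrightarrow> jump_sum m1 n = jump_total m1 a1 \<and> jump_sum m2 n = jump_total m2 a2"
      "\<And>n. B \<le> n \<Longrightarrow> n < B + L \<Longrightarrow> jump_sum m1 n = jump_total m1 b1 \<and> jump_sum m2 n = jump_total m2 b2"
      using jump_sum_constant_ranges[OF m' h(1) \<epsilon>(1) he ew i a b] by metis
    define u where "u = \<theta> * of_int (jump_total m1 a1) + \<beta> * of_int (jump_total m2 a2)"
    define u' where "u' = \<theta> * of_int (jump_total m1 b1) + \<beta> * of_int (jump_total m2 b2)"
    have "u' = u + j" unfolding u_def u'_def j(1) by (simp add: algebra_simps)
    hence "unit_exp u - unit_exp u' = unit_exp u * (1 - unit_exp j)" by (simp add: unit_exp_add algebra_simps)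
    hence "\<kappa> \<le> cmod (unit_exp u - unit_exp u')" using \<kappa>(2)[OF j(2,3)] by (simp add: norm_mult)
    moreover have "\<epsilon> / 2 * x \<le> real L" using *(1) \<open>\<epsilon> * x \<le> \<epsilon> * w\<close> by linarith
    moreover have "real (B + L) \<le> 3 * (\<Lambda> + 2) * x" using *(4) w(2) by linarith
    ultimately show ?thesis unfolding good_def
      using * by (intro exI[of _ A] exI[of _ B] exI[of _ L] exI[of _ u] exI[of _ u'])
        (auto simp: u_def u'_def)
  qed
  have isolated: "good x" \<comment> \<open>a breakpoint \<open>w\<close> of one system, far from those of the other\<close>
    if w: "x \<le> w" "w \<le> (\<Lambda> + 2) * x" "\<epsilon> * x \<ge> 2"
      and i: "a1 \<ge> 1" "a2 \<ge> 1" "b1 \<ge> 1" "b2 \<ge> 1"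
    and a: "real (qd m1 a1) \<le> (1 - \<epsilon>) * w" "w \<le> real (qd m1 (a1 + 1))"
      "real (qd m2 a2) \<le> (1 - \<epsilon>) * w" "w \<le> real (qd m2 (a2 + 1))"
    and b: "real (qd m1 b1) \<le> w" "(1 + \<epsilon>) * w \<le> real (qd m1 (b1 + 1))"
      "real (qd m2 b2) \<le> w" "(1 + \<epsilon>) * w \<le> real (qd m2 (b2 + 1))"
    and j: "j = \<theta> * (of_int (jump_total m1 b1) - of_int (jump_total m1 a1)) + \<beta> * (of_int (jump_total m2 b2) - of_int (jump_total m2 a2))"
      "j \<in> {\<beta> * m2, \<theta> * m1 + \<beta> * m2, \<theta> * (-1) + \<beta> * m2, \<theta> * m1, \<theta> * (-1)}" "j \<notin> \<int>"
    for x w j :: real and a1 a2 b1 b2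
    by (rule goodI[of x w 0 a1 a2 b1 b2 j]) (use w i a b j \<eta> in simp_all)
  have gap1: "real (qd m1 (l - 1)) \<le> (1 - \<epsilon>) * real (qd m1 l)" "(1 + \<epsilon>) * real (qd m1 l) \<le> real (qd m1 (l + 1))"
    if "l \<ge> 2" for l using qd_gap[OF m'(1), of l \<epsilon>] that \<epsilon> \<eta> \<sigma> by auto
  have gap2: "real (qd m2 (l - 1)) \<le> (1 - \<epsilon>) * real (qd m2 l)" "(1 + \<epsilon>) * real (qd m2 l) \<le> real (qd m2 (l + 1))"
    if "l \<ge> 2" for l using qd_gap[OF m'(2), of l \<epsilon>] that \<epsilon> \<eta> \<sigma> by auto
  have nb: "\<beta> * real m2 \<notin> \<int>" using \<beta> by (simp add: mult.commute)
  have main: "good (real (qd m2 l2))" if l2: "odd l2" "l2 \<ge> 2" and big: "\<epsilon> * real (qd m2 l2) \<ge> 2" for l2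
  proof -
    define x where "x = real (qd m2 l2)"
    have x0: "x \<ge> 1" using qd_pos[OF m'(2), of l2] unfolding x_def by linarith
    have bigx: "\<epsilon> * x \<ge> 2" using big by (simp add: x_def)
    have etax: "\<eta> * x \<ge> 1"
    proof -
      have "\<epsilon> * x \<le> \<eta> * x" using \<epsilon> x0 by (intro mult_right_mono) auto
      thus ?thesis using bigx by linarith
    qed
    have xL: "x \<le> (\<Lambda> + 2) * x" using x0 \<Lambda> mult_right_mono[of 1 "\<Lambda> + 2" x] by simp
    have l2': "l2 - 1 + 1 = l2" "l2 - 1 \<ge> 1" using l2 by auto
    have V2': "of_int (jump_total m2 l2) = of_int (jump_total m2 (l2 - 1)) + real m2" using V2[of "l2 - 1"] l2 l2' by simp
    \<comment> \<open>Without a denominator of the first system near x, the jump at x is \<beta> m2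
      alone. Requiring l1 \<ge> 2 leaves out the value 1, which lies far below x.\<close>
    show "good (real (qd m2 l2))"
    proof (cases "\<exists>l1\<ge>2. \<bar>real (qd m1 l1) - x\<bar> \<le> \<eta> * x")
      case False
      obtain l where l: "l \<ge> 1" "real (qd m1 l) \<le> x" "x < real (qd m1 (l + 1))"
        using qd_bracket[OF m'(1) x0] .
      have "real (qd m1 l) \<le> x - \<eta> * x"
      proof (cases "l \<ge> 2")
        case True
        thus ?thesis using False l by (smt (verit))
      next
        case lf: False
        hence "l = Suc 0" using l by simp
        hence "real (qd m1 l) = 1" by (simp add: qd_simps)
        moreover have "\<eta> * x \<le> 1 / 2 * x" using \<eta> \<sigma> x0 by (intro mult_right_mono) auto
        moreover have "\<epsilon> * x \<le> 1 / 2 * x" using \<epsilon> \<eta> \<sigma> x0 by (intro mult_right_mono) auto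
        ultimately show ?thesis using bigx by linarith
      qed
      moreover have "\<epsilon> * x \<le> \<eta> * x" using \<epsilon> x0 by (intro mult_right_mono) auto
      moreover have "real (qd m1 (l + 1)) \<ge> x + \<eta> * x"
        using False l by (smt (verit) add_le_mono nat_1_add_1 le_refl)
      ultimately have q1: "real (qd m1 l) \<le> (1 - \<epsilon>) * x" "(1 + \<epsilon>) * x \<le> real (qd m1 (l + 1))"
        by (simp_all add: algebra_simps)
      show ?thesis unfolding x_def[symmetric]
        using isolated[of x x l "l2 - 1" l l2 "\<beta> * m2"] xL bigx l q1 l2' gap2[OF l2(2)] V2' nb
        by (auto simp: x_def)
    next
      case True
      then obtain l1 where l1: "l1 \<ge> 2" "\<bar>real (qd m1 l1) - x\<bar> \<le> \<eta> * x" by blast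
      define y where "y = real (qd m1 l1)"
      have y: "(1 - \<eta>) * x \<le> y" "y \<le> (1 + \<eta>) * x" using l1(2) unfolding y_def by (auto simp: algebra_simps)
      have l1': "l1 - 1 + 1 = l1" "l1 - 1 \<ge> 1" using l1 by auto
      have V1': "of_int (jump_total m1 l1) = of_int (jump_total m1 (l1 - 1)) + jp l1" using V1[of "l1 - 1"] l1' by simp
      \<comment> \<open>A nonintegral total jump shows in windows around the whole cluster. An
        integral one forces \<theta> \<open>jp l1\<close> to be nonintegral; two indices further the
        jumps repeat, but the denominators of the two systems have drifted apart.\<close>
      show ?thesis
      proof (cases "\<theta> * jp l1 + \<beta> * m2 \<in> \<int>")
        case False
        have he: "\<eta> + \<epsilon> \<le> \<sigma> / 2" using \<epsilon> \<eta> by linarith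
        have s: "(1 - \<sigma>) * (1 + \<eta>) \<le> 1 - \<eta> - \<epsilon>" "1 + \<eta> + \<epsilon> \<le> (1 + \<sigma>) * (1 - \<eta>)" "1 - \<sigma> \<le> 1 - \<eta> - \<epsilon>" "1 + \<eta> + \<epsilon> \<le> 1 + \<sigma>"
        proof -
          define p where "p = \<sigma> * \<eta>"
          have "p \<ge> 0" using \<sigma> \<eta> by (simp add: p_def)
          moreover have "p \<le> 1 * \<eta>" unfolding p_def using \<sigma> \<eta> by (intro mult_right_mono) auto
          ultimately have "1 + \<eta> - \<sigma> - p \<le> 1 - \<eta> - \<epsilon>" "1 + \<eta> + \<epsilon> \<le> 1 - \<eta> + \<sigma> - p"
            using \<eta>(1,2) \<epsilon>(1,2) \<sigma>(1) by auto
          thus "(1 - \<sigma>) * (1 + \<eta>) \<le> 1 - \<eta> - \<epsilon>" "1 + \<eta> + \<epsilon> \<le> (1 + \<sigma>) * (1 - \<eta>)"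
            by (simp_all add: p_def algebra_simps)
          show "1 - \<sigma> \<le> 1 - \<eta> - \<epsilon>" "1 + \<eta> + \<epsilon> \<le> 1 + \<sigma>" using he \<sigma> by linarith+
        qed
        have q1: "real (qd m1 (l1 - 1)) \<le> (1 - \<eta> - \<epsilon>) * x" "(1 + \<eta> + \<epsilon>) * x \<le> real (qd m1 (l1 + 1))"
        proof -
          have "real (qd m1 (l1 - 1)) \<le> (1 - \<sigma>) * y" using qd_gap(2)[OF m'(1) _ \<sigma>(3)] l1 by (simp add: y_def)
          also have "\<dots> \<le> (1 - \<sigma>) * ((1 + \<eta>) * x)" using y \<sigma> by (intro mult_left_mono) auto
          also have "\<dots> = ((1 - \<sigma>) * (1 + \<eta>)) * x" by simp
          also have "\<dots> \<le> (1 - \<eta> - \<epsilon>) * x" using s(1) x0 by (intro mult_right_mono) auto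
          finally show "real (qd m1 (l1 - 1)) \<le> (1 - \<eta> - \<epsilon>) * x" .
          have "(1 + \<eta> + \<epsilon>) * x \<le> ((1 + \<sigma>) * (1 - \<eta>)) * x" using s(2) x0 by (intro mult_right_mono) auto
          also have "\<dots> = (1 + \<sigma>) * ((1 - \<eta>) * x)" by simp
          also have "\<dots> \<le> (1 + \<sigma>) * y" using y \<sigma> by (intro mult_left_mono) auto
          also have "\<dots> \<le> real (qd m1 (l1 + 1))" using qd_gap(1)[OF m'(1) _ \<sigma>(3)] l1 by (simp add: y_def)
          finally show "(1 + \<eta> + \<epsilon>) * x \<le> real (qd m1 (l1 + 1))" .
        qed
        have q2: "real (qd m2 (l2 - 1)) \<le> (1 - \<eta> - \<epsilon>) * x" "(1 + \<eta> + \<epsilon>) * x \<le> real (qd m2 (l2 + 1))"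
        proof -
          have "real (qd m2 (l2 - 1)) \<le> (1 - \<sigma>) * x" using qd_gap(2)[OF m'(2) _ \<sigma>(4)] l2 by (simp add: x_def)
          also have "\<dots> \<le> (1 - \<eta> - \<epsilon>) * x" using s(3) x0 by (intro mult_right_mono) auto
          finally show "real (qd m2 (l2 - 1)) \<le> (1 - \<eta> - \<epsilon>) * x" .
          have "(1 + \<eta> + \<epsilon>) * x \<le> (1 + \<sigma>) * x" using s(4) x0 by (intro mult_right_mono) auto
          also have "\<dots> \<le> real (qd m2 (l2 + 1))" using qd_gap(1)[OF m'(2) _ \<sigma>(4)] l2 by (simp add: x_def)
          finally show "(1 + \<eta> + \<epsilon>) * x \<le> real (qd m2 (l2 + 1))" .
        qed
        have xx: "(1 - \<eta>) * x \<le> real (qd m2 l2)" "real (qd m2 l2) \<le> (1 + \<eta>) * x"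
          using \<eta> x0 unfolding x_def[symmetric] by (auto simp: algebra_simps)
        show ?thesis unfolding x_def[symmetric]
          using goodI[of x x \<eta> "l1 - 1" "l2 - 1" l1 l2 "\<theta> * jp l1 + \<beta> * m2"] xL bigx \<eta> l1' l2' q1 q2 y xx V1' V2' False l1 l2
          by (auto simp: y_def jp_def)
      next
        case True
        have nj: "\<theta> * jp l1 \<notin> \<int>"
        proof
          assume "\<theta> * jp l1 \<in> \<int>"
          hence "(\<theta> * jp l1 + \<beta> * m2) - \<theta> * jp l1 \<in> \<int>" using True by (rule Ints_diff[rotated])
          thus False using nb by simp
        qed
        have near: "(p - e) * x \<le> w \<and> w \<le> (p + e) * x" if "\<bar>w - p * y\<bar> \<le> 1" "0 \<le> p" "p \<le> \<Lambda>" for w p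
        proof -
          have "\<bar>p * y - p * x\<bar> \<le> p * (\<eta> * x)"
            using mult_left_mono[OF l1(2), of p] that by (simp add: y_def abs_mult flip: right_diff_distrib)
          also have "\<dots> \<le> \<Lambda> * (\<eta> * x)" using that \<eta> x0 by (intro mult_right_mono) auto
          finally have "\<bar>w - p * x\<bar> \<le> \<Lambda> * (\<eta> * x) + \<eta> * x" using that etax by linarith
          thus ?thesis by (auto simp: e_def algebra_simps)
        qed
        have nearx: "(p - e) * x \<le> w \<and> w \<le> (p + e) * x" if "\<bar>w - p * x\<bar> \<le> 1" for w p
        proof -
          have "\<Lambda> * (\<eta> * x) \<ge> 0" using \<Lambda> \<eta> x0 by simp
          hence "\<bar>w - p * x\<bar> \<le> \<Lambda> * (\<eta> * x) + \<eta> * x" using that etax by linarith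
          thus ?thesis by (auto simp: e_def algebra_simps)
        qed
        have e1: "e \<le> 1" using e G1 by linarith
        have wb: "x \<le> w \<and> w \<le> (\<Lambda> + 2) * x" if "(p - e) * x \<le> w" "w \<le> (p + e) * x" "2 \<le> p" "p \<le> \<Lambda>" for w p
        proof -
          have "1 * x \<le> (p - e) * x" "(p + e) * x \<le> (\<Lambda> + 2) * x" using that e1 x0 by (intro mult_right_mono; simp)+
          thus ?thesis using that by linarith
        qed
        show ?thesis
        proof (cases "m1 < m2")
          case lt: True
          \<comment> \<open>About \<open>lam m1\<close> x, to be compared with x,
            (\<open>lam m2\<close> - 1) x and \<open>lam m2\<close> x, the approximate positions of
            the next denominators of the second system. Only the nonintegral jump of the first
            system occurs at w.\<close>
          define w where "w = real (qd m1 (l1 + 2))"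
          have w: "(lam m1 - e) * x \<le> w" "w \<le> (lam m1 + e) * x"
            using near[of w "lam m1"] qd_lam[OF m'(1), of l1] lam \<Lambda> by (auto simp: w_def y_def)
          have w': "x \<le> w" "w \<le> (\<Lambda> + 2) * x" using wb[OF w] lam \<Lambda> by auto
          have q1: "real (qd m1 (l1 + 1)) \<le> (1 - \<epsilon>) * w" "(1 + \<epsilon>) * w \<le> real (qd m1 (l1 + 2 + 1))"
            using gap1[of "l1 + 2"] by (auto simp: w_def)
          have z1: "(lam m2 - 1 - e) * x \<le> real (qd m2 (l2 + 1)) \<and> real (qd m2 (l2 + 1)) \<le> (lam m2 - 1 + e) * x"
            using nearx[of "real (qd m2 (l2 + 1))" "lam m2 - 1"] qd_lam_odd[OF m'(2) l2(1)] by (auto simp: x_def)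
          have z2: "(lam m2 - e) * x \<le> real (qd m2 (l2 + 2)) \<and> real (qd m2 (l2 + 2)) \<le> (lam m2 + e) * x"
            using nearx[of "real (qd m2 (l2 + 2))" "lam m2"] qd_lam[OF m'(2), of l2] by (auto simp: x_def)
          have sep: "lam m1 < lam m2" by (rule lam_separated[OF m' lt])
          have z0: "real (qd m2 l2) \<le> (1 + e) * x" using e x0 by (simp add: x_def algebra_simps)
          have "\<exists>l\<ge>1. real (qd m2 l) \<le> (1 - \<epsilon>) * w \<and> (1 + \<epsilon>) * w \<le> real (qd m2 (l + 1))"
          proof (cases "lam m1 < lam m2 - 1")
            case True
            have "real (qd m2 l2) \<le> (1 - \<epsilon>) * w"
              by (rule separated_below[where x = x and p = "lam m1" and r = 1 and e = e and G = G and \<Lambda> = \<Lambda>])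
                (use x0 w z0 lam G1 G0 G\<Lambda> \<Lambda> e \<epsilon> in auto)
            moreover have "(1 + \<epsilon>) * w \<le> real (qd m2 (l2 + 1))"
              by (rule separated_above[where x = x and p = "lam m1" and r = "lam m2 - 1" and e = e and G = G and \<Lambda> = \<Lambda>])
                (use x0 w z1 lam G1 G0 G\<Lambda> \<Lambda> e \<epsilon> True in auto)
            ultimately show ?thesis using l2 by (intro exI[of _ l2]) auto
          next
            case False
            have "real (qd m2 (l2 + 1)) \<le> (1 - \<epsilon>) * w"
              by (rule separated_below[where x = x and p = "lam m1" and r = "lam m2 - 1" and e = e and G = G and \<Lambda> = \<Lambda>])
                (use x0 w z1 lam G1 G0 G\<Lambda> \<Lambda> e \<epsilon> False in auto)
            moreover have "(1 + \<epsilon>) * w \<le> real (qd m2 (l2 + 2))"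
              by (rule separated_above[where x = x and p = "lam m1" and r = "lam m2" and e = e and G = G and \<Lambda> = \<Lambda>])
                (use x0 w z2 lam G1 G0 G\<Lambda> \<Lambda> e \<epsilon> sep in auto)
            ultimately show ?thesis using l2 by (intro exI[of _ "l2 + 1"]) auto
          qed
          then obtain l where l: "l \<ge> 1" "real (qd m2 l) \<le> (1 - \<epsilon>) * w" "(1 + \<epsilon>) * w \<le> real (qd m2 (l + 1))" by blast
          have "\<epsilon> * w \<ge> 0" using \<epsilon> w' x0 by simp
          hence l': "real (qd m2 l) \<le> w" "w \<le> real (qd m2 (l + 1))" using l by (auto simp: algebra_simps)
          have jp: "jp (l1 + 2) = jp l1" by (simp add: jp_def)
          have "of_int (jump_total m1 (l1 + 2)) = of_int (jump_total m1 (l1 + 1)) + jp l1" using V1[of "l1 + 1"] jp by simp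
          thus ?thesis unfolding x_def[symmetric]
            using isolated[of x w "l1 + 1" l "l1 + 2" l "\<theta> * jp l1"] w' bigx l l' q1 nj
            by (auto simp: w_def jp_def)
        next
          case False
          hence lt: "m2 < m1" using m(3) by simp
          \<comment> \<open>Roles exchanged: at w only the jump \<beta> m2 occurs. For even l1 the
            denominator after y is at most 2 y instead of about (\<open>lam m1\<close> - 1) x; it
            stays below w since \<open>lam m2\<close> > 3, which uses m2 \<ge> 2.\<close>
          define w where "w = real (qd m2 (l2 + 2))"
          have w: "(lam m2 - e) * x \<le> w" "w \<le> (lam m2 + e) * x"
            using nearx[of w "lam m2"] qd_lam[OF m'(2), of l2] by (auto simp: w_def x_def)
          have w': "x \<le> w" "w \<le> (\<Lambda> + 2) * x" using wb[OF w] lam \<Lambda> by auto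
          have q2: "real (qd m2 (l2 + 1)) \<le> (1 - \<epsilon>) * w" "(1 + \<epsilon>) * w \<le> real (qd m2 (l2 + 2 + 1))"
            using gap2[of "l2 + 2"] by (auto simp: w_def)
          have sep: "lam m2 < lam m1" by (rule lam_separated[OF m'(2,1) lt])
          have z2: "(lam m1 - e) * x \<le> real (qd m1 (l1 + 2)) \<and> real (qd m1 (l1 + 2)) \<le> (lam m1 + e) * x"
            using near[of "real (qd m1 (l1 + 2))" "lam m1"] qd_lam[OF m'(1), of l1] lam \<Lambda> by (auto simp: y_def)
          have up2: "(1 + \<epsilon>) * w \<le> real (qd m1 (l1 + 2))"
            by (rule separated_above[where x = x and p = "lam m2" and r = "lam m1" and e = e and G = G and \<Lambda> = \<Lambda>])
              (use x0 w z2 lam G1 G0 G\<Lambda> \<Lambda> e \<epsilon> sep in auto)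
          have z0: "(1 - e) * x \<le> y \<and> y \<le> (1 + e) * x" using near[of y 1] \<Lambda> by simp
          have "\<exists>l\<ge>1. real (qd m1 l) \<le> (1 - \<epsilon>) * w \<and> (1 + \<epsilon>) * w \<le> real (qd m1 (l + 1))"
          proof (cases "odd l1")
            case odd: True
            have z1: "(lam m1 - 1 - e) * x \<le> real (qd m1 (l1 + 1)) \<and> real (qd m1 (l1 + 1)) \<le> (lam m1 - 1 + e) * x"
              using near[of "real (qd m1 (l1 + 1))" "lam m1 - 1"] qd_lam_odd[OF m'(1) odd] lam \<Lambda> by (auto simp: y_def)
            show ?thesis
            proof (cases "lam m2 < lam m1 - 1")
              case True
              have "y \<le> (1 - \<epsilon>) * w"
                by (rule separated_below[where x = x and p = "lam m2" and r = 1 and e = e and G = G and \<Lambda> = \<Lambda>])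
                  (use x0 w z0 lam G1 G0 G\<Lambda> \<Lambda> e \<epsilon> in auto)
              moreover have "(1 + \<epsilon>) * w \<le> real (qd m1 (l1 + 1))"
                by (rule separated_above[where x = x and p = "lam m2" and r = "lam m1 - 1" and e = e and G = G and \<Lambda> = \<Lambda>])
                  (use x0 w z1 lam G1 G0 G\<Lambda> \<Lambda> e \<epsilon> True in auto)
              ultimately show ?thesis using l1 by (intro exI[of _ l1]) (auto simp: y_def)
            next
              case False
              have "real (qd m1 (l1 + 1)) \<le> (1 - \<epsilon>) * w"
                by (rule separated_below[where x = x and p = "lam m2" and r = "lam m1 - 1" and e = e and G = G and \<Lambda> = \<Lambda>])
                  (use x0 w z1 lam G1 G0 G\<Lambda> \<Lambda> e \<epsilon> False in auto)
              thus ?thesis using l1 up2 by (intro exI[of _ "l1 + 1"]) auto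
            qed
          next
            case even: False
            have "qd m1 (l1 + 1) \<le> 2 * qd m1 l1" using qd_even_Suc[OF m'(1)] even l1 by simp
            hence "real (qd m1 (l1 + 1)) \<le> 2 * y" unfolding y_def by linarith
            also have "2 * y \<le> (1 - \<epsilon>) * w"
            proof (rule separated_below[where x = x and p = "lam m2" and r = "2 + 2 * \<eta>" and e = e and G = G and \<Lambda> = \<Lambda>])
              have "2 * y \<le> 2 * ((1 + \<eta>) * x)" using y by simp
              also have "\<dots> \<le> (2 + 2 * \<eta> + e) * x" using e x0 by (simp add: algebra_simps)
              finally show "2 * y \<le> (2 + 2 * \<eta> + e) * x" .
              have "lam m2 > 3" using lam m by linarith
              thus "2 + 2 * \<eta> + G \<le> lam m2" using G1 \<eta> \<sigma> by linarith
            qed (use x0 w lam G1 G0 G\<Lambda> \<Lambda> e \<epsilon> in auto)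
            finally show ?thesis using l1 up2 by (intro exI[of _ "l1 + 1"]) auto
          qed
          then obtain l where l: "l \<ge> 1" "real (qd m1 l) \<le> (1 - \<epsilon>) * w" "(1 + \<epsilon>) * w \<le> real (qd m1 (l + 1))" by blast
          have "\<epsilon> * w \<ge> 0" using \<epsilon> w' x0 by simp
          hence l': "real (qd m1 l) \<le> w" "w \<le> real (qd m1 (l + 1))" using l by (auto simp: algebra_simps)
          have "of_int (jump_total m2 (l2 + 2)) = of_int (jump_total m2 (l2 + 1)) + real m2" using V2[of "l2 + 1"] l2 by simp
          thus ?thesis unfolding x_def[symmetric]
            using isolated[of x w l "l2 + 1" l "l2 + 2" "\<beta> * m2"] w' bigx l l' q2 nb
            by (auto simp: w_def)
        qed
      qed
    qed
  qed
  \<comment> \<open>Large enough for a denominator q of odd index \<ge> 3 with q \<le> X \<le> (m2 +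
    3) q and \<epsilon> q \<ge> 2.\<close>
  define X0 where "X0 = nat \<lceil>(real m2 + 3) * (2 / \<epsilon>)\<rceil> + m2 + 10"
  show ?thesis
  proof (rule that[of "\<epsilon> / 2 / (real m2 + 3)" "3 * (\<Lambda> + 2)" \<kappa> X0])
    show "\<epsilon> / 2 / (real m2 + 3) > 0" "3 * (\<Lambda> + 2) > 0" using \<epsilon> \<Lambda> by auto
    show "\<kappa> > 0" by (rule \<kappa>(1))
  next
    fix X assume X: "X \<ge> X0"
    obtain l where l: "l \<ge> 1" "real (qd m2 l) \<le> real X" "real X < real (qd m2 (l + 1))"
      using qd_bracket[OF m'(2), of "real X"] X by (auto simp: X0_def)
    have "\<exists>l2. odd l2 \<and> l2 \<ge> 2 \<and> real (qd m2 l2) \<le> real X \<and> real X \<le> (real m2 + 3) * real (qd m2 l2)"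
    proof -
      have q3: "qd m2 3 = m2 + 2"
        using qd_simps(3)[of m2 1] qd_simps(3)[of m2 0] by (simp add: qd_simps numeral_eq_Suc)
      have l3: "l \<ge> 3"
      proof (rule ccontr)
        assume "\<not> ?thesis"
        hence "qd m2 (l + 1) \<le> qd m2 3" by (intro qd_mono[OF m'(2)]) simp
        thus False using q3 l X by (simp add: X0_def)
      qed
      define l2 where "l2 = (if odd l then l else l - 1)"
      have l2: "odd l2" "l2 \<ge> 2" "l2 \<le> l" "l + 1 \<le> l2 + 2" using l3 by (auto simp: l2_def)
      have "qd m2 l2 \<le> qd m2 l" "qd m2 (l + 1) \<le> qd m2 (l2 + 2)" using l2 by (auto intro!: qd_mono[OF m'(2)])
      hence b: "real (qd m2 l2) \<le> real X" "real X \<le> real (qd m2 (l2 + 2))" using l by linarith+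
      have "real (qd m2 (l2 + 2)) \<le> lam m2 * real (qd m2 l2) + 1" using qd_lam[OF m'(2), of l2] by linarith
      also have "\<dots> \<le> (real m2 + 2) * real (qd m2 l2) + real (qd m2 l2)"
        using qd_pos[OF m'(2), of l2] alpha_lt1[OF m'(2)] by (intro add_mono mult_right_mono) (auto simp: lam_def)
      finally have "real X \<le> (real m2 + 3) * real (qd m2 l2)" using b by (simp add: algebra_simps)
      thus ?thesis using l2 b by blast
    qed
    then obtain l2 where l2: "odd l2" "l2 \<ge> 2" "real (qd m2 l2) \<le> real X" "real X \<le> (real m2 + 3) * real (qd m2 l2)"
      by blast
    have "(real m2 + 3) * (2 / \<epsilon>) \<le> real X" using X unfolding X0_def by linarith
    hence "(real m2 + 3) * (2 / \<epsilon>) \<le> (real m2 + 3) * real (qd m2 l2)" using l2 by linarith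
    hence "2 / \<epsilon> \<le> real (qd m2 l2)" by (rule mult_left_le_imp_le) simp
    hence "\<epsilon> * real (qd m2 l2) \<ge> 2" using \<epsilon> by (simp add: field_simps)
    from main[OF l2(1,2) this] obtain A B L u u' where *:
       "\<epsilon> / 2 * real (qd m2 l2) \<le> real L" "1 \<le> A" "A + L \<le> B" "real (B + L) \<le> 3 * (\<Lambda> + 2) * real (qd m2 l2)"
       "\<kappa> \<le> cmod (unit_exp u - unit_exp u')"
       "\<forall>n. A \<le> n \<and> n < A + L \<longrightarrow> \<theta> * of_int (jump_sum m1 n) + \<beta> * of_int (jump_sum m2 n) = u"
       "\<forall>n. B \<le> n \<and> n < B + L \<longrightarrow> \<theta> * of_int (jump_sum m1 n) + \<beta> * of_int (jump_sum m2 n) = u'"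
      unfolding good_def by (elim exE conjE) (rule that)
    have "\<epsilon> / 2 / (real m2 + 3) * real X \<le> \<epsilon> / 2 / (real m2 + 3) * ((real m2 + 3) * real (qd m2 l2))"
      using l2 \<epsilon> by (intro mult_left_mono) auto
    also have "\<dots> = \<epsilon> / 2 * real (qd m2 l2)"
      using nonzero_divide_mult_cancel_left[of "real m2 + 3"] by (simp add: divide_simps)
    finally have "\<epsilon> / 2 / (real m2 + 3) * real X \<le> real L" using *(1) by linarith
    moreover have "3 * (\<Lambda> + 2) * real (qd m2 l2) \<le> 3 * (\<Lambda> + 2) * real X" using l2 \<Lambda> by (intro mult_left_mono) auto
    hence "real (B + L) \<le> 3 * (\<Lambda> + 2) * real X" using *(4) by linarith
    ultimately show "\<exists>A B L u u'. \<epsilon> / 2 / (real m2 + 3) * real X \<le> real L \<and> 1 \<le> A \<and> A + L \<le> B \<and>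
       real (B + L) \<le> 3 * (\<Lambda> + 2) * real X \<and> \<kappa> \<le> cmod (unit_exp u - unit_exp u') \<and>
       (\<forall>n. A \<le> n \<and> n < A + L \<longrightarrow> \<theta> * of_int (jump_sum m1 n) + \<beta> * of_int (jump_sum m2 n) = u) \<and>
       (\<forall>n. B \<le> n \<and> n < B + L \<longrightarrow> \<theta> * of_int (jump_sum m1 n) + \<beta> * of_int (jump_sum m2 n) = u')"
      using *(2,3,5,6,7) by blast
  qed
qed

section \<open>The resonant case\<close>

abbreviation joint_exp :: "nat \<Rightarrow> nat \<Rightarrow> real \<Rightarrow> real \<Rightarrow> nat \<Rightarrow> complex" where
  "joint_exp m1 m2 \<theta> \<beta> n \<equiv> unit_exp (\<theta> * real (digit_sum m1 n) + \<beta> * real (digit_sum m2 n))"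

text \<open>Squaring the relation and comparing irrational parts leaves h (2 \<open>alpha m1\<close>
  + m1) = r (2 \<open>alpha m2\<close> + m2), where both brackets are positive. A positive r gives
  small phases the same sign in both systems.\<close>

lemma resonance_sign:
  assumes m: "m1 \<ge> 1" "m2 \<ge> 1" and h: "h > (0::int)" and r: "r \<noteq> (0::int)"
    and res: "of_int h * alpha m1 = of_int p + of_int r * alpha m2"
  shows "r > 0"
proof -
  define a where "a = alpha m2"
  have a: "a ^ 2 = real m2 * (1 - a)" unfolding a_def by (rule alpha_sq[OF m(2)])
  have "(of_int h * alpha m1) ^ 2 = of_int h * real m1 * (of_int h - of_int h * alpha m1)"
    unfolding power_mult_distrib alpha_sq[OF m(1)] by (simp add: power2_eq_square algebra_simps)
  hence "(of_int p + of_int r * a) ^ 2 = of_int h * real m1 * (of_int h - of_int p - of_int r * a)"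
    unfolding res a_def by (simp add: algebra_simps)
  hence "of_int p ^ 2 + 2 * of_int p * of_int r * a + of_int r ^ 2 * a ^ 2
      = of_int h * real m1 * (of_int h - of_int p - of_int r * a)"
    by (simp add: power2_eq_square algebra_simps)
  hence eq: "of_int (r * (2 * p - r * int m2 + h * int m1)) * a
      = of_int (h * int m1 * (h - p) - p ^ 2 - r ^ 2 * int m2)"
    unfolding a by (simp add: power2_eq_square algebra_simps)
  have "2 * p - r * int m2 + h * int m1 = 0"
  proof (rule ccontr)
    assume "\<not> ?thesis"
    hence "r * (2 * p - r * int m2 + h * int m1) \<noteq> 0" using r by simp
    hence "(of_int (r * (2 * p - r * int m2 + h * int m1)) :: real) \<noteq> 0" by (simp only: of_int_eq_0_iff not_False_eq_True)
    hence "a = of_int (h * int m1 * (h - p) - p ^ 2 - r ^ 2 * int m2) / of_int (r * (2 * p - r * int m2 + h * int m1))"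
      using eq by (metis nonzero_mult_div_cancel_left)
    hence "a \<in> \<rat>" by (metis Rats_divide Rats_of_int)
    thus False using alpha_irrational[OF m(2)] by (simp add: a_def)
  qed
  hence "of_int (2 * p) = (of_int (r * int m2 - h * int m1) :: real)" by (intro arg_cong[where f = of_int]) linarith
  hence "of_int h * (2 * alpha m1 + real m1) = of_int r * (2 * alpha m2 + real m2)"
    using res by (simp add: algebra_simps)
  moreover have "of_int h * (2 * alpha m1 + real m1) > 0" using h alpha_pos[OF m(1)] by simp
  ultimately have "of_int r * (2 * alpha m2 + real m2) > 0" by simp
  moreover have "2 * alpha m2 + real m2 > 0" using alpha_pos[OF m(2)] by simp
  ultimately have "(of_int r :: real) > 0" by (simp add: zero_less_mult_iff)
  thus ?thesis by simp
qed

text \<open>If z has phase w in the second system, then h z has phase h w there and r w in the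
  first. Comparing h z1 just left of 0 with a later h z2 just right of 0 exposes both step functions
  at once; two windows where their combination takes different values become the twin
  blocks.\<close>

lemma twin_blocks_resonant:
  fixes \<theta> \<beta> :: real
  assumes m: "m1 \<ge> 2" "m2 \<ge> 2" "m1 \<noteq> m2" and \<beta>: "real m2 * \<beta> \<notin> \<int>"
    and h: "h \<ge> (1::nat)" and r: "r \<ge> (1::nat)" and res: "real h * alpha m1 = of_int p + real r * alpha m2"
  obtains c \<kappa> C X0 where "c > 0" "\<kappa> > 0" "C \<ge> 1"
    "twin_blocks c C \<kappa> X0 (\<lambda>n. joint_exp m1 m2 \<theta> \<beta> n)"
proof -
  have m': "m1 \<ge> 1" "m2 \<ge> 1" using m by auto
  obtain c C1 \<kappa> X1 where c: "c > 0" "C1 > 0" "\<kappa> > 0" and NC: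
    "\<And>X. X \<ge> X1 \<Longrightarrow> \<exists>A B L u u'. c * real X \<le> real L \<and> 1 \<le> A \<and> A + L \<le> B \<and> real (B + L) \<le> C1 * real X \<and>
       \<kappa> \<le> cmod (unit_exp u - unit_exp u') \<and>
       (\<forall>n. A \<le> n \<and> n < A + L \<longrightarrow> \<theta> * of_int (jump_sum m1 n) + \<beta> * of_int (jump_sum m2 n) = u) \<and>
       (\<forall>n. B \<le> n \<and> n < B + L \<longrightarrow> \<theta> * of_int (jump_sum m1 n) + \<beta> * of_int (jump_sum m2 n) = u')"
    by (rule jump_sum_combination_nonconstant[OF m \<beta>, of \<theta>]) blast
  define C2 where "C2 = nat \<lceil>C1\<rceil> + 1"
  have C2: "C1 \<le> real C2" "C2 \<ge> 1" unfolding C2_def by linarith+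
  define e where "e = min (eps0 m2 / real h) (eps0 m1 / real r)"
  have e: "e > 0" using eps0_pos[OF m'(1)] eps0_pos[OF m'(2)] h r by (simp add: e_def)
  have eh: "real h * e \<le> eps0 m2" "real r * e \<le> eps0 m1"
  proof -
    have "e \<le> eps0 m2 / real h" "e \<le> eps0 m1 / real r" unfolding e_def by (rule min.cobounded1, rule min.cobounded2)
    thus "real h * e \<le> eps0 m2" "real r * e \<le> eps0 m1" using h r by (auto simp: field_simps)
  qed
  obtain C3 where C3: "C3 > 0"
    "\<And>Y a. Y \<ge> 1 \<Longrightarrow> \<exists>z\<ge>a. \<exists>w. real z \<le> real a + C3 * Y \<and> phase m2 (real z) w \<and> 0 < w \<and> w < e / Y"
    "\<And>Y a. Y \<ge> 1 \<Longrightarrow> \<exists>z\<ge>a. \<exists>w. real z \<le> real a + C3 * Y \<and> phase m2 (real z) w \<and> w < 0 \<and> - w < e / Y"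
    by (rule small_phase_syndetic[OF m'(2) e]) blast
  \<comment> \<open>Two searches in a row, each costing at most N + 1 + h + h C3 N, where N = C2
    X.\<close>
  define C4 where "C4 = nat \<lceil>2 * (real C2 + 1 + real h + real h * (C3 * real C2))\<rceil>"
  have C4: "2 * (real C2 + 1 + real h + real h * (C3 * real C2)) \<le> real C4" unfolding C4_def by linarith
  have "real C4 \<ge> 1"
  proof -
    have "real h * (C3 * real C2) \<ge> 0" using C3(1) by simp
    moreover have "real h \<ge> 1" using h by simp
    moreover have "2 * (c2 + 1 + y + x) \<le> d \<Longrightarrow> 0 \<le> x \<Longrightarrow> 1 \<le> y \<Longrightarrow> 0 \<le> c2 \<Longrightarrow> 1 \<le> d" for c2 x y d :: real by simp
    ultimately show ?thesis using C4 of_nat_0_le_iff by blast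
  qed
  hence C41: "C4 \<ge> 1" by simp
  have phase1: "phase m1 (real (h * z)) (real r * w)" if "phase m2 (real z) w" for z w
  proof -
    from that obtain q where q: "real z * alpha m2 - w = of_int q" unfolding phase_def by (auto elim: Ints_cases)
    have "real (h * z) * alpha m1 - real r * w = real z * (real h * alpha m1) - real r * w" by simp
    also have "\<dots> = of_int (int z * p + int r * q)" unfolding res using q by (simp add: algebra_simps flip: q)
    finally show ?thesis unfolding phase_def by simp
  qed
  have phase2: "phase m2 (real (h * z)) (real h * w)" if "phase m2 (real z) w" for z w
    using phase_mult_nat[OF that, of h] by simp
  have tw: "twin_blocks c C4 \<kappa> (max X1 1) (\<lambda>n. joint_exp m1 m2 \<theta> \<beta> n)"
    unfolding twin_blocks_def
  proof (intro allI impI)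
    fix X a assume X: "X \<ge> max X1 1"
    define N where "N = C2 * X"
    have N1: "N \<ge> 1" using X C2 by (simp add: N_def)
    obtain A B L u u' where AB: "c * real X \<le> real L" "1 \<le> A" "A + L \<le> B" "real (B + L) \<le> C1 * real X"
       "\<kappa> \<le> cmod (unit_exp u - unit_exp u')"
       "\<forall>n. A \<le> n \<and> n < A + L \<longrightarrow> \<theta> * of_int (jump_sum m1 n) + \<beta> * of_int (jump_sum m2 n) = u"
       "\<forall>n. B \<le> n \<and> n < B + L \<longrightarrow> \<theta> * of_int (jump_sum m1 n) + \<beta> * of_int (jump_sum m2 n) = u'"
    proof -
      have "X \<ge> X1" using X by simp
      from NC[OF this] show ?thesis by (elim exE conjE) (rule that)
    qed
    have "C1 * real X \<le> real C2 * real X" using C2 by (intro mult_right_mono) auto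
    hence "real (B + L) \<le> real N" using AB(4) by (simp add: N_def)
    hence BL: "B + L \<le> N" by linarith
    have ex: "\<exists>z w. b + N < h * z \<and> real (h * z) \<le> real b + real N + 1 + real h + real h * (C3 * real N) \<and>
        phase m2 (real z) w \<and> 0 < s * w \<and> s * w < e / real N" if s: "s = 1 \<or> s = -1" for b and s :: real
    proof -
      define a' where "a' = (b + N) div h + 1"
      have "\<exists>z\<ge>a'. \<exists>w. real z \<le> real a' + C3 * real N \<and> phase m2 (real z) w \<and> 0 < s * w \<and> s * w < e / real N"
      proof -
        have N1': "real N \<ge> 1" using N1 by simp
        show ?thesis using s
        proof
          assume "s = 1" thus ?thesis using C3(2)[OF N1', of a'] by simp
        next
          assume "s = -1" thus ?thesis using C3(3)[OF N1', of a'] by simp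
        qed
      qed
      then obtain z w where z: "z \<ge> a'" "real z \<le> real a' + C3 * real N" "phase m2 (real z) w" "0 < s * w" "s * w < e / real N"
        by blast
      have "b + N < h * a'" 
        using dividend_less_times_div[of h "b + N"] h by (simp add: a'_def)
      also have "\<dots> \<le> h * z" using z(1) by simp
      finally have z1: "b + N < h * z" .
      have "h * a' \<le> b + N + h" unfolding a'_def by (simp add: algebra_simps)
      hence "real (h * a') \<le> real (b + N + h)" unfolding of_nat_le_iff .
      moreover have "real h * real z \<le> real h * (real a' + C3 * real N)" using z(2) by (intro mult_left_mono) auto
      ultimately have "real (h * z) \<le> real b + real N + 1 + real h + real h * (C3 * real N)"
        by (simp add: algebra_simps)
      thus ?thesis using z z1 by blast
    qed
    obtain z1 w1 where z1: "a + N < h * z1" "real (h * z1) \<le> real a + real N + 1 + real h + real h * (C3 * real N)"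
        "phase m2 (real z1) w1" "0 < - w1" "- w1 < e / real N"
      using ex[of "-1" a] by auto
    obtain z2 w2 where z2: "h * z1 + N < h * z2" "real (h * z2) \<le> real (h * z1) + real N + 1 + real h + real h * (C3 * real N)"
        "phase m2 (real z2) w2" "0 < w2" "w2 < e / real N"
      using ex[of 1 "h * z1"] by auto
    define z where "z = h * z1"
    define z' where "z' = h * z2"
    have zb: "a + N < z" "z + N < z'" using z1 z2 by (auto simp: z_def z'_def)
    have "real z' \<le> real a + 2 * (real N + 1 + real h + real h * (C3 * real N))"
      using z1(2) z2(2) unfolding z_def z'_def distrib_left by linarith
    also have "\<dots> \<le> real a + 2 * (real C2 + 1 + real h + real h * (C3 * real C2)) * real X"
    proof -
      have "1 + real h \<le> (1 + real h) * real X" using X by (simp add: mult_ge1_I)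
      thus ?thesis unfolding N_def by (simp add: algebra_simps)
    qed
    also have "\<dots> \<le> real a + real C4 * real X" using C4 by (intro add_left_mono mult_right_mono) auto
    finally have z'le: "z' \<le> a + C4 * X" by (simp flip: of_nat_mult of_nat_add)
    have scale: "t * w < E / real N" if "w < e / real N" "t * e \<le> E" "t \<ge> 1" for t w E
    proof -
      have "t * w < t * (e / real N)" using that by (intro mult_strict_left_mono) auto
      also have "\<dots> = t * e / real N" by simp
      also have "\<dots> \<le> E / real N" using that N1 by (intro divide_right_mono) auto
      finally show ?thesis .
    qed
    have diff: "int (digit_sum M (z' - i)) - int (digit_sum M (z - i)) = int (digit_sum M (z' - 1)) - int (digit_sum M (z - 1)) - jump_sum M i"
      if "1 \<le> i" "i \<le> N" "M = m1 \<or> M = m2" for i M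
    proof -
      define t where "t = (if M = m1 then real r else real h)"
      have M: "M \<ge> 1" using that m' by auto
      have t: "t \<ge> 1" "t * e \<le> eps0 M" using h r eh that(3) m(3) by (auto simp: t_def)
      have ph: "phase M (real z) (t * w1)" "phase M (real z') (t * w2)"
        using phase1[OF z1(3)] phase1[OF z2(3)] phase2[OF z1(3)] phase2[OF z2(3)] that(3) m(3)
        by (auto simp: t_def z_def z'_def)
      show ?thesis
      proof (rule digit_sum_diff_near_zero[OF M _ _ _ ph(1) _ _ ph(2), where Y = "real N"])
        show "t * w1 < 0" using t z1 by (simp add: mult_pos_neg)
        show "- (t * w1) < eps0 M / real N" using scale[OF z1(5) t(2,1)] by simp
        show "0 < t * w2" using t z2 by simp
        show "t * w2 < eps0 M / real N" using scale[OF z2(5) t(2,1)] by simp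
      qed (use that zb in auto)
    qed
    define k where "k = \<theta> * (real (digit_sum m1 (z' - 1)) - real (digit_sum m1 (z - 1))) + \<beta> * (real (digit_sum m2 (z' - 1)) - real (digit_sum m2 (z - 1)))"
    define f where "f n = joint_exp m1 m2 \<theta> \<beta> n" for n
    have f: "f (z' - i) = unit_exp (k - (\<theta> * of_int (jump_sum m1 i) + \<beta> * of_int (jump_sum m2 i))) * f (z - i)" if "1 \<le> i" "i \<le> N" for i
    proof -
      have "real (digit_sum M (z' - i)) = real (digit_sum M (z - i)) + (real (digit_sum M (z' - 1)) - real (digit_sum M (z - 1))) - of_int (jump_sum M i)"
        if "M = m1 \<or> M = m2" for M
        using arg_cong[OF diff[OF \<open>1 \<le> i\<close> \<open>i \<le> N\<close> that], of real_of_int] by simp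
      note eq = this[of m1, simplified] this[of m2, simplified]
      have "\<theta> * real (digit_sum m1 (z' - i)) + \<beta> * real (digit_sum m2 (z' - i))
          = (k - (\<theta> * of_int (jump_sum m1 i) + \<beta> * of_int (jump_sum m2 i))) + (\<theta> * real (digit_sum m1 (z - i)) + \<beta> * real (digit_sum m2 (z - i)))"
        unfolding k_def eq by (simp add: algebra_simps)
      thus ?thesis unfolding f_def by (simp only: unit_exp_add)
    qed
    \<comment> \<open>The argument z - i runs backwards, so the window of larger i, the one at B,
      becomes the first block; it starts at i = B + L - 1, whence the + 1.\<close>
    define q where "q = z + 1 - (B + L)"
    define q' where "q' = z + 1 - (A + L)"
    define s where "s = z' - z"
    have shift: "f (n + s) = unit_exp (k - x) * f n"
      if "z + 1 - (I + L) \<le> n" "n < z + 1 - (I + L) + L" "I + L \<le> N" "1 \<le> I"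
        "\<forall>n. I \<le> n \<and> n < I + L \<longrightarrow> \<theta> * of_int (jump_sum m1 n) + \<beta> * of_int (jump_sum m2 n) = x" for I n x
    proof -
      define i where "i = z - n"
      have i: "I \<le> i" "i < I + L" "n = z - i" "n + s = z' - i" "1 \<le> i" "i \<le> N"
        using that zb unfolding i_def s_def by linarith+
      show ?thesis using f[OF i(5,6)] that(5) i by simp
    qed
    have AL: "A + L \<le> N" "1 \<le> B" using AB BL by linarith+
    have "cmod (unit_exp (k - u') - unit_exp (k - u)) = cmod (unit_exp u - unit_exp u')"
    proof -
      have "unit_exp (k - u') = unit_exp (k - u - u') * unit_exp u" "unit_exp (k - u) = unit_exp (k - u - u') * unit_exp u'"
        by (simp_all flip: unit_exp_add)
      hence "unit_exp (k - u') - unit_exp (k - u) = unit_exp (k - u - u') * (unit_exp u - unit_exp u')"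
        by (simp only: right_diff_distrib)
      thus ?thesis by (simp only: norm_mult norm_unit_exp mult_1)
    qed
    hence "\<kappa> \<le> cmod (unit_exp (k - u') - unit_exp (k - u))" using AB(5) by simp
    moreover have "a \<le> q" "q + L \<le> q'" "q' + L \<le> q + s" "q' + s + L \<le> a + C4 * X"
      using zb BL AB(2,3) AL z'le unfolding q_def q'_def s_def by linarith+
    moreover have "\<forall>n. q \<le> n \<and> n < q + L \<longrightarrow> f (n + s) = unit_exp (k - u') * f n"
      using shift[of B _ u'] AB(7) AL BL unfolding q_def by blast
    moreover have "\<forall>n. q' \<le> n \<and> n < q' + L \<longrightarrow> f (n + s) = unit_exp (k - u) * f n"
      using shift[of A _ u] AB(2,6) AL unfolding q'_def by blast
    ultimately show "\<exists>L p p' s v v'. c * real X \<le> real L \<and> a \<le> p \<and> p + L \<le> p' \<and> p' + L \<le> p + s \<and> p' + s + L \<le> a + C4 * X \<and>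
     cmod v = 1 \<and> cmod v' = 1 \<and> \<kappa> \<le> cmod (v - v') \<and>
     (\<forall>n. p \<le> n \<and> n < p + L \<longrightarrow> joint_exp m1 m2 \<theta> \<beta> (n + s) = v * joint_exp m1 m2 \<theta> \<beta> n) \<and>
     (\<forall>n. p' \<le> n \<and> n < p' + L \<longrightarrow> joint_exp m1 m2 \<theta> \<beta> (n + s) = v' * joint_exp m1 m2 \<theta> \<beta> n)"
      unfolding f_def using AB(1)
      by (intro exI[of _ L] exI[of _ q] exI[of _ q'] exI[of _ s] exI[of _ "unit_exp (k - u')"] exI[of _ "unit_exp (k - u)"])
        (simp only: norm_unit_exp simp_thms)
  qed
  show ?thesis by (rule that[OF c(1,3) C41 tw])
qed

theorem resonant_power_saving:
  fixes \<theta> \<beta> :: real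
  assumes m: "m1 \<ge> 2" "m2 \<ge> 2" "m1 \<noteq> m2" and \<beta>: "real m2 * \<beta> \<notin> \<int>"
    and h: "h > (0::int)" and r: "r \<noteq> 0" and res: "of_int h * alpha m1 = of_int p + of_int r * alpha m2"
  obtains K \<delta> :: real where "K > 0" "0 < \<delta>" "\<delta> < 1"
    "\<And>a n t. n \<ge> 1 \<Longrightarrow> cmod (\<Sum>i=a..<a + n. joint_exp m1 m2 \<theta> \<beta> i * unit_exp (real i * t))
       \<le> K * real n powr (1 - \<delta>)"
proof -
  have "r > 0" using resonance_sign[OF _ _ h r res] m by simp
  hence h': "nat h \<ge> 1" "nat r \<ge> 1" "real (nat h) * alpha m1 = of_int p + real (nat r) * alpha m2"
    using h res by auto
  obtain c \<kappa> C X0 where "c > 0" "\<kappa> > 0" "C \<ge> 1"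
    "twin_blocks c C \<kappa> X0 (\<lambda>n. joint_exp m1 m2 \<theta> \<beta> n)"
    by (rule twin_blocks_resonant[OF m \<beta> h', of \<theta>]) blast
  note tw = this
  show ?thesis by (rule twin_blocks_power_saving[OF tw(1-3) _ tw(4)]) (simp, rule that)
qed

text \<open>Since \<open>alpha (m\<^sup>2 + 4 m)\<close> is a rational combination of 1 and \<open>alpha m\<close>, a single system is a resonant pair.\<close>

lemma alpha_square: "alpha (m ^ 2 + 4 * m) = (real m + 2) * alpha m - real m"
proof -
  have "real (m ^ 2 + 4 * m) ^ 2 + 4 * real (m ^ 2 + 4 * m) = (real m + 2) ^ 2 * (real m ^ 2 + 4 * real m)"
    by (simp add: power2_eq_square algebra_simps)
  hence "sqrt (real (m ^ 2 + 4 * m) ^ 2 + 4 * real (m ^ 2 + 4 * m)) = (real m + 2) * sqrt (real m ^ 2 + 4 * real m)"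
    by (simp add: real_sqrt_mult)
  thus ?thesis unfolding alpha_def by (simp add: power2_eq_square field_simps)
qed

text \<open>The resonant pair is used with weight 0 on the auxiliary system
  \<open>m ^ 2 + 4 * m\<close>.\<close>

corollary single_power_saving:
  fixes \<beta> :: real
  assumes m: "m \<ge> 2" and \<beta>: "real m * \<beta> \<notin> \<int>"
  obtains K \<delta> :: real where "K > 0" "0 < \<delta>" "\<delta> < 1"
    "\<And>a n t. n \<ge> 1 \<Longrightarrow> cmod (\<Sum>i=a..<a + n. unit_exp (\<beta> * real (digit_sum m i)) * unit_exp (real i * t))
       \<le> K * real n powr (1 - \<delta>)"
proof -
  have "m ^ 2 + 4 * m \<ge> 2" "m ^ 2 + 4 * m \<noteq> m" using m by auto
  moreover have "of_int 1 * alpha (m ^ 2 + 4 * m) = of_int (- int m) + of_int (int m + 2) * alpha m"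
    using alpha_square[of m] by simp
  ultimately obtain K \<delta> :: real where "K > 0" "0 < \<delta>" "\<delta> < 1"
    "\<And>a n t. n \<ge> 1 \<Longrightarrow> cmod (\<Sum>i=a..<a + n. unit_exp (0 * real (digit_sum (m ^ 2 + 4 * m) i) + \<beta> * real (digit_sum m i)) * unit_exp (real i * t))
       \<le> K * real n powr (1 - \<delta>)"
    using m \<beta> by (elim resonant_power_saving[of "m ^ 2 + 4 * m" m \<beta> 1 "int m + 2" "- int m" 0, rotated -1]) auto
  thus ?thesis using that[of K \<delta>] by simp
qed

section \<open>Exponential sums and linear forms\<close>

lemma unit_exp_power: "unit_exp x ^ n = unit_exp (real n * x)"
  by (simp add: unit_exp_cis Complex.DeMoivre mult_ac)

lemma cnj_unit_exp: "cnj (unit_exp x) = unit_exp (- x)"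
  by (simp add: unit_exp_cis cis_cnj)

text \<open>The modulus is 2 |sin (pi y)| for the centred residue y, and the cubic Taylor remainder
  gives |sin t| \<ge> |t| / 3 for |t| \<le> 2.\<close>

lemma norm_one_minus_unit_exp_ge:
  assumes "\<And>p::int. \<bar>x - of_int p\<bar> \<ge> d"
  shows "cmod (1 - unit_exp x) \<ge> d"
proof -
  define y where "y = x - of_int (round x)"
  have y: "\<bar>y\<bar> \<le> 1 / 2" "\<bar>y\<bar> \<ge> d"
    using of_int_round_abs_le[of x] assms[of "round x"] unfolding y_def by (auto simp: abs_minus_commute)
  have ux: "unit_exp x = unit_exp y"
  proof -
    have "unit_exp x = unit_exp (y + of_int (round x))" by (simp add: y_def)
    also have "\<dots> = unit_exp y" by (simp only: unit_exp_add unit_exp_Ints[OF Ints_of_int] mult_1_right)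
    finally show ?thesis .
  qed
  have s: "\<bar>sin (pi * y)\<bar> \<ge> \<bar>pi * y\<bar> / 3"
  proof -
    define t where "t = pi * y"
    have "\<bar>t\<bar> \<le> pi * (1 / 2)" unfolding t_def abs_mult using y by (simp add: mult_left_mono)
    hence t: "\<bar>t\<bar> \<le> 2" using pi_half_less_two by linarith
    have "\<bar>sin t - t\<bar> \<le> \<bar>t\<bar> ^ 3 / 6"
      using Maclaurin_sin_bound[of t 3] by (simp add: numeral_3_eq_3 sin_coeff_def fact_numeral)
    moreover have "\<bar>t\<bar> ^ 3 = \<bar>t\<bar> * \<bar>t\<bar> ^ 2" by (simp add: power3_eq_cube power2_eq_square)
    moreover have "\<bar>t\<bar> * \<bar>t\<bar> ^ 2 \<le> \<bar>t\<bar> * 2 ^ 2" using t by (intro mult_left_mono power_mono) auto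
    ultimately have "\<bar>sin t - t\<bar> \<le> 2 / 3 * \<bar>t\<bar>" by simp
    thus ?thesis unfolding t_def[symmetric] by linarith
  qed
  have "cmod (1 - unit_exp y) ^ 2 = (1 - cos (2 * pi * y)) ^ 2 + sin (2 * pi * y) ^ 2"
    by (simp add: cmod_power2 unit_exp_cis)
  also have "\<dots> = 2 - 2 * cos (2 * (pi * y))"
    using sin_cos_squared_add[of "2 * pi * y"] by (simp add: power2_eq_square algebra_simps)
  also have "\<dots> = (2 * sin (pi * y)) ^ 2" unfolding cos_double_sin by (simp add: power2_eq_square)
  finally have "cmod (1 - unit_exp y) ^ 2 = (2 * \<bar>sin (pi * y)\<bar>) ^ 2" by (simp add: power2_eq_square)
  hence "cmod (1 - unit_exp y) = 2 * \<bar>sin (pi * y)\<bar>" by (subst (asm) power2_eq_iff_nonneg) auto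
  moreover have "\<bar>pi * y\<bar> \<ge> 2 * \<bar>y\<bar>" unfolding abs_mult using pi_ge_two by (simp add: mult_right_mono)
  ultimately show ?thesis unfolding ux using s y by linarith
qed

lemma norm_sum_unit_exp_le:
  assumes "d > 0" "\<And>p::int. \<bar>x - of_int p\<bar> \<ge> d"
  shows "cmod (\<Sum>n<N. unit_exp (real n * x)) \<le> 2 / d"
proof -
  have lower: "cmod (1 - unit_exp x) \<ge> d" using norm_one_minus_unit_exp_ge assms(2) by blast
  hence ne: "unit_exp x \<noteq> 1" using assms(1) by auto
  have "(\<Sum>n<N. unit_exp (real n * x)) = (\<Sum>n<N. unit_exp x ^ n)" by (simp add: unit_exp_power)
  also have "\<dots> = (unit_exp x ^ N - 1) / (unit_exp x - 1)" using ne by (rule geometric_sum)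
  finally have "cmod (\<Sum>n<N. unit_exp (real n * x)) = cmod (unit_exp x ^ N - 1) / cmod (1 - unit_exp x)"
    by (simp add: norm_divide norm_minus_commute)
  also have "\<dots> \<le> 2 / d"
    using norm_triangle_ineq4[of "unit_exp x ^ N" 1] lower assms(1)
    by (intro frac_le) (auto simp: norm_power)
  finally show ?thesis .
qed

lemma unit_exp_orthogonality:
  assumes "M \<ge> (1::nat)" "\<bar>k\<bar> < int M"
  shows "(\<Sum>t<M. unit_exp (real t * (of_int k / real M))) = (if k = 0 then of_nat M else 0)"
proof (cases "k = 0")
  case False
  have ne: "unit_exp (of_int k / real M) \<noteq> 1"
  proof
    assume "unit_exp (of_int k / real M) = 1"
    hence "of_int k / real M \<in> \<int>" by (rule unit_exp_eq_1_imp_Ints)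
    then obtain j where "of_int k / real M = of_int j" by (auto elim: Ints_cases)
    hence "(of_int k :: real) = of_int (j * int M)" using assms(1) by (simp add: field_simps)
    hence "k = j * int M" by (simp only: of_int_eq_iff)
    hence "int M dvd k" by simp
    hence "int M \<le> \<bar>k\<bar>" using False by (metis dvd_abs_iff zdvd_imp_le zero_less_abs_iff)
    thus False using assms(2) by simp
  qed
  have "(\<Sum>t<M. unit_exp (real t * (of_int k / real M))) = (\<Sum>t<M. unit_exp (of_int k / real M) ^ t)"
    by (simp add: unit_exp_power)
  also have "\<dots> = (unit_exp (of_int k / real M) ^ M - 1) / (unit_exp (of_int k / real M) - 1)"
    using ne by (rule geometric_sum)
  also have "unit_exp (of_int k / real M) ^ M = 1"
    unfolding unit_exp_power using assms(1) by (intro unit_exp_Ints) simp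
  finally show ?thesis using False by simp
qed simp

lemma parseval:
  assumes "X \<le> M" "M \<ge> 1"
  shows "(\<Sum>t<M. cmod (\<Sum>j<X. a j * unit_exp (- (real t * (real j / real M)))) ^ 2) = real M * (\<Sum>j<X. cmod (a j) ^ 2)"
proof -
  define A where "A t = (\<Sum>j<X. a j * unit_exp (- (real t * (real j / real M))))" for t
  have "of_real (\<Sum>t<M. cmod (A t) ^ 2) = (\<Sum>t<M. A t * cnj (A t))"
    by (simp only: of_real_sum complex_norm_square)
  also have "\<dots> = (\<Sum>t<M. \<Sum>j<X. \<Sum>i<X. a j * cnj (a i) * unit_exp (real t * (of_int (int i - int j) / real M)))"
  proof (rule sum.cong[OF refl])
    fix t
    have "A t * cnj (A t) = (\<Sum>j<X. \<Sum>i<X. (a j * unit_exp (- (real t * (real j / real M)))) * (cnj (a i) * unit_exp (real t * (real i / real M))))"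
      unfolding A_def cnj_sum sum_product by (simp add: cnj_unit_exp)
    also have "\<dots> = (\<Sum>j<X. \<Sum>i<X. a j * cnj (a i) * unit_exp (real t * (of_int (int i - int j) / real M)))"
    proof (intro sum.cong refl)
      fix i j
      have "unit_exp (real t * (of_int (int i - int j) / real M)) = unit_exp (- (real t * (real j / real M))) * unit_exp (real t * (real i / real M))"
        unfolding unit_exp_add[symmetric] by (simp add: diff_divide_distrib right_diff_distrib)
      thus "(a j * unit_exp (- (real t * (real j / real M)))) * (cnj (a i) * unit_exp (real t * (real i / real M)))
          = a j * cnj (a i) * unit_exp (real t * (of_int (int i - int j) / real M))" by simp
    qed
    finally show "A t * cnj (A t) = \<dots>" .
  qed
  also have "\<dots> = (\<Sum>j<X. \<Sum>i<X. a j * cnj (a i) * (\<Sum>t<M. unit_exp (real t * (of_int (int i - int j) / real M))))"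
    unfolding sum_distrib_left by (subst sum.swap, rule sum.cong[OF refl], rule sum.swap)
  also have "\<dots> = (\<Sum>j<X. \<Sum>i<X. if i = j then a j * cnj (a j) * of_nat M else 0)"
  proof (intro sum.cong refl)
    fix i j assume "i \<in> {..<X}" "j \<in> {..<X}"
    hence "\<bar>int i - int j\<bar> < int M" using assms(1) by auto
    from unit_exp_orthogonality[OF assms(2) this]
    show "a j * cnj (a i) * (\<Sum>t<M. unit_exp (real t * (of_int (int i - int j) / real M)))
        = (if i = j then a j * cnj (a j) * of_nat M else 0)" by auto
  qed
  also have "\<dots> = (\<Sum>j<X. a j * cnj (a j) * of_nat M)" by (intro sum.cong refl) simp
  also have "\<dots> = of_real (real M * (\<Sum>j<X. cmod (a j) ^ 2))"
    by (simp only: of_real_mult of_real_sum complex_norm_square sum_distrib_left of_real_of_nat_eq mult.commute)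
  finally show ?thesis unfolding A_def by (simp only: of_real_eq_iff)
qed

text \<open>Characters modulo M = 2 X, which exceeds every j + i, split the double sum into products
  \<open>F a t * F b t\<close>. The transform of g is at most B at every frequency, and Parseval
  with the arithmetic-geometric mean inequality handles the arbitrary a and b.\<close>

lemma bilinear_bound:
  assumes a: "\<And>j. cmod (a j) \<le> 1" and b: "\<And>j. cmod (b j) \<le> 1"
    and B: "\<And>t. cmod (\<Sum>n<2 * X. g n * unit_exp (real n * t)) \<le> B"
  shows "cmod (\<Sum>j<X. \<Sum>i<X. a j * b i * g (j + i)) \<le> B * real X"
proof (cases "X = 0")
  case False
  define M where "M = 2 * X"
  have M: "M \<ge> 1" "X \<le> M" using False by (auto simp: M_def)
  define G where "G t = (\<Sum>n<M. g n * unit_exp (real n * (real t / real M)))" for t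
  define F where "F c t = (\<Sum>j<X. c j * unit_exp (- (real t * (real j / real M))))" for c :: "nat \<Rightarrow> complex" and t :: nat
  have G: "cmod (G t) \<le> B" for t using B[of "real t / real M"] by (simp add: G_def M_def)
  have B0: "B \<ge> 0" using G[of 0] norm_ge_zero order_trans by blast
  have inv: "of_nat M * g k = (\<Sum>t<M. G t * unit_exp (- (real t * (real k / real M))))" if "k < M" for k
  proof -
    have "(\<Sum>t<M. G t * unit_exp (- (real t * (real k / real M))))
        = (\<Sum>t<M. \<Sum>n<M. g n * unit_exp (real t * (of_int (int n - int k) / real M)))"
    proof (rule sum.cong[OF refl])
      fix t
      have "g n * unit_exp (real n * (real t / real M)) * unit_exp (- (real t * (real k / real M)))
          = g n * unit_exp (real t * (of_int (int n - int k) / real M))" for n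
      proof -
        have "unit_exp (real t * (of_int (int n - int k) / real M)) = unit_exp (real n * (real t / real M)) * unit_exp (- (real t * (real k / real M)))"
          unfolding unit_exp_add[symmetric] by (simp add: diff_divide_distrib right_diff_distrib mult.commute)
        thus ?thesis by simp
      qed
      thus "G t * unit_exp (- (real t * (real k / real M))) = (\<Sum>n<M. g n * unit_exp (real t * (of_int (int n - int k) / real M)))"
        unfolding G_def sum_distrib_right by (simp only:)
    qed
    also have "\<dots> = (\<Sum>n<M. g n * (\<Sum>t<M. unit_exp (real t * (of_int (int n - int k) / real M))))"
      unfolding sum_distrib_left by (rule sum.swap)
    also have "\<dots> = (\<Sum>n<M. if n = k then g k * of_nat M else 0)"
    proof (intro sum.cong refl)
      fix n assume "n \<in> {..<M}"
      hence "\<bar>int n - int k\<bar> < int M" using that by auto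
      from unit_exp_orthogonality[OF M(1) this]
      show "g n * (\<Sum>t<M. unit_exp (real t * (of_int (int n - int k) / real M))) = (if n = k then g k * of_nat M else 0)"
        by auto
    qed
    also have "\<dots> = g k * of_nat M" using that by simp
    finally show ?thesis by (simp add: mult.commute)
  qed
  have "of_nat M * (\<Sum>j<X. \<Sum>i<X. a j * b i * g (j + i)) = (\<Sum>j<X. \<Sum>i<X. a j * b i * (of_nat M * g (j + i)))"
    by (simp add: sum_distrib_left mult_ac)
  also have "\<dots> = (\<Sum>j<X. \<Sum>i<X. \<Sum>t<M. G t * ((a j * unit_exp (- (real t * (real j / real M)))) * (b i * unit_exp (- (real t * (real i / real M))))))"
  proof (intro sum.cong refl)
    fix j i assume ij: "j \<in> {..<X}" "i \<in> {..<X}"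
    have "unit_exp (- (real t * (real (j + i) / real M))) = unit_exp (- (real t * (real j / real M))) * unit_exp (- (real t * (real i / real M)))" for t
      unfolding unit_exp_add[symmetric] by (simp add: add_divide_distrib distrib_left)
    thus "a j * b i * (of_nat M * g (j + i)) = (\<Sum>t<M. G t * ((a j * unit_exp (- (real t * (real j / real M)))) * (b i * unit_exp (- (real t * (real i / real M))))))"
      using ij by (subst inv) (auto simp: M_def sum_distrib_left mult_ac)
  qed
  also have "\<dots> = (\<Sum>t<M. G t * (F a t * F b t))"
  proof -
    have "(\<Sum>j<X. \<Sum>i<X. \<Sum>t<M. h j i t) = (\<Sum>t<M. \<Sum>j<X. \<Sum>i<X. h j i t)" for h :: "nat \<Rightarrow> nat \<Rightarrow> nat \<Rightarrow> complex"
      by (subst sum.swap[of _ "{..<M}"]) (intro sum.cong refl sum.swap)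
    moreover have "G t * (F a t * F b t) = (\<Sum>j<X. \<Sum>i<X. G t * ((a j * unit_exp (- (real t * (real j / real M)))) * (b i * unit_exp (- (real t * (real i / real M))))))" for t
      unfolding F_def sum_product by (simp only: sum_distrib_left)
    ultimately show ?thesis by (simp only:)
  qed
  finally have eq: "of_nat M * (\<Sum>j<X. \<Sum>i<X. a j * b i * g (j + i)) = (\<Sum>t<M. G t * (F a t * F b t))" .
  have pars: "(\<Sum>t<M. cmod (F c t) ^ 2) \<le> real M * real X" if "\<And>j. cmod (c j) \<le> 1" for c
  proof -
    have "(\<Sum>j<X. cmod (c j) ^ 2) \<le> (\<Sum>j<X. 1)" using that by (intro sum_mono) (simp add: power_le_one)
    thus ?thesis unfolding F_def parseval[OF M(2,1)] by (intro mult_left_mono) auto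
  qed
  have "real M * cmod (\<Sum>j<X. \<Sum>i<X. a j * b i * g (j + i)) = cmod (\<Sum>t<M. G t * (F a t * F b t))"
    by (simp add: norm_mult flip: eq)
  also have "\<dots> \<le> (\<Sum>t<M. B * (cmod (F a t) ^ 2 + cmod (F b t) ^ 2) / 2)"
  proof (rule sum_norm_le)
    fix t
    have "cmod (F a t) * cmod (F b t) \<le> (cmod (F a t) ^ 2 + cmod (F b t) ^ 2) / 2"
      using sum_squares_bound[of "cmod (F a t)" "cmod (F b t)"] by simp
    hence "cmod (G t) * (cmod (F a t) * cmod (F b t)) \<le> B * ((cmod (F a t) ^ 2 + cmod (F b t) ^ 2) / 2)"
      using G[of t] B0 by (intro mult_mono) auto
    thus "cmod (G t * (F a t * F b t)) \<le> B * (cmod (F a t) ^ 2 + cmod (F b t) ^ 2) / 2"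
      by (simp add: norm_mult)
  qed
  also have "\<dots> = B * ((\<Sum>t<M. cmod (F a t) ^ 2) + (\<Sum>t<M. cmod (F b t) ^ 2)) / 2"
    by (simp add: sum.distrib flip: sum_distrib_left sum_divide_distrib)
  also have "\<dots> \<le> B * (real M * real X + real M * real X) / 2"
    using pars[OF a] pars[OF b] B0 by (intro divide_right_mono mult_left_mono add_mono) auto
  also have "\<dots> = real M * (B * real X)" by simp
  finally show ?thesis using M(1) by (simp add: mult_le_cancel_left_pos)
qed simp

section \<open>A Liouville bound for forms in two quadratic irrationals\<close>

text \<open>The four conjugates multiply to an integer. Each is again an integral linear form whose
  first two coefficients are not both 0, so \<open>indep\<close> makes it nonzero; unless the form
  itself is at least 1, the three others are at most Q.\<close>

lemma liouville_linear_form: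
  assumes m: "m1 \<ge> 1" "m2 \<ge> 1"
    and indep: "\<And>h r p::int. h \<noteq> 0 \<or> r \<noteq> 0 \<Longrightarrow> of_int h * alpha m1 + of_int r * alpha m2 + of_int p \<noteq> 0"
    and l: "l1 \<noteq> 0 \<or> l2 \<noteq> (0::int)" "of_int \<bar>l1\<bar> \<le> L" "of_int \<bar>l2\<bar> \<le> L" "L \<ge> 1"
  shows "\<bar>of_int l1 * alpha m1 + of_int l2 * alpha m2 + of_int l0\<bar> \<ge> 1 / ((real m1 + real m2 + 5) ^ 3 * L ^ 3)"
proof -
  define Q where "Q = (real m1 + real m2 + 5) * L"
  have Q1: "Q \<ge> 1"
  proof -
    have "1 * 1 \<le> (real m1 + real m2 + 5) * L" using l(4) by (intro mult_mono) auto
    thus ?thesis by (simp add: Q_def)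
  qed
  define a a' b b' where "a = alpha m1" and "a' = - real m1 - a" and "b = alpha m2" and "b' = - real m2 - b"
  have a: "0 < a" "a < 1" "a * a = real m1 - real m1 * a" and b: "0 < b" "b < 1" "b * b = real m2 - real m2 * b"
    using alpha_pos alpha_lt1 alpha_sq m unfolding a_def b_def by (auto simp: power2_eq_square algebra_simps)
  define x1 x2 x3 x4 where "x1 = of_int l0 + of_int l1 * a + of_int l2 * b"
    and "x2 = of_int l0 + of_int l1 * a' + of_int l2 * b"
    and "x3 = of_int l0 + of_int l1 * a + of_int l2 * b'"
    and "x4 = of_int l0 + of_int l1 * a' + of_int l2 * b'"
  have goal: "\<bar>x1\<bar> \<ge> 1 / Q ^ 3"
  proof (cases "\<bar>x1\<bar> \<ge> 1")
    case True
    have "1 / Q ^ 3 \<le> 1" using Q1 by simp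
    thus ?thesis using True by linarith
  next
    case False
    \<comment> \<open>Multiplying over the two conjugates of a leaves x1 x2 = u + v b and x3 x4 = u
      + v b'.\<close>
    define u where "u = l0 ^ 2 + l2 ^ 2 * int m2 - int m1 * l1 * l0 - int m1 * l1 ^ 2"
    define v where "v = 2 * l0 * l2 - l2 ^ 2 * int m2 - int m1 * l1 * l2"
    have p12: "x1 * x2 = of_int u + of_int v * b"
    proof -
      have "x1 * x2 = of_int l0 ^ 2 + of_int l2 ^ 2 * (b * b) + 2 * of_int l0 * of_int l2 * b
          - real m1 * of_int l1 * (of_int l0 + of_int l2 * b) - of_int l1 ^ 2 * (real m1 * a + a * a)"
        unfolding x1_def x2_def a'_def by (simp add: power2_eq_square algebra_simps)
      also have "\<dots> = of_int u + of_int v * b"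
        unfolding a(3) b(3) u_def v_def by (simp add: power2_eq_square algebra_simps)
      finally show ?thesis .
    qed
    have bb': "b' * b' = real m2 - real m2 * b'" unfolding b'_def using b(3) by (simp add: algebra_simps)
    have p34: "x3 * x4 = of_int u + of_int v * b'"
    proof -
      have "x3 * x4 = of_int l0 ^ 2 + of_int l2 ^ 2 * (b' * b') + 2 * of_int l0 * of_int l2 * b'
          - real m1 * of_int l1 * (of_int l0 + of_int l2 * b') - of_int l1 ^ 2 * (real m1 * a + a * a)"
        unfolding x3_def x4_def a'_def by (simp add: power2_eq_square algebra_simps)
      also have "\<dots> = of_int u + of_int v * b'"
        unfolding a(3) bb' u_def v_def by (simp add: power2_eq_square algebra_simps)
      finally show ?thesis .
    qed
    have "(x1 * x2) * (x3 * x4) = of_int u ^ 2 - real m2 * of_int u * of_int v - of_int v ^ 2 * (real m2 * b + b * b)"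
      unfolding p12 p34 b'_def by (simp add: power2_eq_square algebra_simps)
    also have "\<dots> = of_int (u ^ 2 - int m2 * u * v - int m2 * v ^ 2)"
      unfolding b(3) by (simp add: algebra_simps)
    finally have int: "(x1 * x2) * (x3 * x4) \<in> \<int>" by simp
    have "x1 \<noteq> 0" using indep[of l1 l2 l0] l(1) by (simp add: x1_def a_def b_def algebra_simps)
    moreover have "x2 \<noteq> 0" using indep[of "- l1" l2 "l0 - l1 * int m1"] l(1) by (simp add: x2_def a'_def a_def b_def algebra_simps)
    moreover have "x3 \<noteq> 0" using indep[of l1 "- l2" "l0 - l2 * int m2"] l(1) by (simp add: x3_def b'_def a_def b_def algebra_simps)
    moreover have "x4 \<noteq> 0" using indep[of "- l1" "- l2" "l0 - l1 * int m1 - l2 * int m2"] l(1)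
      by (simp add: x4_def a'_def b'_def a_def b_def algebra_simps)
    ultimately have "(x1 * x2) * (x3 * x4) \<noteq> 0" by simp
    hence ge: "1 \<le> \<bar>(x1 * x2) * (x3 * x4)\<bar>" using int by (simp add: Ints_nonzero_abs_ge1)
    have l': "\<bar>of_int l1 :: real\<bar> \<le> L" "\<bar>of_int l2 :: real\<bar> \<le> L" using l by auto
    have prod: "\<bar>of_int k * y\<bar> \<le> L * c" if "\<bar>of_int k :: real\<bar> \<le> L" "\<bar>y\<bar> \<le> c" for k :: int and y c :: real
      unfolding abs_mult using that by (intro mult_mono) auto
    have t: "\<bar>of_int l1 * a\<bar> \<le> L * 1" "\<bar>of_int l1 * a'\<bar> \<le> L * (real m1 + 1)"
      "\<bar>of_int l2 * b\<bar> \<le> L * 1" "\<bar>of_int l2 * b'\<bar> \<le> L * (real m2 + 1)"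
      using a b by (intro prod l'; simp add: a'_def b'_def)+
    have l0: "\<bar>of_int l0 :: real\<bar> \<le> 3 * L" using False t(1,3) l(4) unfolding x1_def by linarith
    have mm: "L * real m1 \<ge> 0" "L * real m2 \<ge> 0" using l(4) by auto
    have xb: "\<bar>x2\<bar> \<le> Q" "\<bar>x3\<bar> \<le> Q" "\<bar>x4\<bar> \<le> Q"
    proof -
      have Q: "Q = L * real m1 + L * real m2 + 5 * L" by (simp add: Q_def algebra_simps)
      show "\<bar>x2\<bar> \<le> Q" "\<bar>x3\<bar> \<le> Q" "\<bar>x4\<bar> \<le> Q"
        using t l0 mm unfolding x2_def x3_def x4_def Q distrib_left by linarith+
    qed
    have "\<bar>(x1 * x2) * (x3 * x4)\<bar> = \<bar>x1\<bar> * (\<bar>x2\<bar> * (\<bar>x3\<bar> * \<bar>x4\<bar>))" by (simp add: abs_mult)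
    also have "\<dots> \<le> \<bar>x1\<bar> * (Q * (Q * Q))" using xb Q1 by (intro mult_left_mono mult_mono) auto
    finally have "1 \<le> \<bar>x1\<bar> * Q ^ 3" using ge by (simp add: power3_eq_cube mult_ac)
    thus ?thesis using Q1 by (simp add: divide_le_eq)
  qed
  have "of_int l1 * alpha m1 + of_int l2 * alpha m2 + of_int l0 = x1" by (simp add: x1_def a_def b_def)
  thus ?thesis using goal by (simp add: Q_def power_mult_distrib)
qed

section \<open>Simultaneous approximation\<close>

text \<open>The Fejer kernel without its factor 1 / L: nonnegative, with mean L, and small away from
  the integers.\<close>

definition fejer :: "nat \<Rightarrow> real \<Rightarrow> real" where
  "fejer L x = cmod (\<Sum>l<L. unit_exp (real l * x)) ^ 2"

lemma fejer_nonneg: "fejer L x \<ge> 0"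
  by (simp add: fejer_def)

lemma fejer_expand:
  "of_real (fejer L (real n * \<alpha> - \<gamma>)) =
    (\<Sum>q\<in>{..<L} \<times> {..<L}. unit_exp (- (of_int (int (fst q) - int (snd q)) * \<gamma>)) *
       unit_exp (real n * (of_int (int (fst q) - int (snd q)) * \<alpha>)))"
proof -
  define x where "x = real n * \<alpha> - \<gamma>"
  have "of_real (fejer L x) = (\<Sum>l<L. unit_exp (real l * x)) * cnj (\<Sum>l<L. unit_exp (real l * x))"
    unfolding fejer_def by (rule complex_norm_square)
  also have "\<dots> = (\<Sum>a<L. \<Sum>b<L. unit_exp (real a * x) * unit_exp (- (real b * x)))"
    unfolding cnj_sum sum_product by (simp add: cnj_unit_exp)
  also have "\<dots> = (\<Sum>a<L. \<Sum>b<L. unit_exp (- (of_int (int a - int b) * \<gamma>)) * unit_exp (real n * (of_int (int a - int b) * \<alpha>)))"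
    unfolding unit_exp_add[symmetric] x_def by (simp add: algebra_simps)
  finally show ?thesis unfolding x_def by (simp add: sum.cartesian_product case_prod_beta)
qed

text \<open>The frequencies indexed by Z give the mean; all others cancel up to B.\<close>

lemma exponential_sum_main_term:
  assumes "finite I" "Z \<subseteq> I" "\<And>i. i \<in> I \<Longrightarrow> cmod (c i) \<le> 1"
    and "\<And>i. i \<in> Z \<Longrightarrow> c i = 1 \<and> \<xi> i = 0"
    and "\<And>i. i \<in> I - Z \<Longrightarrow> cmod (\<Sum>n<N. unit_exp (real n * \<xi> i)) \<le> B" and "B \<ge> 0"
  shows "cmod ((\<Sum>n<N. \<Sum>i\<in>I. c i * unit_exp (real n * \<xi> i)) - of_nat (N * card Z)) \<le> real (card I) * B"
proof -
  have "(\<Sum>n<N. \<Sum>i\<in>I. c i * unit_exp (real n * \<xi> i)) = (\<Sum>i\<in>I. c i * (\<Sum>n<N. unit_exp (real n * \<xi> i)))"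
    unfolding sum_distrib_left by (rule sum.swap)
  also have "\<dots> = (\<Sum>i\<in>I - Z. c i * (\<Sum>n<N. unit_exp (real n * \<xi> i))) + (\<Sum>i\<in>Z. c i * (\<Sum>n<N. unit_exp (real n * \<xi> i)))"
    by (rule sum.subset_diff[OF assms(2,1)])
  also have "(\<Sum>i\<in>Z. c i * (\<Sum>n<N. unit_exp (real n * \<xi> i))) = of_nat (N * card Z)"
    using assms(4) by simp
  finally have "cmod ((\<Sum>n<N. \<Sum>i\<in>I. c i * unit_exp (real n * \<xi> i)) - of_nat (N * card Z))
      = cmod (\<Sum>i\<in>I - Z. c i * (\<Sum>n<N. unit_exp (real n * \<xi> i)))" by simp
  also have "\<dots> \<le> (\<Sum>i\<in>I - Z. B)"
  proof (rule sum_norm_le)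
    fix i assume i: "i \<in> I - Z"
    have "cmod (c i) * cmod (\<Sum>n<N. unit_exp (real n * \<xi> i)) \<le> 1 * B"
      using assms(3)[of i] assms(5)[OF i] assms(6) i by (intro mult_mono) auto
    thus "cmod (c i * (\<Sum>n<N. unit_exp (real n * \<xi> i))) \<le> B" by (simp add: norm_mult)
  qed
  also have "\<dots> = real (card (I - Z)) * B" by simp
  also have "\<dots> \<le> real (card I) * B" using assms(1,6) by (intro mult_right_mono) (auto intro: card_mono)
  finally show ?thesis .
qed

lemma card_diagonal: "card {q \<in> {..<L} \<times> {..<L}. fst q = snd q} = (L :: nat)"
proof -
  have "{q \<in> {..<L} \<times> {..<L}. fst q = snd q} = (\<lambda>a. (a, a)) ` {..<L}" by auto
  thus ?thesis by (simp add: card_image inj_on_def)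
qed

text \<open>The mean of a product of two Fejer kernels is too large for the product to be small at all points.\<close>

theorem quantitative_kronecker:
  fixes \<alpha>1 \<alpha>2 \<gamma> \<eta> B :: real and L N :: nat
  assumes L: "L \<ge> 1" and B: "B > 0"
    and lin: "\<And>l1 l2 p::int. l1 \<noteq> 0 \<or> l2 \<noteq> 0 \<Longrightarrow> \<bar>l1\<bar> \<le> int L \<Longrightarrow> \<bar>l2\<bar> \<le> int L \<Longrightarrow>
      \<bar>of_int l1 * \<alpha>1 + of_int l2 * \<alpha>2 - of_int p\<bar> \<ge> 2 / B"
    and \<eta>: "\<eta> > 0" "real L * \<eta> ^ 2 \<ge> 16" and N: "real N > 3 * real L ^ 2 * B"
  obtains n p1 p2 where "n < N" "\<bar>real n * \<alpha>1 - of_int p1\<bar> \<le> \<eta>" "\<bar>real n * \<alpha>2 - \<gamma> - of_int p2\<bar> \<le> \<eta>"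
proof (rule ccontr)
  assume neg: "\<not> thesis"
  note found = that
  define K1 where "K1 n = fejer L (real n * \<alpha>1 - 0)" for n
  define K2 where "K2 n = fejer L (real n * \<alpha>2 - \<gamma>)" for n
  define P where "P = {..<L} \<times> {..<L}"
  define Z where "Z = {q \<in> P. fst q = snd q}"
  define dif where "dif q = int (fst q) - int (snd q)" for q :: "nat \<times> nat"
  have P: "finite P" "card P = L ^ 2" "Z \<subseteq> P" "card Z = L"
    using card_diagonal[of L] by (auto simp: P_def Z_def power2_eq_square)
  have difL: "\<bar>dif q\<bar> \<le> int L" if "q \<in> P" for q using that by (auto simp: P_def dif_def)
  have dif0: "dif q = 0 \<longleftrightarrow> q \<in> Z" if "q \<in> P" for q using that by (auto simp: Z_def dif_def)
  have S: "cmod (\<Sum>n<N. unit_exp (real n * (of_int l1 * \<alpha>1 + of_int l2 * \<alpha>2))) \<le> B"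
    if "l1 \<noteq> 0 \<or> l2 \<noteq> 0" "\<bar>l1\<bar> \<le> int L" "\<bar>l2\<bar> \<le> int L" for l1 l2
    using norm_sum_unit_exp_le[of "2 / B" "of_int l1 * \<alpha>1 + of_int l2 * \<alpha>2" N] lin[OF that] B by simp
  have single: "\<bar>(\<Sum>n<N. fejer L (real n * \<alpha> - g)) - real N * real L\<bar> \<le> real L ^ 2 * B"
    if "\<And>l. l \<noteq> 0 \<Longrightarrow> \<bar>l\<bar> \<le> int L \<Longrightarrow> cmod (\<Sum>n<N. unit_exp (real n * (of_int l * \<alpha>))) \<le> B" for \<alpha> g
  proof -
    have "cmod ((\<Sum>n<N. \<Sum>q\<in>P. unit_exp (- (of_int (dif q) * g)) * unit_exp (real n * (of_int (dif q) * \<alpha>))) - of_nat (N * card Z))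
        \<le> real (card P) * B"
    proof (rule exponential_sum_main_term)
      fix q assume "q \<in> Z"
      hence "dif q = 0" using dif0[of q] P(3) by blast
      thus "unit_exp (- (of_int (dif q) * g)) = 1 \<and> of_int (dif q) * \<alpha> = 0" by simp
    next
      fix q assume "q \<in> P - Z"
      thus "cmod (\<Sum>n<N. unit_exp (real n * (of_int (dif q) * \<alpha>))) \<le> B" using difL dif0 by (intro that) auto
    qed (use P B in auto)
    moreover have "(\<Sum>n<N. \<Sum>q\<in>P. unit_exp (- (of_int (dif q) * g)) * unit_exp (real n * (of_int (dif q) * \<alpha>)))
        = of_real (\<Sum>n<N. fejer L (real n * \<alpha> - g))"
      unfolding of_real_sum fejer_expand P_def dif_def ..
    ultimately have "cmod (of_real ((\<Sum>n<N. fejer L (real n * \<alpha> - g)) - real N * real L)) \<le> real L ^ 2 * B"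
      using P by simp
    thus ?thesis by (simp only: norm_of_real)
  qed
  have s1: "\<bar>(\<Sum>n<N. K1 n) - real N * real L\<bar> \<le> real L ^ 2 * B"
    unfolding K1_def by (rule single) (use S[of _ 0] in simp)
  have s2: "\<bar>(\<Sum>n<N. K2 n) - real N * real L\<bar> \<le> real L ^ 2 * B"
    unfolding K2_def by (rule single) (use S[of 0] in simp)
  have s12: "\<bar>(\<Sum>n<N. K1 n * K2 n) - real N * real L ^ 2\<bar> \<le> real L ^ 4 * B"
  proof -
    define c where "c u = unit_exp (- (of_int (dif (snd u)) * \<gamma>))" for u :: "(nat \<times> nat) \<times> (nat \<times> nat)"
    define \<xi> where "\<xi> u = of_int (dif (fst u)) * \<alpha>1 + of_int (dif (snd u)) * \<alpha>2" for u :: "(nat \<times> nat) \<times> (nat \<times> nat)"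
    have "cmod ((\<Sum>n<N. \<Sum>u\<in>P \<times> P. c u * unit_exp (real n * \<xi> u)) - of_nat (N * card (Z \<times> Z))) \<le> real (card (P \<times> P)) * B"
    proof (rule exponential_sum_main_term)
      fix u assume u: "u \<in> P \<times> P - Z \<times> Z"
      show "cmod (\<Sum>n<N. unit_exp (real n * \<xi> u)) \<le> B" unfolding \<xi>_def
        by (rule S) (use u dif0 difL in auto)
    next
      fix u assume "u \<in> Z \<times> Z"
      hence "dif (fst u) = 0" "dif (snd u) = 0" using dif0 P(3) by auto
      thus "c u = 1 \<and> \<xi> u = 0" by (simp add: c_def \<xi>_def)
    qed (use P B in \<open>auto simp: c_def\<close>)
    moreover have "(\<Sum>n<N. \<Sum>u\<in>P \<times> P. c u * unit_exp (real n * \<xi> u)) = of_real (\<Sum>n<N. K1 n * K2 n)"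
    proof -
      have "of_real (K1 n * K2 n) = (\<Sum>u\<in>P \<times> P. c u * unit_exp (real n * \<xi> u))" for n
      proof -
        have "of_real (K1 n * K2 n) = (\<Sum>p\<in>P. unit_exp (real n * (of_int (dif p) * \<alpha>1))) *
            (\<Sum>q\<in>P. unit_exp (- (of_int (dif q) * \<gamma>)) * unit_exp (real n * (of_int (dif q) * \<alpha>2)))"
          unfolding K1_def K2_def of_real_mult fejer_expand P_def dif_def by simp
        also have "\<dots> = (\<Sum>p\<in>P. \<Sum>q\<in>P. c (p, q) * unit_exp (real n * \<xi> (p, q)))"
          unfolding sum_product c_def \<xi>_def by (simp add: unit_exp_add distrib_left mult_ac)
        finally show ?thesis by (simp add: sum.cartesian_product case_prod_beta)
      qed
      thus ?thesis by (simp only: of_real_sum)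
    qed
    moreover have "card (Z \<times> Z) = L ^ 2" "card (P \<times> P) = L ^ 4"
      using P by (auto simp: card_cartesian_product power2_eq_square power4_eq_xxxx)
    ultimately have "cmod (of_real ((\<Sum>n<N. K1 n * K2 n) - real N * real L ^ 2)) \<le> real L ^ 4 * B"
      by simp
    thus ?thesis by (simp only: norm_of_real)
  qed
  have small: "fejer L x \<le> 4 / \<eta> ^ 2" if "\<And>p::int. \<bar>x - of_int p\<bar> > \<eta>" for x
  proof -
    have "cmod (\<Sum>n<L. unit_exp (real n * x)) \<le> 2 / \<eta>"
      using \<eta>(1) that by (intro norm_sum_unit_exp_le) (auto intro: less_imp_le)
    hence "fejer L x \<le> (2 / \<eta>) ^ 2" unfolding fejer_def by (intro power_mono) auto
    thus ?thesis by (simp add: power_divide)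
  qed
  \<comment> \<open>At each n one kernel is at most 4 / \<eta>^2 \<le> L / 4. Summing bounds the
    product, whose mean is about L^2, by about half of that; N > 3 L^2 B keeps the errors too small
    for this.\<close>
  have "K1 n * K2 n \<le> real L / 4 * (K1 n + K2 n)" if "n < N" for n
  proof -
    have nn: "K1 n \<ge> 0" "K2 n \<ge> 0" by (simp_all add: K1_def K2_def fejer_nonneg)
    have e: "4 / \<eta> ^ 2 \<le> real L / 4" using \<eta> by (simp add: field_simps)
    have "(\<forall>p1::int. \<bar>real n * \<alpha>1 - of_int p1\<bar> > \<eta>) \<or> (\<forall>p2::int. \<bar>real n * \<alpha>2 - \<gamma> - of_int p2\<bar> > \<eta>)"
      using neg found[OF that] by (meson not_le)
    hence "K1 n \<le> 4 / \<eta> ^ 2 \<or> K2 n \<le> 4 / \<eta> ^ 2" unfolding K1_def K2_def using small by auto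
    hence "K1 n \<le> real L / 4 \<or> K2 n \<le> real L / 4" using e by linarith
    thus ?thesis
    proof
      assume "K1 n \<le> real L / 4"
      hence "K1 n * K2 n \<le> real L / 4 * K2 n" using nn by (intro mult_right_mono)
      also have "\<dots> \<le> real L / 4 * (K1 n + K2 n)" using nn by (intro mult_left_mono) auto
      finally show ?thesis .
    next
      assume "K2 n \<le> real L / 4"
      hence "K2 n * K1 n \<le> real L / 4 * K1 n" using nn by (intro mult_right_mono)
      also have "\<dots> \<le> real L / 4 * (K1 n + K2 n)" using nn by (intro mult_left_mono) auto
      finally show ?thesis by (simp add: mult.commute)
    qed
  qed
  hence "(\<Sum>n<N. K1 n * K2 n) \<le> (\<Sum>n<N. real L / 4 * (K1 n + K2 n))" by (intro sum_mono) auto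
  also have "\<dots> = real L / 4 * ((\<Sum>n<N. K1 n) + (\<Sum>n<N. K2 n))" by (simp only: sum_distrib_left[symmetric] sum.distrib)
  also have "\<dots> \<le> real L / 4 * ((real N * real L + real L ^ 2 * B) + (real N * real L + real L ^ 2 * B))"
    using s1 s2 by (intro mult_left_mono add_mono) auto
  also have "\<dots> = real N * real L ^ 2 / 2 + real L ^ 3 * B / 2" by (simp add: power2_eq_square power3_eq_cube field_simps)
  finally have "real N * real L ^ 2 - real L ^ 4 * B \<le> real N * real L ^ 2 / 2 + real L ^ 3 * B / 2" using s12 by linarith
  moreover have "real L ^ 3 * B \<le> real L ^ 4 * B"
    using L B by (intro mult_right_mono power_increasing) auto
  ultimately have "real N * real L ^ 2 \<le> 3 * (real L ^ 4 * B)" by linarith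
  hence "real N * real L ^ 2 \<le> (3 * real L ^ 2 * B) * real L ^ 2" by (simp add: power2_eq_square power4_eq_xxxx mult_ac)
  moreover have "real L ^ 2 > 0" using L by simp
  ultimately have "real N \<le> 3 * real L ^ 2 * B" by (metis mult_le_cancel_right_pos)
  thus False using N by linarith
qed

text \<open>The target phases 0 and \<open>alpha m2\<close> make d act like 0 in the first system
  and like 1 in the second; \<open>liouville_linear_form\<close> keeps the cost polynomial in
  X.\<close>

lemma simultaneous_shift:
  assumes m: "m1 \<ge> 1" "m2 \<ge> 1"
    and indep: "\<And>h r p::int. h \<noteq> 0 \<or> r \<noteq> 0 \<Longrightarrow> of_int h * alpha m1 + of_int r * alpha m2 + of_int p \<noteq> 0"
  obtains E :: real where "E > 0"
    "\<And>X::nat. X \<ge> m2 + 4 \<Longrightarrow> \<exists>d w1 w2. d \<ge> 1 \<and> real d \<le> E * real X ^ 50 \<and>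
       phase m1 (real d) w1 \<and> \<bar>w1\<bar> \<le> 1 / real X ^ 5 \<and> phase m2 (real d - 1) w2 \<and> \<bar>w2\<bar> \<le> 1 / real X ^ 5"
proof -
  define C where "C = (real m1 + real m2 + 5) ^ 3"
  have C: "C > 0" by (simp add: C_def)
  define E where "E = 6 * C * 16 ^ 5 + 1"
  show ?thesis
  proof (rule that[of E])
    show "E > 0" using C by (simp add: E_def add_pos_pos)
  next
    fix X :: nat assume X: "X \<ge> m2 + 4"
    \<comment> \<open>Accuracy 1 / X^5 asks for L / X^10 \<ge> 16. Then B is of order L^3 and N of
      order L^2 B, that is L^5 or X^50.\<close>
    define L where "L = 16 * X ^ 10"
    define B where "B = 2 * C * real L ^ 3"
    define N where "N = nat \<lfloor>3 * real L ^ 2 * B\<rfloor> + 1"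
    have X1: "real X \<ge> 1" using X by simp
    have L1: "L \<ge> 1" using X by (simp add: L_def)
    have B0: "B > 0" using C L1 by (simp add: B_def)
    have nn: "3 * real L ^ 2 * B \<ge> 0" using B0 by simp
    have N: "real N > 3 * real L ^ 2 * B" "real N \<le> 3 * real L ^ 2 * B + 1" using nn unfolding N_def by linarith+
    obtain n p1 p2 where n: "n < N" "\<bar>real n * alpha m1 - of_int p1\<bar> \<le> 1 / real X ^ 5"
      "\<bar>real n * alpha m2 - alpha m2 - of_int p2\<bar> \<le> 1 / real X ^ 5"
    proof (rule quantitative_kronecker[OF L1 B0 _ _ _ N(1), of "alpha m1" "alpha m2" "1 / real X ^ 5" "alpha m2"])
      fix l1 l2 p :: int assume l: "l1 \<noteq> 0 \<or> l2 \<noteq> 0" "\<bar>l1\<bar> \<le> int L" "\<bar>l2\<bar> \<le> int L"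
      have "real_of_int \<bar>l1\<bar> \<le> real L" "real_of_int \<bar>l2\<bar> \<le> real L"
        using l(2,3) by (metis of_int_le_iff of_int_of_nat_eq)+
      hence "\<bar>of_int l1 * alpha m1 + of_int l2 * alpha m2 + of_int (- p)\<bar> \<ge> 1 / (C * real L ^ 3)"
        unfolding C_def using l(1) L1 by (intro liouville_linear_form[OF m indep]) auto
      thus "2 / B \<le> \<bar>of_int l1 * alpha m1 + of_int l2 * alpha m2 - of_int p\<bar>" by (simp add: B_def)
    next
      show "1 / real X ^ 5 > 0" using X1 by simp
      have "real L * (1 / real X ^ 5) ^ 2 = 16"
        using X1 by (simp add: L_def power_divide flip: power_mult)
      thus "16 \<le> real L * (1 / real X ^ 5) ^ 2" by simp
    qed (use that in blast)
    have ph: "phase m1 (real n) (real n * alpha m1 - of_int p1)" "phase m2 (real n - 1) (real n * alpha m2 - alpha m2 - of_int p2)"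
      by (simp_all add: phase_def algebra_simps)
    \<comment> \<open>So that d - 1 is a natural number; n = 0 would put \<open>alpha m2\<close>
      itself too close to an integer.\<close>
    have "n \<noteq> 0"
    proof
      assume "n = 0"
      hence "phase m2 (- 1) (- alpha m2 - of_int p2)" using ph(2) by simp
      from phase_diff[OF phase_0 this] have "phase m2 (real 1) (alpha m2 + of_int p2)" by (simp add: add.commute)
      hence "1 / (real (m2 + 3) * real 1) \<le> \<bar>alpha m2 + of_int p2\<bar>" by (intro dist_int_ge[OF m(2)]) auto
      moreover have "\<bar>alpha m2 + of_int p2\<bar> \<le> 1 / real X ^ 5" using n(3) \<open>n = 0\<close> by simp
      moreover have "1 / real X ^ 5 < 1 / real (m2 + 3)"
      proof (rule divide_strict_left_mono)
        have "real (m2 + 3) < real X ^ 1" using X by simp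
        also have "\<dots> \<le> real X ^ 5" using X1 by (intro power_increasing) auto
        finally show "real (m2 + 3) < real X ^ 5" .
      qed (use X1 in auto)
      ultimately show False by simp
    qed
    hence n1: "n \<ge> 1" by simp
    have "3 * real L ^ 2 * B + 1 \<le> E * real X ^ 50"
    proof -
      have "3 * real L ^ 2 * B = 6 * C * real L ^ 5" by (simp add: B_def power2_eq_square power3_eq_cube numeral_eq_Suc)
      also have "real L ^ 5 = 16 ^ 5 * real X ^ 50" by (simp add: L_def power_mult_distrib flip: power_mult)
      finally have "3 * real L ^ 2 * B = 6 * C * 16 ^ 5 * real X ^ 50" by simp
      moreover have "1 \<le> real X ^ 50" using X1 by (rule one_le_power)
      ultimately show ?thesis unfolding E_def distrib_right by linarith
    qed
    moreover have "real n \<le> real N" using n(1) by simp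
    ultimately have "real n \<le> E * real X ^ 50" using N(2) by linarith
    thus "\<exists>d w1 w2. d \<ge> 1 \<and> real d \<le> E * real X ^ 50 \<and>
       phase m1 (real d) w1 \<and> \<bar>w1\<bar> \<le> 1 / real X ^ 5 \<and> phase m2 (real d - 1) w2 \<and> \<bar>w2\<bar> \<le> 1 / real X ^ 5"
      using n n1 ph by blast
  qed
qed

section \<open>Counting numbers of small phase\<close>

lemma card_separated:
  fixes g :: real
  assumes "A \<subseteq> {..<N}" "g > 0" "\<And>x y. x \<in> A \<Longrightarrow> y \<in> A \<Longrightarrow> x < y \<Longrightarrow> g \<le> real y - real x"
  shows "real (card A) \<le> real N / g + 1"
proof -
  define F where "F x = nat \<lfloor>real x / g\<rfloor>" for x :: nat
  have mono: "F x < F y" if "x \<in> A" "y \<in> A" "x < y" for x y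
  proof -
    have "real x / g + 1 \<le> real y / g" 
      using divide_right_mono[OF assms(3)[OF that], of g] assms(2) by (simp add: diff_divide_distrib)
    hence "\<lfloor>real x / g\<rfloor> < \<lfloor>real y / g\<rfloor>" by linarith
    moreover have "0 \<le> \<lfloor>real x / g\<rfloor>" using assms(2) by simp
    ultimately show ?thesis unfolding F_def by linarith
  qed
  hence "inj_on F A" by (intro inj_onI) (metis linorder_neqE_nat less_irrefl)
  moreover have "F ` A \<subseteq> {..nat \<lfloor>real N / g\<rfloor>}"
  proof
    fix y assume "y \<in> F ` A"
    then obtain x where x: "x \<in> A" "y = F x" by auto
    have "real x / g \<le> real N / g" using assms(1,2) x(1) by (intro divide_right_mono) auto
    thus "y \<in> {..nat \<lfloor>real N / g\<rfloor>}" unfolding x(2) F_def by (simp add: floor_mono nat_mono)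
  qed
  ultimately have "card A \<le> card {..nat \<lfloor>real N / g\<rfloor>}" by (intro card_inj_on_le) auto
  hence "real (card A) \<le> real (nat \<lfloor>real N / g\<rfloor>) + 1" by simp
  moreover have "0 \<le> real N / g" using assms(2) by simp
  ultimately show ?thesis by linarith
qed

text \<open>Two such numbers differ by one of phase at most 2 \<eta>, so \<open>dist_int_ge\<close>
  keeps them apart.\<close>

lemma card_small_phase:
  assumes m: "m \<ge> 1" and \<eta>: "\<eta> > 0"
  shows "real (card {z. z < N \<and> (\<exists>w. phase m (real z + real j) w \<and> \<bar>w\<bar> \<le> \<eta>)}) \<le> 2 * (real m + 3) * \<eta> * real N + 1"
proof -
  let ?A = "{z. z < N \<and> (\<exists>w. phase m (real z + real j) w \<and> \<bar>w\<bar> \<le> \<eta>)}"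
  define g where "g = 1 / (2 * (real m + 3) * \<eta>)"
  have "real (card ?A) \<le> real N / g + 1"
  proof (rule card_separated)
    show "g > 0" using \<eta> by (simp add: g_def)
    fix x y assume xy: "x \<in> ?A" "y \<in> ?A" "x < y"
    then obtain w v where w: "phase m (real x + real j) w" "\<bar>w\<bar> \<le> \<eta>" "phase m (real y + real j) v" "\<bar>v\<bar> \<le> \<eta>" by auto
    have "phase m (real (y - x)) (v - w)" using phase_diff[OF w(3,1)] xy(3) by (simp add: of_nat_diff)
    hence "1 / (real (m + 3) * real (y - x)) \<le> \<bar>v - w\<bar>" using xy(3) by (intro dist_int_ge[OF m]) auto
    also have "\<dots> \<le> 2 * \<eta>" using w by linarith
    finally have "1 \<le> 2 * \<eta> * (real (m + 3) * real (y - x))" using xy(3) by (simp add: divide_le_eq)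
    thus "g \<le> real y - real x" using \<eta> xy(3) by (simp add: g_def divide_le_eq of_nat_diff mult_ac)
  qed auto
  thus ?thesis by (simp add: g_def mult_ac)
qed

section \<open>The nonresonant case\<close>

lemma digit_sum_shift_const:
  assumes "\<And>z. n < z \<Longrightarrow> z \<le> n + j \<Longrightarrow> digit_incr m (z + k) = digit_incr m z"
  shows "int (digit_sum m (n + j + k)) - int (digit_sum m (n + j)) = int (digit_sum m (n + k)) - int (digit_sum m n)"
  using assms
proof (induction j)
  case (Suc j)
  have "int (digit_sum m (n + j + k)) - int (digit_sum m (n + j)) = int (digit_sum m (n + k)) - int (digit_sum m n)"
    using Suc by simp
  moreover have "digit_incr m (n + Suc j + k) = digit_incr m (n + Suc j)" using Suc.prems[of "n + Suc j"] by simp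
  ultimately show ?case unfolding digit_incr_def by simp
qed simp

text \<open>The bound Y of \<open>digit_incr_shift_eq\<close> for \<rho> = 1 / X^2.\<close>

definition jump_range :: "nat \<Rightarrow> nat \<Rightarrow> nat" where
  "jump_range m X = nat \<lceil>real X ^ 2 / (alpha m * (1 - alpha m))\<rceil>"

text \<open>All i in the range are excluded, not only denominators: about X^2 values of i at N / X^4
  each still give only N / X^2 exceptions. The tolerance 1 / X^4 covers e-fold multiples, e < X, of
  a shift of phase 1 / X^5.\<close>

definition near_jump :: "nat \<Rightarrow> nat \<Rightarrow> nat \<Rightarrow> bool" where
  "near_jump m X z \<longleftrightarrow> (\<exists>w. phase m (real z + real 0) w \<and> \<bar>w\<bar> \<le> 1 / real X ^ 2) \<or>
     (\<exists>i\<le>jump_range m X. \<exists>w. phase m (real z + real i) w \<and> \<bar>w\<bar> \<le> 1 / real X ^ 4)"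

lemma digit_incr_shift_not_near_jump:
  assumes m: "m \<ge> 1" and X: "X \<ge> 1" and z: "z \<ge> 1" "\<not> near_jump m X z"
    and d: "phase m (real d) \<delta>" "\<bar>\<delta>\<bar> \<le> 1 / real X ^ 4"
  shows "digit_incr m (z + d) = digit_incr m z"
proof (rule digit_incr_shift_eq[OF m z(1) d, of "1 / real X ^ 2" "real (jump_range m X)"])
  show "1 / real X ^ 2 > 0" using X by simp
  show "\<bar>w\<bar> > 1 / real X ^ 2" if "phase m (real z) w" for w
    using z(2) that unfolding near_jump_def by force
  show "\<bar>w\<bar> > 1 / real X ^ 4" if "real (qd m l) \<le> real (jump_range m X)" "phase m (real z + real (qd m l)) w" for l w
    using z(2) that unfolding near_jump_def by (meson not_le of_nat_le_iff)
  have "1 / (alpha m * (1 - alpha m) * (1 / real X ^ 2)) = real X ^ 2 / (alpha m * (1 - alpha m))" by simp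
  also have "\<dots> \<le> real (jump_range m X)" unfolding jump_range_def by linarith
  finally show "1 / (alpha m * (1 - alpha m) * (1 / real X ^ 2)) \<le> real (jump_range m X)" .
qed

lemma card_near_jump:
  assumes m: "m \<ge> 1"
  obtains C :: real where "C > 0"
    "\<And>X N. X \<ge> 1 \<Longrightarrow> real (card {z. z < N \<and> near_jump m X z}) \<le> C * (real N / real X ^ 2 + real X ^ 2)"
proof -
  have a: "0 < alpha m" "alpha m < 1" using alpha_pos[OF m] alpha_lt1[OF m] .
  define c where "c = 1 / (alpha m * (1 - alpha m)) + 2"
  have c: "c > 0" using a by (simp add: c_def add_pos_pos)
  define C where "C = 2 * (real m + 3) * (1 + c)"
  show ?thesis
  proof (rule that[of C])
    show "C > 0" using c by (simp add: C_def)
  next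
    fix X N :: nat assume X: "X \<ge> 1"
    define x where "x = real X"
    have x: "x \<ge> 1" using X by (simp add: x_def)
    define J where "J = jump_range m X"
    define A where "A i \<eta> = {z. z < N \<and> (\<exists>w. phase m (real z + real i) w \<and> \<bar>w\<bar> \<le> \<eta>)}" for i :: nat and \<eta> :: real
    have "{z. z < N \<and> near_jump m X z} = A 0 (1 / x ^ 2) \<union> (\<Union>i\<in>{..J}. A i (1 / x ^ 4))"
      unfolding near_jump_def A_def J_def x_def by auto
    hence "card {z. z < N \<and> near_jump m X z} \<le> card (A 0 (1 / x ^ 2)) + card (\<Union>i\<in>{..J}. A i (1 / x ^ 4))"
      by (simp only: card_Un_le)
    also have "card (\<Union>i\<in>{..J}. A i (1 / x ^ 4)) \<le> (\<Sum>i\<le>J. card (A i (1 / x ^ 4)))" by (rule card_UN_le) simp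
    finally have "real (card {z. z < N \<and> near_jump m X z}) \<le> real (card (A 0 (1 / x ^ 2))) + (\<Sum>i\<le>J. real (card (A i (1 / x ^ 4))))"
      by (simp flip: of_nat_sum of_nat_add)
    also have "\<dots> \<le> (2 * (real m + 3) * (1 / x ^ 2) * real N + 1) + (\<Sum>i\<le>J. 2 * (real m + 3) * (1 / x ^ 4) * real N + 1)"
      unfolding A_def using x by (intro add_mono sum_mono card_small_phase[OF m]) auto
    also have "\<dots> = (2 * (real m + 3) * (1 / x ^ 2) * real N + 1) + (real J + 1) * (2 * (real m + 3) * (1 / x ^ 4) * real N + 1)"
      by simp
    also have "\<dots> \<le> (2 * (real m + 3) * (1 / x ^ 2) * real N + x ^ 2) + (c * x ^ 2) * (2 * (real m + 3) * (1 / x ^ 4) * real N + 1)"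
    proof (rule add_mono[OF add_left_mono mult_right_mono])
      show x2: "1 \<le> x ^ 2" using x by (rule one_le_power)
      have "x ^ 2 / (alpha m * (1 - alpha m)) \<ge> 0" using a by simp
      hence "real J \<le> x ^ 2 / (alpha m * (1 - alpha m)) + 1" unfolding J_def jump_range_def x_def by linarith
      hence "real J + 1 \<le> x ^ 2 / (alpha m * (1 - alpha m)) + 2 * x ^ 2" using x2 by linarith
      thus "real J + 1 \<le> c * x ^ 2" unfolding c_def distrib_right by simp
      show "0 \<le> 2 * (real m + 3) * (1 / x ^ 4) * real N + 1" by (intro add_nonneg_nonneg mult_nonneg_nonneg) auto
    qed
    also have "\<dots> = 2 * (real m + 3) * (1 + c) * (real N / x ^ 2) + (1 + c) * x ^ 2"
    proof -
      have "x ^ 2 * (1 / x ^ 4) = 1 / x ^ 2" using x by (simp add: power2_eq_square power4_eq_xxxx)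
      moreover have "(c * x ^ 2) * (s * q * r + 1) = c * s * r * (x ^ 2 * q) + c * x ^ 2" for s q r
        by (simp add: algebra_simps)
      ultimately have "(c * x ^ 2) * (2 * (real m + 3) * (1 / x ^ 4) * real N + 1)
          = c * (2 * (real m + 3)) * real N * (1 / x ^ 2) + c * x ^ 2" by (simp only:)
      thus ?thesis by (simp add: algebra_simps)
    qed
    also have "\<dots> \<le> C * (real N / x ^ 2) + C * x ^ 2"
    proof -
      have "1 * (1 + c) \<le> 2 * (real m + 3) * (1 + c)" using c by (intro mult_right_mono) auto
      hence "(1 + c) * x ^ 2 \<le> C * x ^ 2" unfolding C_def by (intro mult_right_mono) auto
      thus ?thesis by (simp add: C_def)
    qed
    finally show "real (card {z. z < N \<and> near_jump m X z}) \<le> C * (real N / real X ^ 2 + real X ^ 2)"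
      unfolding x_def distrib_left .
  qed
qed

lemma sum_shift_error:
  fixes f :: "nat \<Rightarrow> complex"
  assumes "\<And>n. cmod (f n) \<le> 1"
  shows "cmod ((\<Sum>n<N. f (n + k)) - (\<Sum>n<N. f n)) \<le> 2 * real k"
proof (induction k)
  case (Suc k)
  have "(\<Sum>n<N. f (n + Suc k)) - (\<Sum>n<N. f (n + k)) = f (N + k) - f k"
    using sum_lessThan_telescope[of "\<lambda>n. f (n + k)" N] by (simp add: sum_subtractf)
  moreover have "cmod (f (N + k) - f k) \<le> 1 + 1"
    using norm_triangle_ineq4[of "f (N + k)" "f k"] assms[of "N + k"] assms[of k] by linarith
  moreover have "(\<Sum>n<N. f (n + Suc k)) - (\<Sum>n<N. f n)
      = ((\<Sum>n<N. f (n + Suc k)) - (\<Sum>n<N. f (n + k))) + ((\<Sum>n<N. f (n + k)) - (\<Sum>n<N. f n))" by simp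
  ultimately have "cmod ((\<Sum>n<N. f (n + Suc k)) - (\<Sum>n<N. f n)) \<le> (1 + 1) + 2 * real k"
    using Suc.IH by (metis norm_triangle_mono)
  thus ?case by simp
qed simp

context
  fixes m1 m2 :: nat and \<theta> \<beta> :: real
  assumes m: "m1 \<ge> 2" "m2 \<ge> 2" and \<beta>: "real m2 * \<beta> \<notin> \<int>"
    and indep: "\<And>h r p::int. h \<noteq> 0 \<or> r \<noteq> 0 \<Longrightarrow> of_int h * alpha m1 + of_int r * alpha m2 + of_int p \<noteq> 0"
begin

text \<open>Write e d = e + e (d - 1). On the window, e d changes the first digit sum by a constant
  depending on e only, and e (d - 1) does the same to the second. So the summand is a(j) b(e) g(j +
  e), with g from the second system alone.\<close>

lemma good_window_bound:
  assumes X: "X \<ge> 1" and d: "d \<ge> 1" "phase m1 (real d) w1" "\<bar>w1\<bar> \<le> 1 / real X ^ 5"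
      "phase m2 (real d - 1) w2" "\<bar>w2\<bar> \<le> 1 / real X ^ 5"
    and good: "\<And>z. n < z \<Longrightarrow> z \<le> n + 2 * X \<Longrightarrow> \<not> near_jump m1 X z \<and> \<not> near_jump m2 X z"
    and B: "\<And>t. cmod (\<Sum>i=n..<n + 2 * X. unit_exp (\<beta> * real (digit_sum m2 i)) * unit_exp (real i * t)) \<le> B"
  shows "cmod (\<Sum>j<X. \<Sum>e<X. joint_exp m1 m2 \<theta> \<beta> (n + j + e * d)) \<le> B * real X"
proof -
  have m': "m1 \<ge> 1" "m2 \<ge> 1" using m by auto
  define d' where "d' = d - 1"
  have ed: "e * d = e + e * d'" for e using d(1) by (cases d) (auto simp: d'_def)
  have small: "phase M (real (e * k)) (real e * w) \<and> \<bar>real e * w\<bar> \<le> 1 / real X ^ 4"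
    if "phase M (real k) w" "\<bar>w\<bar> \<le> 1 / real X ^ 5" "e < X" for M e k w
  proof
    show "phase M (real (e * k)) (real e * w)" using phase_mult_nat[OF that(1), of e] by simp
    have "\<bar>real e * w\<bar> \<le> real X * (1 / real X ^ 5)" unfolding abs_mult using that by (intro mult_mono) auto
    also have "\<dots> = 1 / real X ^ 4" using X by (simp add: numeral_eq_Suc)
    finally show "\<bar>real e * w\<bar> \<le> 1 / real X ^ 4" .
  qed
  have ph': "phase m2 (real d') w2" using d by (simp add: d'_def of_nat_diff)
  have S1: "int (digit_sum m1 (n + j + e * d)) - int (digit_sum m1 (n + j)) = int (digit_sum m1 (n + e * d)) - int (digit_sum m1 n)"
    if "j < X" "e < X" for j e
    using that small[OF d(2,3) that(2)] good
    by (intro digit_sum_shift_const digit_incr_shift_not_near_jump[OF m'(1) X]) auto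
  have S2: "int (digit_sum m2 (n + (j + e) + e * d')) - int (digit_sum m2 (n + (j + e))) = int (digit_sum m2 (n + e * d')) - int (digit_sum m2 n)"
    if "j < X" "e < X" for j e
    using that small[OF ph' d(5) that(2)] good
    by (intro digit_sum_shift_const digit_incr_shift_not_near_jump[OF m'(2) X]) auto
  define a where "a j = unit_exp (\<theta> * real (digit_sum m1 (n + j)))" for j
  define b where "b e = unit_exp (\<theta> * (real (digit_sum m1 (n + e * d)) - real (digit_sum m1 n)) + \<beta> * (real (digit_sum m2 (n + e * d')) - real (digit_sum m2 n)))" for e
  define g where "g k = unit_exp (\<beta> * real (digit_sum m2 (n + k)))" for k
  have "joint_exp m1 m2 \<theta> \<beta> (n + j + e * d) = a j * b e * g (j + e)"
    if "j < X" "e < X" for j e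
  proof -
    have "real (digit_sum m1 (n + j + e * d)) = real (digit_sum m1 (n + j)) + (real (digit_sum m1 (n + e * d)) - real (digit_sum m1 n))"
      using arg_cong[OF S1[OF that], of real_of_int] by simp
    moreover have "real (digit_sum m2 (n + j + e * d)) = real (digit_sum m2 (n + (j + e))) + (real (digit_sum m2 (n + e * d')) - real (digit_sum m2 n))"
      using arg_cong[OF S2[OF that], of real_of_int] by (simp add: ed add_ac)
    ultimately have "\<theta> * real (digit_sum m1 (n + j + e * d)) + \<beta> * real (digit_sum m2 (n + j + e * d))
        = \<theta> * real (digit_sum m1 (n + j)) + (\<theta> * (real (digit_sum m1 (n + e * d)) - real (digit_sum m1 n)) + \<beta> * (real (digit_sum m2 (n + e * d')) - real (digit_sum m2 n)))
          + \<beta> * real (digit_sum m2 (n + (j + e)))"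
      by (simp only: distrib_left)
    thus ?thesis unfolding a_def b_def g_def unit_exp_add[symmetric] by (simp only:)
  qed
  hence "(\<Sum>j<X. \<Sum>e<X. joint_exp m1 m2 \<theta> \<beta> (n + j + e * d))
      = (\<Sum>j<X. \<Sum>e<X. a j * b e * g (j + e))" by (intro sum.cong refl) auto
  also have "cmod \<dots> \<le> B * real X"
  proof (rule bilinear_bound)
    fix t
    have "(\<Sum>i=n..<n + 2 * X. unit_exp (\<beta> * real (digit_sum m2 i)) * unit_exp (real i * t))
        = (\<Sum>k<2 * X. unit_exp (\<beta> * real (digit_sum m2 (n + k))) * unit_exp (real (n + k) * t))"
      using sum.shift_bounds_nat_ivl[of "\<lambda>i. unit_exp (\<beta> * real (digit_sum m2 i)) * unit_exp (real i * t)" 0 n "2 * X"]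
      by (simp add: lessThan_atLeast0 add.commute)
    also have "\<dots> = unit_exp (real n * t) * (\<Sum>k<2 * X. g k * unit_exp (real k * t))"
      unfolding sum_distrib_left g_def by (intro sum.cong refl) (simp add: distrib_right unit_exp_add)
    finally show "cmod (\<Sum>k<2 * X. g k * unit_exp (real k * t)) \<le> B" using B[of t] by (simp add: norm_mult)
  qed (auto simp: a_def b_def)
  finally show ?thesis .
qed

text \<open>Average over the X^2 shifts j + e d. Windows free of near jumps are bilinear; the
  others, O(N / X + X^3) in number, are estimated trivially. The shifts cost O(X d) at the ends,
  whence X^51.\<close>

lemma nonresonant_bound:
  obtains C \<delta> :: real where "C > 0" "0 < \<delta>" "\<delta> < 1"
    "\<And>X N. X \<ge> m2 + 4 \<Longrightarrow> cmod (\<Sum>n<N. joint_exp m1 m2 \<theta> \<beta> n)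
       \<le> C * (real N * real X powr (- \<delta>) + real X ^ 51)"
proof -
  have m': "m1 \<ge> 1" "m2 \<ge> 1" using m by auto
  obtain K \<delta> where K: "K > 0" "0 < \<delta>" "\<delta> < 1" and
    bd: "\<And>a n t. n \<ge> 1 \<Longrightarrow> cmod (\<Sum>i=a..<a + n. unit_exp (\<beta> * real (digit_sum m2 i)) * unit_exp (real i * t))
       \<le> K * real n powr (1 - \<delta>)"
    by (rule single_power_saving[OF m(2) \<beta>]) blast
  obtain E where E: "E > 0" and shift: "\<And>X::nat. X \<ge> m2 + 4 \<Longrightarrow> \<exists>d w1 w2. d \<ge> 1 \<and> real d \<le> E * real X ^ 50 \<and>
       phase m1 (real d) w1 \<and> \<bar>w1\<bar> \<le> 1 / real X ^ 5 \<and> phase m2 (real d - 1) w2 \<and> \<bar>w2\<bar> \<le> 1 / real X ^ 5"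
    by (rule simultaneous_shift[OF m' indep]) blast+
  obtain C1 where C1: "C1 > 0"
    "\<And>X N. X \<ge> 1 \<Longrightarrow> real (card {z. z < N \<and> near_jump m1 X z}) \<le> C1 * (real N / real X ^ 2 + real X ^ 2)"
    by (rule card_near_jump[OF m'(1)]) blast
  obtain C2 where C2: "C2 > 0"
    "\<And>X N. X \<ge> 1 \<Longrightarrow> real (card {z. z < N \<and> near_jump m2 X z}) \<le> C2 * (real N / real X ^ 2 + real X ^ 2)"
    by (rule card_near_jump[OF m'(2)]) blast
  define C3 where "C3 = C1 + C2"
  define C where "C = 2 * K + 6 * C3 + 2 + 2 * E"
  have C3: "C3 > 0" using C1 C2 by (simp add: C3_def)
  define f where "f n = joint_exp m1 m2 \<theta> \<beta> n" for n
  have main: "cmod (\<Sum>n<N. f n) \<le> C * (real N * real X powr (- \<delta>) + real X ^ 51)" if X: "X \<ge> m2 + 4" for X N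
  proof -
    have X1: "X \<ge> 1" using X by simp
    define x where "x = real X"
    have x: "x \<ge> 1" using X1 by (simp add: x_def)
    obtain d w1 w2 where d: "d \<ge> 1" "real d \<le> E * x ^ 50" "phase m1 (real d) w1" "\<bar>w1\<bar> \<le> 1 / real X ^ 5"
      "phase m2 (real d - 1) w2" "\<bar>w2\<bar> \<le> 1 / real X ^ 5"
      using shift[OF X] unfolding x_def by blast
    define Bad where "Bad = {n. n < N \<and> (\<exists>z. n < z \<and> z \<le> n + 2 * X \<and> (near_jump m1 X z \<or> near_jump m2 X z))}"
    have finBad: "finite Bad" by (simp add: Bad_def)
    have cardBad: "real (card Bad) \<le> 2 * C3 * (real N / x) + 6 * C3 * x ^ 3"
    proof -
      define Q where "Q = {z. z < N + 2 * X + 1 \<and> near_jump m1 X z} \<union> {z. z < N + 2 * X + 1 \<and> near_jump m2 X z}"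
      have finQ: "finite Q" by (simp add: Q_def)
      have "Bad \<subseteq> (\<Union>k\<in>{1..2 * X}. {n. n + k \<in> Q})"
      proof
        fix n assume "n \<in> Bad"
        then obtain z where z: "n < N" "n < z" "z \<le> n + 2 * X" "near_jump m1 X z \<or> near_jump m2 X z"
          unfolding Bad_def by blast
        have "n + (z - n) \<in> Q" using z by (auto simp: Q_def)
        moreover have "z - n \<in> {1..2 * X}" using z by auto
        ultimately show "n \<in> (\<Union>k\<in>{1..2 * X}. {n. n + k \<in> Q})" by blast
      qed
      moreover have fin: "finite {n. n + k \<in> Q}" and le: "card {n. n + k \<in> Q} \<le> card Q" for k
      proof -
        have inj: "inj_on (\<lambda>n. n + k) {n. n + k \<in> Q}" by (simp add: inj_on_def)
        show "finite {n. n + k \<in> Q}" by (rule inj_on_finite[OF inj _ finQ]) auto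
        show "card {n. n + k \<in> Q} \<le> card Q" by (rule card_inj_on_le[OF inj _ finQ]) auto
      qed
      ultimately have "card Bad \<le> card (\<Union>k\<in>{1..2 * X}. {n. n + k \<in> Q})" by (intro card_mono) auto
      also have "\<dots> \<le> (\<Sum>k=1..2 * X. card {n. n + k \<in> Q})" by (rule card_UN_le) simp
      also have "\<dots> \<le> (\<Sum>k=1..2 * X. card Q)" by (intro sum_mono le)
      finally have "card Bad \<le> 2 * X * card Q" by simp
      hence "real (card Bad) \<le> real (2 * X * card Q)" unfolding of_nat_le_iff .
      also have "\<dots> = 2 * x * real (card Q)" by (simp add: x_def)
      also have "real (card Q) \<le> C3 * (real N / x ^ 2 + 3 * x ^ 2)"
      proof -
        have "card Q \<le> card {z. z < N + 2 * X + 1 \<and> near_jump m1 X z} + card {z. z < N + 2 * X + 1 \<and> near_jump m2 X z}"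
          unfolding Q_def by (rule card_Un_le)
        hence "real (card Q) \<le> real (card {z. z < N + 2 * X + 1 \<and> near_jump m1 X z}) + real (card {z. z < N + 2 * X + 1 \<and> near_jump m2 X z})"
          by (simp flip: of_nat_add)
        also have "\<dots> \<le> C1 * (real (N + 2 * X + 1) / real X ^ 2 + real X ^ 2) + C2 * (real (N + 2 * X + 1) / real X ^ 2 + real X ^ 2)"
          using X1 by (intro add_mono C1(2) C2(2))
        also have "\<dots> = C3 * (real (N + 2 * X + 1) / x ^ 2 + x ^ 2)" by (simp add: C3_def x_def distrib_right)
        also have "\<dots> \<le> C3 * (real N / x ^ 2 + 3 * x ^ 2)"
        proof (rule mult_left_mono)
          have "5 \<le> x" using X m by (simp add: x_def)
          hence "2 * x + 1 \<le> x * x" using mult_right_mono[of 5 x x] by linarith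
          hence "(2 * x + 1) / x ^ 2 \<le> 1" using x by (simp add: power2_eq_square)
          moreover have "1 \<le> x ^ 2" using x by (rule one_le_power)
          moreover have "real (N + 2 * X + 1) / x ^ 2 = real N / x ^ 2 + (2 * x + 1) / x ^ 2"
            by (simp add: x_def add_divide_distrib)
          ultimately show "real (N + 2 * X + 1) / x ^ 2 + x ^ 2 \<le> real N / x ^ 2 + 3 * x ^ 2" by linarith
        qed (use C3 in simp)
        finally show ?thesis .
      qed
      hence "2 * x * real (card Q) \<le> 2 * x * (C3 * (real N / x ^ 2 + 3 * x ^ 2))" using x by (intro mult_left_mono) auto
      also have "\<dots> = 2 * C3 * (real N / x) + 6 * C3 * x ^ 3"
        using x by (simp add: field_simps power2_eq_square power3_eq_cube)
      finally show ?thesis .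
    qed
    define B where "B = K * real (2 * X) powr (1 - \<delta>)"
    have B0: "B \<ge> 0" using K by (simp add: B_def)
    define W where "W n = (\<Sum>j<X. \<Sum>e<X. f (n + j + e * d))" for n
    have Wtriv: "cmod (W n) \<le> x ^ 2" for n
    proof -
      have "cmod (W n) \<le> (\<Sum>j<X. \<Sum>e<X. 1)" unfolding W_def by (intro sum_norm_le) (simp add: f_def)
      thus ?thesis by (simp add: x_def power2_eq_square)
    qed
    have Wgood: "cmod (W n) \<le> B * x" if "n < N" "n \<notin> Bad" for n
      unfolding W_def f_def x_def
    proof (rule good_window_bound[OF X1 d(1,3-6)])
      show "\<not> near_jump m1 X z \<and> \<not> near_jump m2 X z" if "n < z" "z \<le> n + 2 * X" for z
        using \<open>n \<notin> Bad\<close> \<open>n < N\<close> that unfolding Bad_def by blast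
      show "cmod (\<Sum>i=n..<n + 2 * X. unit_exp (\<beta> * real (digit_sum m2 i)) * unit_exp (real i * t)) \<le> B" for t
        unfolding B_def using X1 by (intro bd) simp
    qed
    have "cmod (\<Sum>n<N. W n) \<le> (\<Sum>n<N. B * x + (if n \<in> Bad then x ^ 2 else 0))"
    proof (rule sum_norm_le)
      fix n assume "n \<in> {..<N}"
      thus "cmod (W n) \<le> B * x + (if n \<in> Bad then x ^ 2 else 0)"
        using Wtriv[of n] Wgood[of n] B0 x by (cases "n \<in> Bad") (auto intro: add_increasing)
    qed
    also have "\<dots> = real N * (B * x) + real (card Bad) * x ^ 2"
    proof -
      have "{..<N} \<inter> Bad = Bad" by (auto simp: Bad_def)
      thus ?thesis by (simp add: sum.distrib sum.If_cases)
    qed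
    finally have W: "cmod (\<Sum>n<N. W n) \<le> real N * (B * x) + real (card Bad) * x ^ 2" .
    have "(\<Sum>n<N. W n) = (\<Sum>j<X. \<Sum>e<X. \<Sum>n<N. f (n + (j + e * d)))"
      unfolding W_def add.assoc by (subst sum.swap) (intro sum.cong refl sum.swap)
    hence "(\<Sum>n<N. W n) - of_nat (X * X) * (\<Sum>n<N. f n) = (\<Sum>j<X. \<Sum>e<X. (\<Sum>n<N. f (n + (j + e * d))) - (\<Sum>n<N. f n))"
      by (simp add: sum_subtractf)
    also have "cmod \<dots> \<le> (\<Sum>j<X. \<Sum>e<X. 2 * (x + x * real d))"
    proof (intro sum_norm_le)
      fix j e assume je: "j \<in> {..<X}" "e \<in> {..<X}"
      have "cmod ((\<Sum>n<N. f (n + (j + e * d))) - (\<Sum>n<N. f n)) \<le> 2 * real (j + e * d)"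
        by (rule sum_shift_error) (simp add: f_def)
      also have "real (j + e * d) \<le> x + x * real d"
        using je unfolding of_nat_add of_nat_mult x_def by (intro add_mono mult_right_mono) auto
      finally show "cmod ((\<Sum>n<N. f (n + (j + e * d))) - (\<Sum>n<N. f n)) \<le> 2 * (x + x * real d)" by simp
    qed
    also have "\<dots> = x ^ 2 * (2 * (x + x * real d))" by (simp add: x_def power2_eq_square)
    finally have "cmod (of_nat (X * X) * (\<Sum>n<N. f n)) \<le> cmod (\<Sum>n<N. W n) + x ^ 2 * (2 * (x + x * real d))"
      using norm_triangle_ineq3[of "\<Sum>n<N. W n" "of_nat (X * X) * (\<Sum>n<N. f n)"] by linarith
    moreover have "cmod (of_nat (X * X) * (\<Sum>n<N. f n)) = x ^ 2 * cmod (\<Sum>n<N. f n)"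
      by (simp add: norm_mult x_def power2_eq_square)
    ultimately have "x ^ 2 * cmod (\<Sum>n<N. f n) \<le> real N * (B * x) + real (card Bad) * x ^ 2 + x ^ 2 * (2 * (x + x * real d))"
      using W by linarith
    also have "\<dots> = x ^ 2 * (real N * (B / x) + real (card Bad) + 2 * (x + x * real d))"
      using x by (simp add: power2_eq_square field_simps)
    finally have "cmod (\<Sum>n<N. f n) \<le> real N * (B / x) + real (card Bad) + 2 * (x + x * real d)"
      using x by (simp add: mult_le_cancel_left_pos)
    also have "\<dots> \<le> real N * (2 * K * x powr (- \<delta>)) + (2 * C3 * (real N * x powr (- \<delta>)) + 6 * C3 * x ^ 51) + (2 + 2 * E) * x ^ 51"
    proof (intro add_mono mult_left_mono)
      have "B = K * (2 powr (1 - \<delta>) * x powr (1 - \<delta>))" using x by (simp add: B_def x_def powr_mult)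
      moreover have "(2::real) powr (1 - \<delta>) \<le> 2 powr 1" using K by (intro powr_mono) auto
      moreover have "x powr (1 - \<delta>) = x * x powr (- \<delta>)" using x by (simp add: powr_diff powr_minus field_simps)
      ultimately have "B \<le> K * (2 * (x * x powr (- \<delta>)))" using K x by (intro order.trans[OF eq_refl mult_left_mono[OF mult_mono]]) auto
      thus "B / x \<le> 2 * K * x powr (- \<delta>)" using x by (simp add: divide_le_eq mult_ac)
      have "real N / x = real N * x powr (- 1)" using x by (simp add: powr_minus divide_inverse)
      also have "\<dots> \<le> real N * x powr (- \<delta>)" using x K by (intro mult_left_mono powr_mono) auto
      finally have "2 * C3 * (real N / x) \<le> 2 * C3 * (real N * x powr (- \<delta>))" using C3 by (intro mult_left_mono) auto
      moreover have "6 * C3 * x ^ 3 \<le> 6 * C3 * x ^ 51" using C3 x by (intro mult_left_mono power_increasing) auto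
      ultimately show "real (card Bad) \<le> 2 * C3 * (real N * x powr (- \<delta>)) + 6 * C3 * x ^ 51" using cardBad by linarith
      have "x \<le> x ^ 51" using x power_increasing[of 1 51 x] by simp
      moreover have "x * real d \<le> x * (E * x ^ 50)" using d(2) x by (intro mult_left_mono) auto
      moreover have "x * (E * x ^ 50) = E * x ^ 51" by (simp add: power_Suc[of x 50, symmetric])
      ultimately show "2 * (x + x * real d) \<le> (2 + 2 * E) * x ^ 51" by (simp add: distrib_left distrib_right)
    qed auto
    also have "\<dots> = (2 * K + 2 * C3) * (real N * x powr (- \<delta>)) + (6 * C3 + 2 + 2 * E) * x ^ 51"
      by (simp add: algebra_simps)
    also have "\<dots> \<le> C * (real N * x powr (- \<delta>)) + C * x ^ 51"
      using K C3 E x by (intro add_mono mult_right_mono) (auto simp: C_def)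
    finally show ?thesis by (simp add: x_def distrib_left)
  qed
  show ?thesis
  proof (rule that[of C \<delta>])
    show "C > 0" using K C3 E by (simp add: C_def)
  qed (use K main in \<open>auto simp: f_def\<close>)
qed

end

section \<open>The alternative between linear dependence and independence\<close>

theorem theorem1p1:
  fixes m1 m2 :: nat and \<alpha>1 \<alpha>2 \<theta> \<beta> :: real
  assumes "m1 \<ge> 2" and "m2 \<ge> 2" and "m1 \<noteq> m2"
    and "has_cf_expansion \<alpha>1 (cf_1m m1)"
    and "has_cf_expansion \<alpha>2 (cf_1m m2)"
    and "real m2 * \<beta> \<notin> \<int>"
  shows "\<exists>\<delta>>0. (\<lambda>N. cmod (\<Sum>n<N. unit_exp (\<theta> * real (ostrowski_sum_of_digits \<alpha>1 n)
                                     + \<beta> * real (ostrowski_sum_of_digits \<alpha>2 n))))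
                 \<in> O(\<lambda>N. real N powr (1 - \<delta>))"
proof -
  define F where "F N = cmod (\<Sum>n<N. joint_exp m1 m2 \<theta> \<beta> n)" for N
  have m': "m1 \<ge> 1" "m2 \<ge> 1" using assms by auto
  have "\<exists>\<delta>>0. F \<in> O(\<lambda>N. real N powr (1 - \<delta>))"
  proof (cases "\<exists>h r p::int. (h \<noteq> 0 \<or> r \<noteq> 0) \<and> of_int h * alpha m1 + of_int r * alpha m2 + of_int p = 0")
    case True
    then obtain h r p :: int where hr: "h \<noteq> 0 \<or> r \<noteq> 0" "of_int h * alpha m1 + of_int r * alpha m2 + of_int p = 0" by blast
    have rat: "k = 0" if "of_int k * alpha M + of_int p = 0" "M \<ge> 1" for k :: int and M
    proof (rule ccontr)
      assume "k \<noteq> 0"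
      hence "alpha M = - of_int p / of_int k" using that(1) by (simp add: field_simps)
      hence "alpha M \<in> \<rat>" by simp
      thus False using alpha_irrational[OF that(2)] by simp
    qed
    \<comment> \<open>If one coefficient vanished, the remaining irrational would be rational.
      Multiplying by \<open>sgn h\<close> then makes the coefficient of \<open>alpha m1\<close>
      positive.\<close>
    have "h \<noteq> 0" using hr rat[of r m2] m' by auto
    moreover have "r \<noteq> 0" using hr rat[of h m1] m' by auto
    moreover have "of_int (sgn h * h) * alpha m1 = of_int (- sgn h * p) + of_int (- sgn h * r) * alpha m2"
    proof -
      have "of_int h * alpha m1 = - of_int p - of_int r * alpha m2" using hr(2) by linarith
      hence "of_int (sgn h) * (of_int h * alpha m1) = of_int (sgn h) * (- of_int p - of_int r * alpha m2)" by simp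
      thus ?thesis by (simp add: right_diff_distrib mult.assoc)
    qed
    ultimately obtain K \<delta> where K: "K > 0" "0 < \<delta>" "\<delta> < 1" and
      bd: "\<And>a n t. n \<ge> 1 \<Longrightarrow> cmod (\<Sum>i=a..<a + n. joint_exp m1 m2 \<theta> \<beta> i * unit_exp (real i * t))
       \<le> K * real n powr (1 - \<delta>)"
      using resonant_power_saving[OF assms(1-3,6), of "sgn h * h" "- sgn h * r" "- sgn h * p" \<theta>]
      by (auto simp: sgn_if split: if_splits)
    have "F \<in> O(\<lambda>N. real N powr (1 - \<delta>))"
    proof (rule bigoI[of _ K], rule eventually_mono[OF eventually_ge_at_top[of 1]])
      fix N :: nat assume "N \<ge> 1"
      thus "norm (F N) \<le> K * norm (real N powr (1 - \<delta>))"
        using bd[of N 0 0] by (simp add: F_def lessThan_atLeast0)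
    qed
    thus ?thesis using K by blast
  next
    case False
    obtain C \<delta> where C: "C > 0" "0 < \<delta>" "\<delta> < 1" and
      bd: "\<And>X N. X \<ge> m2 + 4 \<Longrightarrow> F N \<le> C * (real N * real X powr (- \<delta>) + real X ^ 51)"
      unfolding F_def by (rule nonresonant_bound[OF assms(1,2,6)]) (use False in blast)+
    \<comment> \<open>With X about N^(1/102), the term X^51 is about N^(1/2) and X^(-\<delta>) is
      about N^(-\<delta>/102).\<close>
    define \<epsilon> where "\<epsilon> = \<delta> / 102"
    have \<epsilon>: "0 < \<epsilon>" "\<epsilon> \<le> 1 / 2" using C by (auto simp: \<epsilon>_def)
    have "F \<in> O(\<lambda>N. real N powr (1 - \<epsilon>))"
    proof (rule bigoI[of _ "3 * C"], rule eventually_mono[OF eventually_ge_at_top[of "(m2 + 4) ^ 102"]])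
      fix N :: nat assume N: "N \<ge> (m2 + 4) ^ 102"
      define y where "y = real N powr (1 / 102)"
      have N1: "real N \<ge> 1" using N by (metis le_trans of_nat_1 of_nat_le_iff one_le_power le_add2 add_leD2 one_le_numeral)
      have "real ((m2 + 4) ^ 102) \<le> real N" using N unfolding of_nat_le_iff .
      hence "real ((m2 + 4) ^ 102) powr (1 / 102) \<le> y" unfolding y_def by (intro powr_mono2) auto
      moreover have "real ((m2 + 4) ^ 102) powr (1 / 102) = real (m2 + 4)"
      proof -
        have "real ((m2 + 4) ^ 102) = real (m2 + 4) powr 102" unfolding of_nat_power by (rule powr_realpow[symmetric, of _ 102, simplified]) simp
        thus ?thesis by (simp only: powr_powr) simp
      qed
      ultimately have y: "y \<ge> real (m2 + 4)" by simp
      define X where "X = nat \<lfloor>y\<rfloor>"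
      have X: "X \<ge> m2 + 4" "real X \<le> y" "y \<le> 2 * real X"
        using y unfolding X_def by linarith+
      have "real X ^ 51 \<le> y ^ 51" using X by (intro power_mono) auto
      also have "\<dots> = real N powr (1 / 2)"
        using N1 unfolding y_def by (subst powr_power) auto
      also have "\<dots> \<le> real N powr (1 - \<epsilon>)" using N1 \<epsilon> by (intro powr_mono) auto
      finally have t2: "real X ^ 51 \<le> real N powr (1 - \<epsilon>)" .
      have "real X powr (- \<delta>) \<le> (y / 2) powr (- \<delta>)" using X y C by (intro powr_mono2') auto
      also have "\<dots> = 2 powr \<delta> * y powr (- \<delta>)" using y by (simp add: powr_divide powr_minus field_simps)
      also have "\<dots> \<le> 2 * y powr (- \<delta>)"
        using C powr_mono[of \<delta> 1 2] by (intro mult_right_mono) auto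
      also have "y powr (- \<delta>) = real N powr (- \<epsilon>)" by (simp add: y_def powr_powr \<epsilon>_def)
      finally have "real N * real X powr (- \<delta>) \<le> real N * (2 * real N powr (- \<epsilon>))" by (intro mult_left_mono) auto
      also have "\<dots> = 2 * real N powr (1 - \<epsilon>)" using N1 by (simp add: powr_diff powr_minus field_simps)
      finally have "real N * real X powr (- \<delta>) + real X ^ 51 \<le> 3 * real N powr (1 - \<epsilon>)" using t2 by linarith
      hence "C * (real N * real X powr (- \<delta>) + real X ^ 51) \<le> C * (3 * real N powr (1 - \<epsilon>))" using C by (intro mult_left_mono) auto
      moreover have "F N \<ge> 0" by (simp add: F_def)
      ultimately show "norm (F N) \<le> 3 * C * norm (real N powr (1 - \<epsilon>))" using bd[OF X(1), of N] by simp
    qed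
    thus ?thesis using \<epsilon> by blast
  qed
  thus ?thesis
    unfolding F_def ostrowski_sum_of_digits_eq[OF assms(4)] ostrowski_sum_of_digits_eq[OF assms(5)] .
qed

end
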